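(* Let $V=\mathbb R^n$, $\varepsilon\in\mathbb R$, and let $P^{\mathbb C}\subset(T^*V)^{\mathbb C}\cong\mathbb C^{2n}$, its holomorphic Poisson bracket $\{\cdot,\cdot\}$ and its anti-holomorphic involution $\psi$ be as defined in the context. Let $P=\{z\in P^{\mathbb C}:\psi(z)=z\}$. Then $P$ carries the structure of a real analytic Poisson manifold, in which the Poisson bracket of two real analytic functions $f_0,g_0$ on $P$ is $$\{f_0,g_0\}:=\{f,g\}|_P,$$ where $f,g$ are the (local) holomorphic extensions of $f_0,g_0$ to $P^{\mathbb C}$; in particular the restriction of $\{f,g\}$ to $P$ is real-valued.
   Context: Let $e_j{}^k$ be the matrix units ($e_j{}^kx=x^ke_j$), $M_j{}^k=e_j{}^k-e_k{}^j$, $j'=n+1-j$, and $a\wedge b=a\otimes b-b\otimes a$. The standard $r$-matrix on $so(n,\mathbb R)$ is $r=\varepsilon\sum_{j<k<j'}M_j{}^k\wedge M_k{}^{j'}$. Put $$s_\lambda=\varepsilon\sum_{j,k}\big(e_j{}^k\otimes e_k{}^j-e_j{}^k\otimes e_j{}^k+e_j{}^j\otimes e_k{}^k\big),\qquad w_\lambda=r-is_\lambda.$$ Components: $\rho=\sum\rho^{jk}_{lm}e_j{}^l\otimes e_k{}^m$. On $(T^*V)^{\mathbb C}\cong\mathbb C^{2n}$ with holomorphic coordinates $x^j,p_j$, the holomorphic Poisson structure is given by (summation convention) $$\{x^j,x^k\}=r^{jk}_{lm}x^lx^m,\qquad \{p_l,p_m\}=p_jp_kr^{jk}_{lm},\qquad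 \{p_l,x^k\}=\delta_l^k-p_j(w_\lambda)^{jk}_{lm}x^m.$$ Indices are raised and lowered with the Euclidean metric $\delta_{jk}$; $x^2=\sum_j x^jx^j$, $p^2=\sum_jp_jp_j$, $E=\sum_jp_jx^j$, and $\Lambda=1+2i\varepsilon E-\varepsilon^2x^2p^2$. $P^{\mathbb C}=\{(x,p)\in(T^*V)^{\mathbb C}:\Lambda\ne0\}$. The anti-holomorphic involution $\psi\colon P^{\mathbb C}\to P^{\mathbb C}$ is $\psi(x,p)=(\overline{x},\overline{T/\Lambda})$ with $T_j=p_j+i\varepsilon p^2x_j$. *)

theory Defs
  imports "HOL-Analysis.Analysis"
begin

text \<open>Multi-indices are extensional functions from the standard basis to the naturals.\<close>

definition real_analytic_at :: "('a::euclidean_space \<Rightarrow> 'b::euclidean_space) \<Rightarrow> 'a \<Rightarrow> bool" where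
  "real_analytic_at f a \<longleftrightarrow>
     (\<exists>r>0. \<exists>c::('a \<Rightarrow> nat) \<Rightarrow> 'b.
        \<forall>h. (\<forall>b\<in>Basis. \<bar>h \<bullet> b\<bar> < r) \<longrightarrow>
          ((\<lambda>\<alpha>. (\<Prod>b\<in>Basis. (h \<bullet> b) ^ \<alpha> b) *\<^sub>R c \<alpha>) has_sum f (a + h)) (Basis \<rightarrow>\<^sub>E UNIV))"

text \<open>On an arbitrary subset of a Euclidean space a map is analytic if it locally is the
  restriction of an analytic map defined on an open set of the ambient space.\<close>

definition real_analytic_on :: "('a::euclidean_space \<Rightarrow> 'b::euclidean_space) \<Rightarrow> 'a set \<Rightarrow> bool" where
  "real_analytic_on f X \<longleftrightarrow>
     (\<forall>a\<in>X. \<exists>N F. open N \<and> a \<in> N \<and> (\<forall>y\<in>N. real_analytic_at F y) \<and> (\<forall>y\<in>N \<inter> X. F y = f y))"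

text \<open>Embedded real analytic submanifolds of a Euclidean space: each point has a relatively open
  neighbourhood that is analytically diffeomorphic to an open subset of the model space. Since
  charts and their inverses are analytic in the above sense, all changes of charts are analytic,
  and the analytic functions on \<open>M\<close> are those that are analytic in the charts.\<close>

definition real_analytic_submanifold ::
  "'a::euclidean_space set \<Rightarrow> 'c::euclidean_space itself \<Rightarrow> bool" where
  "real_analytic_submanifold M model \<longleftrightarrow>
     (\<forall>z\<in>M. \<exists>U (W::'c set) \<kappa> \<phi>.
        z \<in> U \<and> openin (top_of_set M) U \<and> open W \<and>
        \<kappa> ` U = W \<and> \<phi> ` W = U \<and> (\<forall>y\<in>U. \<phi> (\<kappa> y) = y) \<and> (\<forall>t\<in>W. \<kappa> (\<phi> t) = t) \<and>
        real_analytic_on \<kappa> U \<and> real_analytic_on \<phi> W)"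

text \<open>The bracket is a bracket on the sheaf of real analytic functions: \<open>br U f g\<close> is the bracket
  of two analytic functions on the open subset \<open>U\<close> of \<open>M\<close>. Values of functions
  outside of \<open>U\<close> are irrelevant.\<close>

locale real_analytic_poisson_manifold =
  fixes M :: "'a::euclidean_space set"
    and model :: "'c::euclidean_space itself"
    and br :: "'a set \<Rightarrow> ('a \<Rightarrow> real) \<Rightarrow> ('a \<Rightarrow> real) \<Rightarrow> 'a \<Rightarrow> real"
  assumes manifold: "real_analytic_submanifold M model"
    and br_analytic:
      "\<lbrakk>openin (top_of_set M) U; real_analytic_on f U; real_analytic_on g U\<rbrakk>
        \<Longrightarrow> real_analytic_on (br U f g) U"
    and br_local:
      "\<lbrakk>openin (top_of_set M) U; openin (top_of_set M) V; V \<subseteq> U;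
        real_analytic_on f U; real_analytic_on g U; real_analytic_on f' V; real_analytic_on g' V;
        \<forall>y\<in>V. f' y = f y; \<forall>y\<in>V. g' y = g y; z \<in> V\<rbrakk>
        \<Longrightarrow> br V f' g' z = br U f g z"
    and br_linear:
      "\<lbrakk>openin (top_of_set M) U;
        real_analytic_on f U; real_analytic_on g U; real_analytic_on h U; z \<in> U\<rbrakk>
        \<Longrightarrow> br U (\<lambda>y. a * f y + b * g y) h z = a * br U f h z + b * br U g h z"
    and br_antisym:
      "\<lbrakk>openin (top_of_set M) U; real_analytic_on f U; real_analytic_on g U; z \<in> U\<rbrakk>
        \<Longrightarrow> br U g f z = - br U f g z"
    and br_Leibniz:
      "\<lbrakk>openin (top_of_set M) U;
        real_analytic_on f U; real_analytic_on g U; real_analytic_on h U; z \<in> U\<rbrakk>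
        \<Longrightarrow> br U f (\<lambda>y. g y * h y) z = br U f g z * h z + g z * br U f h z"
    and br_Jacobi:
      "\<lbrakk>openin (top_of_set M) U;
        real_analytic_on f U; real_analytic_on g U; real_analytic_on h U; z \<in> U\<rbrakk>
        \<Longrightarrow> br U f (br U g h) z + br U g (br U h f) z + br U h (br U f g) z = 0"

text \<open>Points of the complexified cotangent bundle are pairs \<open>(x, p)\<close>. The index type is a finite
  linear order \<open>{1 < \<dots> < n}\<close> with \<open>n = CARD('n)\<close>.\<close>

type_synonym 'n phase = "(complex ^ 'n) \<times> (complex ^ 'n)"

definition holomorphic_phase :: "('n::finite phase \<Rightarrow> complex) \<Rightarrow> 'n phase set \<Rightarrow> bool" where
  "holomorphic_phase f N \<longleftrightarrow>
     (\<forall>z\<in>N. \<exists>D. (f has_derivative D) (at z) \<and>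
        (\<forall>c x p. D (c *s x, c *s p) = c * D (x, p)))"

definition partial_x :: "'n::finite \<Rightarrow> ('n phase \<Rightarrow> complex) \<Rightarrow> 'n phase \<Rightarrow> complex" where
  "partial_x j f z = deriv (\<lambda>t. f (fst z + axis j t, snd z)) 0"

definition partial_p :: "'n::finite \<Rightarrow> ('n phase \<Rightarrow> complex) \<Rightarrow> 'n phase \<Rightarrow> complex" where
  "partial_p j f z = deriv (\<lambda>t. f (fst z, snd z + axis j t)) 0"

definition position :: "'n::{finite,linorder} \<Rightarrow> nat" where
  "position j = card {i. i \<le> j}"

definition opposite :: "'n::{finite,linorder} \<Rightarrow> 'n" where
  "opposite j = (THE k. position k = CARD('n) + 1 - position j)"

text \<open>The entry in row \<open>a\<close> and column \<open>b\<close> of a matrix \<open>A\<close> is the coefficient of \<open>e\<^sub>a\<^sup>b\<close>.\<close>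

definition mat_unit :: "'n::finite \<Rightarrow> 'n \<Rightarrow> complex ^ 'n ^ 'n" where
  "mat_unit j k = (\<chi> a b. if a = j \<and> b = k then 1 else 0)"

definition M_gen :: "'n::finite \<Rightarrow> 'n \<Rightarrow> complex ^ 'n ^ 'n" where
  "M_gen j k = mat_unit j k - mat_unit k j"

text \<open>An element \<open>\<rho>\<close> of the tensor square of the matrices is given by its components:
  \<open>\<rho> j k l m\<close> is the coefficient of \<open>e\<^sub>j\<^sup>l \<otimes> e\<^sub>k\<^sup>m\<close>.\<close>

type_synonym 'n tensor2 = "'n \<Rightarrow> 'n \<Rightarrow> 'n \<Rightarrow> 'n \<Rightarrow> complex"

definition tensor :: "complex ^ 'n ^ 'n \<Rightarrow> complex ^ 'n ^ 'n \<Rightarrow> 'n::finite tensor2" where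
  "tensor A B j k l m = A $ j $ l * B $ k $ m"

definition wedge :: "complex ^ 'n ^ 'n \<Rightarrow> complex ^ 'n ^ 'n \<Rightarrow> 'n::finite tensor2" where
  "wedge A B j k l m = tensor A B j k l m - tensor B A j k l m"

definition r_mat :: "real \<Rightarrow> 'n::{finite,linorder} tensor2" where
  "r_mat \<epsilon> j k l m = of_real \<epsilon> *
     (\<Sum>(a, b)\<in>{(a, b). a < b \<and> b < opposite a}.
        wedge (M_gen a b) (M_gen b (opposite a)) j k l m)"

definition s_lam :: "real \<Rightarrow> 'n::finite tensor2" where
  "s_lam \<epsilon> j k l m = of_real \<epsilon> *
     (\<Sum>a\<in>UNIV. \<Sum>b\<in>UNIV.
        tensor (mat_unit a b) (mat_unit b a) j k l m
        - tensor (mat_unit a b) (mat_unit a b) j k l m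
        + tensor (mat_unit a a) (mat_unit b b) j k l m)"

definition w_lam :: "real \<Rightarrow> 'n::{finite,linorder} tensor2" where
  "w_lam \<epsilon> j k l m = r_mat \<epsilon> j k l m - \<i> * s_lam \<epsilon> j k l m"

definition bracket_xx :: "real \<Rightarrow> 'n::{finite,linorder} \<Rightarrow> 'n \<Rightarrow> 'n phase \<Rightarrow> complex" where
  "bracket_xx \<epsilon> j k = (\<lambda>(x, p). \<Sum>l\<in>UNIV. \<Sum>m\<in>UNIV. r_mat \<epsilon> j k l m * x $ l * x $ m)"

definition bracket_pp :: "real \<Rightarrow> 'n::{finite,linorder} \<Rightarrow> 'n \<Rightarrow> 'n phase \<Rightarrow> complex" where
  "bracket_pp \<epsilon> l m = (\<lambda>(x, p). \<Sum>j\<in>UNIV. \<Sum>k\<in>UNIV. p $ j * p $ k * r_mat \<epsilon> j k l m)"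

definition bracket_px :: "real \<Rightarrow> 'n::{finite,linorder} \<Rightarrow> 'n \<Rightarrow> 'n phase \<Rightarrow> complex" where
  "bracket_px \<epsilon> l k = (\<lambda>(x, p).
     (if l = k then 1 else 0) - (\<Sum>j\<in>UNIV. \<Sum>m\<in>UNIV. p $ j * w_lam \<epsilon> j k l m * x $ m))"

text \<open>The biderivation with the prescribed brackets of the coordinate functions.\<close>

definition hol_bracket ::
  "real \<Rightarrow> ('n::{finite,linorder} phase \<Rightarrow> complex) \<Rightarrow> ('n phase \<Rightarrow> complex) \<Rightarrow> 'n phase \<Rightarrow> complex"
where
  "hol_bracket \<epsilon> f g z =
     (\<Sum>j\<in>UNIV. \<Sum>k\<in>UNIV. partial_x j f z * partial_x k g z * bracket_xx \<epsilon> j k z)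
   + (\<Sum>l\<in>UNIV. \<Sum>m\<in>UNIV. partial_p l f z * partial_p m g z * bracket_pp \<epsilon> l m z)
   + (\<Sum>l\<in>UNIV. \<Sum>k\<in>UNIV.
        (partial_p l f z * partial_x k g z - partial_x k f z * partial_p l g z) * bracket_px \<epsilon> l k z)"

text \<open>Bilinear (not Hermitian) dot product, as needed for \<open>x\<^sup>2\<close>, \<open>p\<^sup>2\<close> and \<open>E\<close>.\<close>

definition dotc :: "complex ^ 'n \<Rightarrow> complex ^ 'n::finite \<Rightarrow> complex" where
  "dotc x y = (\<Sum>j\<in>UNIV. x $ j * y $ j)"

definition Lam :: "real \<Rightarrow> 'n::finite phase \<Rightarrow> complex" where
  "Lam \<epsilon> = (\<lambda>(x, p).
     1 + 2 * \<i> * of_real \<epsilon> * dotc p x - (of_real \<epsilon>)\<^sup>2 * dotc x x * dotc p p)"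

definition PC :: "real \<Rightarrow> 'n::finite phase set" where
  "PC \<epsilon> = {z. Lam \<epsilon> z \<noteq> 0}"

definition T_vec :: "real \<Rightarrow> 'n::finite phase \<Rightarrow> complex ^ 'n" where
  "T_vec \<epsilon> = (\<lambda>(x, p). \<chi> j. p $ j + \<i> * of_real \<epsilon> * dotc p p * x $ j)"

definition psi :: "real \<Rightarrow> 'n::finite phase \<Rightarrow> 'n phase" where
  "psi \<epsilon> z = (\<chi> j. cnj (fst z $ j), \<chi> j. cnj (T_vec \<epsilon> z $ j / Lam \<epsilon> z))"

definition P_real :: "real \<Rightarrow> 'n::finite phase set" where
  "P_real \<epsilon> = {z \<in> PC \<epsilon>. psi \<epsilon> z = z}"

definition local_hol_extension ::
  "real \<Rightarrow> 'n::finite phase set \<Rightarrow> ('n phase \<Rightarrow> real) \<Rightarrow> 'n phase set \<Rightarrow> ('n phase \<Rightarrow> complex) \<Rightarrow> bool"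
where
  "local_hol_extension \<epsilon> U f\<^sub>0 N f \<longleftrightarrow>
     open N \<and> N \<subseteq> PC \<epsilon> \<and> holomorphic_phase f N \<and> (\<forall>y\<in>N \<inter> U. f y = of_real (f\<^sub>0 y))"

end

theory Submission
  imports Defs "HOL-Complex_Analysis.Cauchy_Integral_Formula"
begin

text \<open>Locally, real analytic functions are the restrictions of holomorphic functions to a real form:
  a holomorphic function has a power series by iterating the one-variable expansion over the
  coordinates, and conversely a power series converges on a complex polydisc. Near a point of the
  fixed point set the real coordinates of \<open>w\<close> are the values of holomorphic functions of \<open>w\<close> and
  \<open>psi w\<close>, so real analytic functions have holomorphic extensions.

  In the projective coordinates \<open>(1, p, p\<^sup>2)\<close> the map \<open>Theta = cnj \<circ> psi\<close> is a special conformal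
  transformation depending additively on \<open>\<epsilon>\<close>. Its square root (parameter \<open>\<epsilon>/2\<close>) straightens \<open>P\<close> to the
  real points, and so does the inverted momentum \<open>p/p\<^sup>2 + i\<epsilon>x/2\<close>; these two charts cover \<open>P\<close>.
  As \<open>P\<close> is totally real, the derivative of an extension at a point of \<open>P\<close> is determined by the function
  on \<open>P\<close>.

  Contracting a covector with a point gives an element of \<open>so(n)\<close>. In these terms the $r$-part
  of the bracket is the trace form of the operator \<open>Rop\<close>, which is conjugate to
  multiplication of the matrix entry \<open>(j, k)\<close> by a multiple of \<open>sgn (k - j)\<close>. The modified Yang-Baxter
  equation for signs makes the Jacobiator of the $r$-part an invariant trivector, which
  cancels that of the remaining, rotation invariant part. Both parts are mapped to their complex conjugates
  by \<open>Theta\<close>, so the bracket of functions that are real on \<open>P\<close> is real on \<open>P\<close>.\<close>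

section \<open>Holomorphic functions on spaces with a complex structure\<close>

text \<open>Analyticity speaks of power series on the phase space as a real vector space, whereas
  the bracket is made of complex derivatives. Passing between the two needs holomorphy on two
  spaces, the phase space and its own complexification, so the function theory is developed once for
  an operator \<open>J\<close> with square -1. One chart would not do:
  \<open>Lam (\<epsilon> / 2)\<close> can vanish on the fixed point set. For n = 1 and \<epsilon>
  \<noteq> 0 this happens at p = 2i / (\<epsilon> x) with x real and nonzero, where
  \<open>Lam \<epsilon>\<close> is 1. The r-part alone violates the Jacobi identity in general,
  since r satisfies only the modified Yang-Baxter equation. The invariant part enters with the
  factor i \<epsilon>, and it is the square of this factor, -\<epsilon>^2, that has the sign needed
  for the cancellation. The same factor governs reality: conjugation fixes r and turns i \<epsilon>
  into -i \<epsilon>, and \<open>Theta\<close> has the same effect on the two parts.\<close>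

definition has_cderiv ::
  "('v::real_normed_vector \<Rightarrow> 'v) \<Rightarrow> ('w::real_normed_vector \<Rightarrow> 'w) \<Rightarrow> ('v \<Rightarrow> 'w) \<Rightarrow> ('v \<Rightarrow> 'w) \<Rightarrow> 'v \<Rightarrow> bool"
where
  "has_cderiv J K f D z \<longleftrightarrow> (f has_derivative D) (at z) \<and> (\<forall>v. D (J v) = K (D v))"

definition hol :: "('v::real_normed_vector \<Rightarrow> 'v) \<Rightarrow> ('v \<Rightarrow> complex) \<Rightarrow> 'v set \<Rightarrow> bool" where
  "hol J f S \<longleftrightarrow> (\<forall>z\<in>S. \<exists>D. has_cderiv J ((*) \<i>) f D z)"

lemma has_cderiv_compose:
  assumes "has_cderiv J K f D z" "has_cderiv K L g E (f z)"
  shows "has_cderiv J L (\<lambda>z. g (f z)) (\<lambda>v. E (D v)) z"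
  using assms has_derivative_compose[of f D z UNIV g E] unfolding has_cderiv_def by auto

lemma has_cderiv_const: "has_cderiv J ((*) \<i>) (\<lambda>_. c) (\<lambda>_. 0) z"
  unfolding has_cderiv_def by auto

lemma has_cderiv_add:
  assumes "has_cderiv J ((*) \<i>) f D z" "has_cderiv J ((*) \<i>) g E z"
  shows "has_cderiv J ((*) \<i>) (\<lambda>z. f z + g z) (\<lambda>h. D h + E h) z"
  using assms unfolding has_cderiv_def by (auto intro!: has_derivative_add simp: distrib_left)

lemma has_cderiv_diff:
  assumes "has_cderiv J ((*) \<i>) f D z" "has_cderiv J ((*) \<i>) g E z"
  shows "has_cderiv J ((*) \<i>) (\<lambda>z. f z - g z) (\<lambda>h. D h - E h) z"
  using assms unfolding has_cderiv_def by (auto intro!: has_derivative_diff simp: right_diff_distrib)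

lemma has_cderiv_mult:
  assumes "has_cderiv J ((*) \<i>) f D z" "has_cderiv J ((*) \<i>) g E z"
  shows "has_cderiv J ((*) \<i>) (\<lambda>z. f z * g z) (\<lambda>h. f z * E h + D h * g z) z"
proof -
  have "((\<lambda>z. f z * g z) has_derivative (\<lambda>h. f z * E h + D h * g z)) (at z)"
    using assms unfolding has_cderiv_def by (intro has_derivative_mult) auto
  then show ?thesis
    using assms unfolding has_cderiv_def by (auto simp: algebra_simps)
qed

lemma has_cderiv_inverse:
  assumes "has_cderiv J ((*) \<i>) f D z" "f z \<noteq> 0"
  shows "has_cderiv J ((*) \<i>) (\<lambda>z. inverse (f z)) (\<lambda>h. - (inverse (f z) * D h * inverse (f z))) z"
proof -
  have "((\<lambda>z. inverse (f z)) has_derivative (\<lambda>h. - (inverse (f z) * D h * inverse (f z)))) (at z)"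
    using assms unfolding has_cderiv_def by (intro Deriv.has_derivative_inverse) auto
  then show ?thesis
    using assms unfolding has_cderiv_def by (auto simp: algebra_simps)
qed

lemma hol_const: "hol J (\<lambda>_. c) S"
  unfolding hol_def using has_cderiv_const by blast

lemma hol_add: "hol J f S \<Longrightarrow> hol J g S \<Longrightarrow> hol J (\<lambda>z. f z + g z) S"
  unfolding hol_def using has_cderiv_add by blast

lemma hol_diff: "hol J f S \<Longrightarrow> hol J g S \<Longrightarrow> hol J (\<lambda>z. f z - g z) S"
  unfolding hol_def using has_cderiv_diff by blast

lemma hol_mult: "hol J f S \<Longrightarrow> hol J g S \<Longrightarrow> hol J (\<lambda>z. f z * g z) S"
  unfolding hol_def using has_cderiv_mult by blast

lemma hol_uminus: "hol J f S \<Longrightarrow> hol J (\<lambda>z. - f z) S"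
  using hol_diff[OF hol_const[of J 0]] by simp

lemma hol_divide:
  "hol J f S \<Longrightarrow> hol J g S \<Longrightarrow> (\<And>z. z \<in> S \<Longrightarrow> g z \<noteq> 0) \<Longrightarrow> hol J (\<lambda>z. f z / g z) S"
  unfolding divide_inverse hol_def using has_cderiv_mult has_cderiv_inverse by blast

lemma hol_sum: "(\<And>i. i \<in> I \<Longrightarrow> hol J (f i) S) \<Longrightarrow> hol J (\<lambda>z. \<Sum>i\<in>I. f i z) S"
  by (induction I rule: infinite_finite_induct) (simp_all add: hol_const hol_add)

lemma hol_prod: "(\<And>i. i \<in> I \<Longrightarrow> hol J (f i) S) \<Longrightarrow> hol J (\<lambda>z. \<Prod>i\<in>I. f i z) S"
  by (induction I rule: infinite_finite_induct) (simp_all add: hol_const hol_mult)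

lemma hol_power: "hol J f S \<Longrightarrow> hol J (\<lambda>z. f z ^ n) S"
  by (induction n) (simp_all add: hol_const hol_mult)

lemmas hol_intros = hol_const hol_add hol_diff hol_uminus hol_mult hol_divide hol_sum hol_prod hol_power

lemma hol_subset: "hol J f S \<Longrightarrow> T \<subseteq> S \<Longrightarrow> hol J f T"
  unfolding hol_def by blast

lemma has_cderiv_transform:
  assumes "has_cderiv J K f D z" "open S" "z \<in> S" "\<And>x. x \<in> S \<Longrightarrow> f x = g x"
  shows "has_cderiv J K g D z"
  using assms has_derivative_transform_within_open[of f D z UNIV S g] unfolding has_cderiv_def by auto

lemma hol_transform:
  assumes "hol J f S" "open S" "\<And>x. x \<in> S \<Longrightarrow> f x = g x"
  shows "hol J g S"
  using assms has_cderiv_transform unfolding hol_def by metis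

lemma hol_continuous_on: "hol J f S \<Longrightarrow> continuous_on S f"
  unfolding has_cderiv_def hol_def by (meson continuous_at_imp_continuous_on has_derivative_continuous)

text \<open>The quadratic error term is what makes difference quotients converge uniformly in
  \<open>difference_quotients\<close>. Discs of radius R/4 about points of the closed disc of radius
  R/4 stay in the domain, so Cauchy's inequality bounds the second derivative by 2 M / (R/4)^2,
  which is the constant 32 M / R^2.\<close>

lemma holomorphic_second_order_bound:
  assumes h: "h holomorphic_on ball 0 R" and M: "\<And>t. t \<in> ball 0 R \<Longrightarrow> norm (h t) \<le> M" and R: "R > 0"
    and t: "norm t \<le> R / 4"
  shows "norm (h t - h 0 - deriv h 0 * t) \<le> 32 * M / R\<^sup>2 * (norm t)\<^sup>2"
proof -
  have "norm ((deriv ^^ 0) h t - (\<Sum>i\<le>1. (deriv ^^ i) h 0 * (t - 0) ^ i / fact i))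
          \<le> 32 * M / R\<^sup>2 * norm (t - 0) ^ Suc 1 / fact 1"
  proof (rule field_Taylor[of "cball 0 (R/4)"])
    fix i and x :: complex assume x: "x \<in> cball 0 (R/4)" "i \<le> (1::nat)"
    have "(deriv ^^ i) h holomorphic_on ball 0 R"
      using h by (intro holomorphic_higher_deriv) auto
    then have "((deriv ^^ i) h has_field_derivative deriv ((deriv ^^ i) h) x) (at x)"
      using x R by (intro holomorphic_derivI[of _ "ball 0 R"]) auto
    then show "((deriv ^^ i) h has_field_derivative (deriv ^^ Suc i) h x) (at x within cball 0 (R/4))"
      by (simp add: has_field_derivative_at_within)
  next
    fix x :: complex assume x: "x \<in> cball 0 (R/4)"
    have sub: "cball x (R/4) \<subseteq> ball 0 R"
    proof
      fix y assume "y \<in> cball x (R/4)"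
      then have "dist 0 y \<le> R/4 + R/4"
        using x dist_triangle[of 0 y x] by auto
      then show "y \<in> ball 0 R" using R by auto
    qed
    have "norm ((deriv ^^ 2) h x) \<le> fact 2 * M / (R/4)^2"
    proof (rule Cauchy_inequality)
      show "h holomorphic_on ball x (R/4)"
        using sub h by (meson ball_subset_cball holomorphic_on_subset order_trans)
      show "continuous_on (cball x (R/4)) h"
        using sub h by (meson holomorphic_on_imp_continuous_on holomorphic_on_subset)
    qed (use R M sub in \<open>auto simp: dist_norm subset_eq\<close>)
    then show "norm ((deriv ^^ Suc 1) h x) \<le> 32 * M / R\<^sup>2"
      by (simp add: numeral_2_eq_2 power2_eq_square)
  qed (use R t in auto)
  then show ?thesis
    by (simp add: power2_eq_square algebra_simps)
qed

section \<open>Directional derivatives, Cauchy estimates and uniform limits\<close>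

locale cplx_struct =
  fixes J :: "'v::real_normed_vector \<Rightarrow> 'v"
  assumes linear: "linear J" and J_J: "J (J v) = - v" and norm_J: "norm (J v) = norm v"
begin

text \<open>Complex scalar multiplication on a real vector space, with \<open>J\<close> as the
  imaginary unit.\<close>

definition cm :: "complex \<Rightarrow> 'v \<Rightarrow> 'v" where
  "cm c v = Re c *\<^sub>R v + Im c *\<^sub>R J v"

text \<open>Defined by the one-variable derivative along a complex line, so that Cauchy's inequality
  applies directly; for a holomorphic function \<open>dd_eq\<close> identifies it with the total
  derivative.\<close>

definition dd :: "('v \<Rightarrow> complex) \<Rightarrow> 'v \<Rightarrow> 'v \<Rightarrow> complex" where
  "dd f v z = deriv (\<lambda>t. f (z + cm t v)) 0"

lemma cm_0 [simp]: "cm 0 v = 0"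
  by (simp add: cm_def)

lemma cm_of_real: "cm (of_real t) v = t *\<^sub>R v"
  by (simp add: cm_def)

lemma norm_cm: "norm (cm c v) \<le> 2 * (norm c * norm v)"
proof -
  have "norm (cm c v) \<le> \<bar>Re c\<bar> * norm v + \<bar>Im c\<bar> * norm v"
    unfolding cm_def by (metis norm_J norm_scaleR norm_triangle_ineq)
  also have "\<dots> \<le> norm c * norm v + norm c * norm v"
    by (intro add_mono mult_right_mono abs_Re_le_cmod abs_Im_le_cmod) auto
  finally show ?thesis by linarith
qed

lemma cm_has_derivative: "((\<lambda>t. cm t v) has_derivative (\<lambda>h. cm h v)) (at t)"
  unfolding cm_def by (auto intro!: derivative_eq_intros)

lemma has_cderiv_cm:
  assumes "has_cderiv J ((*) \<i>) f D z"
  shows "D (cm h v) = h * D v"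
proof -
  have "bounded_linear D"
    using assms unfolding has_cderiv_def by (blast dest: has_derivative_bounded_linear)
  then have "D (cm h v) = Re h *\<^sub>R D v + Im h *\<^sub>R D (J v)"
    by (simp add: cm_def linear_simps)
  also have "\<dots> = (of_real (Re h) + \<i> * of_real (Im h)) * D v"
    using assms unfolding has_cderiv_def by (simp add: scaleR_conv_of_real algebra_simps)
  finally show ?thesis
    by (simp add: complex_eq[symmetric])
qed

lemma slice_field_derivative:
  assumes "has_cderiv J ((*) \<i>) f D (z + cm t v)"
  shows "((\<lambda>t. f (z + cm t v)) has_field_derivative D v) (at t)"
proof -
  have "((\<lambda>t. z + cm t v) has_derivative (\<lambda>h. cm h v)) (at t)"
    using has_derivative_add[OF has_derivative_const[of z] cm_has_derivative] by simp
  then have "((\<lambda>t. f (z + cm t v)) has_derivative (\<lambda>h. D (cm h v))) (at t)"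
    using assms has_derivative_compose[of "\<lambda>t. z + cm t v" _ t UNIV f D] unfolding has_cderiv_def by simp
  then show ?thesis
    unfolding has_field_derivative_def has_cderiv_cm[OF assms] by (simp add: mult.commute[of _ "D v"])
qed

lemma dd_eq: "has_cderiv J ((*) \<i>) f D z \<Longrightarrow> dd f v z = D v"
  unfolding dd_def using slice_field_derivative[of f D z 0 v] by (simp add: DERIV_imp_deriv)

lemma has_cderiv_dd:
  assumes "hol J f S" "z \<in> S"
  shows "has_cderiv J ((*) \<i>) f (\<lambda>v. dd f v z) z"
proof -
  obtain D where D: "has_cderiv J ((*) \<i>) f D z"
    using assms unfolding hol_def by blast
  then show ?thesis
    using dd_eq[OF D] by simp
qed

lemma slice_field_derivative_dd:
  assumes "hol J f S" "z + cm t v \<in> S"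
  shows "((\<lambda>t. f (z + cm t v)) has_field_derivative dd f v (z + cm t v)) (at t)"
  using slice_field_derivative has_cderiv_dd[OF assms] by blast

lemma slice_holomorphic:
  assumes "hol J f S" "\<And>t. t \<in> T \<Longrightarrow> z + cm t v \<in> S" "open T"
  shows "(\<lambda>t. f (z + cm t v)) holomorphic_on T"
  using slice_field_derivative_dd[OF assms(1)] assms(2,3) holomorphic_on_open by blast

lemma cm_ball:
  assumes "norm t * (2 * norm v) < d"
  shows "z + cm t v \<in> ball z d"
  using norm_cm[of t v] assms by (simp add: dist_norm algebra_simps)

lemma dd_bound:
  assumes f: "hol J f (ball z d)" and M: "\<And>x. x \<in> ball z d \<Longrightarrow> norm (f x) \<le> M" and d: "d > 0"
  shows "norm (dd f v z) \<le> 4 * M / d * norm v"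
proof (cases "v = 0")
  case True
  then show ?thesis
    using has_cderiv_dd[OF f, of z] d unfolding has_cderiv_def
    by (auto dest!: has_derivative_bounded_linear simp: linear_simps(3)[of "\<lambda>v. dd f v z"])
next
  case False
  \<comment> \<open>\<open>norm_cm\<close> costs a factor 2: parameters of modulus below 2 R keep
    the slice inside the ball, and the closed disc of radius R, on which Cauchy's inequality is
    used, lies well within.\<close>
  define R where "R = d / (4 * norm v)"
  have R: "R > 0" using d False by (simp add: R_def)
  have in_ball: "z + cm t v \<in> ball z d" if "t \<in> ball 0 (2 * R)" for t
    using that False d by (intro cm_ball) (simp add: R_def field_simps)
  have hol: "(\<lambda>t. f (z + cm t v)) holomorphic_on ball 0 (2 * R)"
    using slice_holomorphic[OF f] in_ball by blast
  have "norm ((deriv ^^ 1) (\<lambda>t. f (z + cm t v)) 0) \<le> fact 1 * M / R ^ 1"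
  proof (rule Cauchy_inequality)
    show "(\<lambda>t. f (z + cm t v)) holomorphic_on ball 0 R"
      using hol R by (auto elim: holomorphic_on_subset)
    have "cball 0 R \<subseteq> (ball 0 (2 * R)::complex set)"
      using R by auto
    then show "continuous_on (cball 0 R) (\<lambda>t. f (z + cm t v))"
      using hol continuous_on_subset holomorphic_on_imp_continuous_on by blast
  qed (use R in \<open>auto intro!: M in_ball simp: dist_norm\<close>)
  then show ?thesis
    using False d by (simp add: dd_def R_def field_simps)
qed

lemma hol_locally_bounded:
  assumes "hol J f S" "z \<in> S" "open S"
  obtains d M where "d > 0" "ball z d \<subseteq> S" "\<And>x. x \<in> ball z d \<Longrightarrow> norm (f x) \<le> M"
proof -
  obtain e where e: "e > 0" "ball z e \<subseteq> S"
    using assms open_contains_ball by blast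
  have "isCont f z"
    using assms hol_continuous_on continuous_on_eq_continuous_at by blast
  then obtain d where d: "d > 0" "\<And>x. dist x z < d \<Longrightarrow> dist (f x) (f z) < 1"
    unfolding continuous_at_eps_delta by (metis zero_less_one)
  have "norm (f x) \<le> norm (f z) + 1" if "x \<in> ball z (min d e)" for x
    using d(2)[of x] that norm_triangle_sub[of "f x" "f z"] by (auto simp: dist_commute dist_norm[of "f x"])
  then show ?thesis
    using that[of "min d e"] d e by force
qed

text \<open>Weierstrass' theorem. The estimate \<open>dd_bound\<close>, applied to differences on
  balls of half the radius, makes the derivatives uniformly Cauchy near the centre, and the real
  theorem on differentiating a sequence of functions applies. Compatibility with \<open>J\<close>
  passes to the pointwise limit.\<close>

lemma hol_uniform_limit_ball:
  assumes d: "d > 0" and f: "\<And>n. hol J (f n) (ball z d)" and lim: "uniform_limit (ball z d) f g sequentially"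
  shows "has_cderiv J ((*) \<i>) g (\<lambda>v. dd g v z) z \<and> (\<forall>v. (\<lambda>n. dd (f n) v z) \<longlonglongrightarrow> dd g v z)"
proof -
  define B where "B = ball z (d/2)"
  have sub: "ball x (d/2) \<subseteq> ball z d" if "x \<in> B" for x
  proof
    fix y assume "y \<in> ball x (d/2)"
    then show "y \<in> ball z d"
      using that dist_triangle[of z y x] by (auto simp: B_def)
  qed
  have B: "convex B" "z \<in> B" "open B" "B \<subseteq> ball z d"
    using d by (auto simp: B_def)
  have diff: "norm (dd (f n) v x - dd (f m) v x) \<le> 8 * M / d * norm v"
    if M: "\<And>y. y \<in> ball z d \<Longrightarrow> norm (f n y - f m y) \<le> M" and x: "x \<in> B" for n m v x M
  proof -
    have xz: "x \<in> ball z d" using B x by auto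
    have "dd (\<lambda>x. f n x - f m x) v x = dd (f n) v x - dd (f m) v x"
    proof (rule dd_eq)
      show "has_cderiv J ((*) \<i>) (\<lambda>x. f n x - f m x) (\<lambda>v. dd (f n) v x - dd (f m) v x) x"
        using has_cderiv_dd[OF f xz, of n] has_cderiv_dd[OF f xz, of m] unfolding has_cderiv_def
        by (auto intro!: has_derivative_diff simp: algebra_simps)
    qed
    moreover have "norm (dd (\<lambda>x. f n x - f m x) v x) \<le> 4 * M / (d/2) * norm v"
      using d sub[OF x] f M
      by (intro dd_bound hol_diff hol_subset[OF f]) auto
    ultimately show ?thesis by simp
  qed
  have cauchy: "\<exists>N. \<forall>m\<ge>N. \<forall>n\<ge>N. \<forall>x\<in>B. \<forall>v. norm (dd (f m) v x - dd (f n) v x) \<le> e * norm v" if e: "e > 0" for e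
  proof -
    have "uniformly_Cauchy_on (ball z d) f"
      using lim uniformly_convergent_Cauchy uniformly_convergent_on_def by blast
    moreover have "e * d / 8 > 0" using e d by simp
    ultimately obtain N where N: "\<And>m n y. m \<ge> N \<Longrightarrow> n \<ge> N \<Longrightarrow> y \<in> ball z d \<Longrightarrow> dist (f m y) (f n y) < e * d / 8"
      unfolding uniformly_Cauchy_on_def by blast
    have "norm (dd (f m) v x - dd (f n) v x) \<le> e * norm v" if "m \<ge> N" "n \<ge> N" "x \<in> B" for m n x v
      using diff[where M = "e * d / 8" and n = m and m = n and x = x and v = v] N[OF that(1,2)] that(3) d
      by (force simp: dist_norm less_imp_le)
    then show ?thesis by blast
  qed
  have "\<exists>l. (\<lambda>n. dd (f n) v x) \<longlonglongrightarrow> l" if "x \<in> B" for x v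
  proof -
    have "Cauchy (\<lambda>n. dd (f n) v x)"
    proof (rule metric_CauchyI)
      fix e :: real assume "e > 0"
      then have "e / (2 * (norm v + 1)) > 0"
        by (simp add: add_nonneg_pos)
      from cauchy[OF this] \<open>x \<in> B\<close>
      obtain N where N: "\<forall>m\<ge>N. \<forall>n\<ge>N. norm (dd (f m) v x - dd (f n) v x) \<le> e / (2 * (norm v + 1)) * norm v"
        by blast
      have "e / (2 * (norm v + 1)) * norm v < e"
        using \<open>e > 0\<close> norm_ge_zero[of v] by (simp add: divide_less_eq add_nonneg_pos)
      then show "\<exists>M. \<forall>m\<ge>M. \<forall>n\<ge>M. dist (dd (f m) v x) (dd (f n) v x) < e"
        using N unfolding dist_norm by (meson order_le_less_trans)
    qed
    then show ?thesis
      using Cauchy_convergent convergentD by blast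
  qed
  then obtain g' where g': "\<And>x v. x \<in> B \<Longrightarrow> (\<lambda>n. dd (f n) v x) \<longlonglongrightarrow> g' x v"
    by metis
  have near: "\<forall>\<^sub>F n in sequentially. \<forall>x\<in>B. \<forall>v. norm (dd (f n) v x - g' x v) \<le> e * norm v" if "e > 0" for e
  proof -
    obtain N where N: "\<forall>m\<ge>N. \<forall>n\<ge>N. \<forall>x\<in>B. \<forall>v. norm (dd (f m) v x - dd (f n) v x) \<le> e * norm v"
      using cauchy[OF \<open>e > 0\<close>] by blast
    have "norm (dd (f n) v x - g' x v) \<le> e * norm v" if "n \<ge> N" "x \<in> B" for n x v
    proof (rule Lim_norm_ubound[of sequentially "\<lambda>m. dd (f n) v x - dd (f m) v x"])
      show "(\<lambda>m. dd (f n) v x - dd (f m) v x) \<longlonglongrightarrow> dd (f n) v x - g' x v"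
        by (intro tendsto_diff tendsto_const g' that)
      show "\<forall>\<^sub>F m in sequentially. norm (dd (f n) v x - dd (f m) v x) \<le> e * norm v"
        using N that eventually_sequentially by blast
    qed auto
    then show ?thesis
      unfolding eventually_sequentially by blast
  qed
  have limg: "(\<lambda>n. f n x) \<longlonglongrightarrow> g x" if "x \<in> B" for x
    by (rule tendsto_uniform_limitI[OF lim]) (use that B(4) in blast)
  have der: "(f n has_derivative (\<lambda>v. dd (f n) v x)) (at x within B)" if "x \<in> B" for n x
    using has_cderiv_dd[OF f subsetD[OF B(4) that], of n] unfolding has_cderiv_def
    by (blast intro: has_derivative_at_withinI)
  obtain g0 where g0: "\<forall>x\<in>B. (\<lambda>n. f n x) \<longlonglongrightarrow> g0 x \<and> (g0 has_derivative g' x) (at x within B)"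
    using has_derivative_sequence[OF B(1) der near B(2) limg[OF B(2)]] by blast
  have "g0 x = g x" if "x \<in> B" for x
    using g0 limg[OF that] that LIMSEQ_unique[of "\<lambda>n. f n x"] by auto
  moreover have "(g0 has_derivative g' z) (at z)"
    using g0 B(2) unfolding at_within_open[OF B(2,3), symmetric] by blast
  ultimately have "(g has_derivative g' z) (at z)"
    using has_derivative_transform_within_open[of g0 "g' z" z UNIV B g] B(2,3) by blast
  moreover have "g' z (J v) = \<i> * g' z v" for v
  proof (rule LIMSEQ_unique[OF g'[OF B(2)]])
    have "dd (f n) (J v) z = \<i> * dd (f n) v z" for n
      using has_cderiv_dd[OF f, of z n] d unfolding has_cderiv_def by auto
    then show "(\<lambda>n. dd (f n) (J v) z) \<longlonglongrightarrow> \<i> * g' z v"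
      by (simp add: tendsto_mult_left g' B(2))
  qed
  ultimately have c: "has_cderiv J ((*) \<i>) g (g' z) z"
    by (simp add: has_cderiv_def)
  then have "dd g v z = g' z v" for v by (rule dd_eq)
  then show ?thesis
    using c g' B(2) by simp
qed

lemma hol_shift:
  assumes "hol J f S" "\<And>x. x \<in> T \<Longrightarrow> x + a \<in> S"
  shows "hol J (\<lambda>x. f (x + a)) T"
proof -
  have "has_cderiv J J (\<lambda>x. x + a) (\<lambda>v. v) x" for x
    unfolding has_cderiv_def by (auto intro!: derivative_eq_intros)
  then show ?thesis
    using assms has_cderiv_compose[of J J "\<lambda>x. x + a"] unfolding hol_def by blast
qed

text \<open>Exhibits \<open>dd f v\<close> as a locally uniform limit of holomorphic functions; from
  this follow both its holomorphy and the symmetry of second derivatives. By Taylor's formula along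
  the slice the error is at most a constant times \<open>t n\<close>, uniformly in the base
  point.\<close>

lemma difference_quotients:
  assumes f: "hol J f S" "open S" "z \<in> S"
  obtains t :: "nat \<Rightarrow> real" and d where "d > 0" "t \<longlonglongrightarrow> 0" "\<And>n. t n > 0"
    "ball z d \<subseteq> S" "\<And>n x. x \<in> ball z d \<Longrightarrow> x + t n *\<^sub>R v \<in> S"
    "uniform_limit (ball z d) (\<lambda>n x. (f (x + t n *\<^sub>R v) - f x) / of_real (t n)) (dd f v) sequentially"
proof -
  obtain d M where d: "d > 0" "ball z d \<subseteq> S" and M: "\<And>x. x \<in> ball z d \<Longrightarrow> norm (f x) \<le> M"
    using hol_locally_bounded[OF f(1,3,2)] by blast
  have M0: "M \<ge> 0"
    using M[of z] d norm_ge_zero order_trans by (metis centre_in_ball)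
  define R where "R = d / (4 * (norm v + 1))"
  have v1: "norm v + 1 > 0" by (simp add: add_nonneg_pos)
  have R: "R > 0" using d v1 by (simp add: R_def)
  have shift: "x + cm c v \<in> ball z d" if x: "x \<in> ball z (d/2)" and c: "c \<in> ball 0 R" for x c
  proof -
    have "norm c * (2 * norm v) \<le> R * (2 * norm v)"
      using c by (intro mult_right_mono) auto
    also have "\<dots> < d/2"
      using d(1) v1 by (simp add: R_def divide_simps)
    finally have "x + cm c v \<in> ball x (d/2)" by (rule cm_ball)
    then show ?thesis
      using x dist_triangle[of z "x + cm c v" x] by simp
  qed
  \<comment> \<open>Positive steps, because they are divisors, and at most R/4, the range of
    \<open>holomorphic_second_order_bound\<close>.\<close>
  define t where "t n = R / 4 * inverse (real (Suc n))" for n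
  have t: "t n > 0" "t n \<le> R/4" for n
    unfolding t_def using R by (auto intro!: mult_left_le simp: inverse_le_1_iff simp del: of_nat_Suc)
  have tR: "complex_of_real (t n) \<in> ball 0 R" for n
    using t[of n] R by (simp add: dist_norm)
  have t0: "t \<longlonglongrightarrow> 0"
    unfolding t_def using tendsto_mult_right_zero[OF LIMSEQ_inverse_real_of_nat] by blast
  have in_S: "x + t n *\<^sub>R v \<in> S" if "x \<in> ball z (d/2)" for n x
    using shift[OF that tR, of n] d(2) by (auto simp: cm_of_real)
  have bound: "norm ((f (x + t n *\<^sub>R v) - f x) / of_real (t n) - dd f v x) \<le> 32 * M / R\<^sup>2 * t n"
    if x: "x \<in> ball z (d/2)" for n x
  proof -
    define h where "h c = f (x + cm c v)" for c
    have "norm (h (of_real (t n)) - h 0 - deriv h 0 * of_real (t n)) \<le> 32 * M / R\<^sup>2 * (norm (complex_of_real (t n)))\<^sup>2"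
    proof (rule holomorphic_second_order_bound)
      show "h holomorphic_on ball 0 R"
        unfolding h_def by (rule slice_holomorphic[OF f(1)]) (use shift[OF x] d(2) in blast, simp)
      show "norm (h c) \<le> M" if "c \<in> ball 0 R" for c
        unfolding h_def by (intro M shift x that)
      show "norm (complex_of_real (t n)) \<le> R / 4"
        using t[of n] by simp
    qed (rule R)
    moreover have "h (of_real (t n)) = f (x + t n *\<^sub>R v)" "h 0 = f x" "deriv h 0 = dd f v x"
      by (simp_all add: h_def[abs_def] cm_of_real dd_def)
    moreover have "norm (complex_of_real (t n)) = t n"
      using t(1)[of n] by simp
    ultimately have "norm (f (x + t n *\<^sub>R v) - f x - dd f v x * of_real (t n)) \<le> 32 * M / R\<^sup>2 * t n * t n"
      by (simp only: power2_eq_square mult.assoc)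
    moreover have "(f (x + t n *\<^sub>R v) - f x) / of_real (t n) - dd f v x
        = (f (x + t n *\<^sub>R v) - f x - dd f v x * of_real (t n)) / of_real (t n)"
      using t(1)[of n] by (simp add: diff_divide_distrib)
    ultimately show ?thesis
      using t(1)[of n] by (simp only: norm_divide divide_le_eq norm_of_real abs_of_pos if_True)
  qed
  have "uniform_limit (ball z (d/2)) (\<lambda>n x. (f (x + t n *\<^sub>R v) - f x) / of_real (t n)) (dd f v) sequentially"
  proof (rule uniform_limitI)
    fix e :: real assume e: "e > 0"
    have "(\<lambda>n. 32 * M / R\<^sup>2 * t n) \<longlonglongrightarrow> 0"
      by (rule tendsto_mult_right_zero[OF t0])
    from order_tendstoD(2)[OF this e] have "\<forall>\<^sub>F n in sequentially. 32 * M / R\<^sup>2 * t n < e" .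
    then show "\<forall>\<^sub>F n in sequentially. \<forall>x\<in>ball z (d/2).
        dist ((f (x + t n *\<^sub>R v) - f x) / of_real (t n)) (dd f v x) < e"
      unfolding dist_norm by eventually_elim (use bound in \<open>blast intro: order_le_less_trans\<close>)
  qed
  moreover have "ball z (d/2) \<subseteq> S"
    using d subset_ball[of "d/2" d z] by simp
  ultimately show ?thesis
    using d(1) by (intro that[OF _ t0 t(1) _ in_S]) simp_all
qed

lemma difference_quotient_hol:
  assumes "hol J f S" "T \<subseteq> S" "\<And>x. x \<in> T \<Longrightarrow> x + s *\<^sub>R v \<in> S" "s \<noteq> 0"
  shows "hol J (\<lambda>x. (f (x + s *\<^sub>R v) - f x) / of_real s) T"
  using assms by (intro hol_divide hol_diff hol_const hol_shift[OF assms(1)] hol_subset[OF assms(1)]) auto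

lemma hol_dd:
  assumes "hol J f S" "open S"
  shows "hol J (dd f v) S"
  unfolding hol_def
proof
  fix z assume z: "z \<in> S"
  obtain t d where "d > 0" and t0: "t \<longlonglongrightarrow> 0" and t: "\<And>n. t n > 0"
    and sub: "ball z d \<subseteq> S" "\<And>n x. x \<in> ball z d \<Longrightarrow> x + t n *\<^sub>R v \<in> S"
    and lim: "uniform_limit (ball z d) (\<lambda>n x. (f (x + t n *\<^sub>R v) - f x) / of_real (t n)) (dd f v) sequentially"
    by (rule difference_quotients[OF assms z, where v = v]) (rule that)
  have "hol J (\<lambda>x. (f (x + t n *\<^sub>R v) - f x) / of_real (t n)) (ball z d)" for n
    using t[of n] by (intro difference_quotient_hol[OF assms(1) sub]) auto
  then show "\<exists>D. has_cderiv J ((*) \<i>) (dd f v) D z"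
    using hol_uniform_limit_ball[OF \<open>d > 0\<close> _ lim] by blast
qed

text \<open>The difference quotient in direction v commutes with differentiation in direction w, so
  both sides are limits of one sequence: one by uniform convergence of the quotients, the other
  because \<open>dd f w\<close> is differentiable along v.\<close>

lemma dd_commute:
  assumes "hol J f S" "open S" "z \<in> S"
  shows "dd (dd f v) w z = dd (dd f w) v z"
proof -
  obtain t d where d: "d > 0" and t0: "t \<longlonglongrightarrow> 0" and t: "\<And>n. t n > 0"
    and sub: "ball z d \<subseteq> S" "\<And>n x. x \<in> ball z d \<Longrightarrow> x + t n *\<^sub>R v \<in> S"
    and lim: "uniform_limit (ball z d) (\<lambda>n x. (f (x + t n *\<^sub>R v) - f x) / of_real (t n)) (dd f v) sequentially"
    by (rule difference_quotients[OF assms, where v = v]) (rule that)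
  define q where "q n x = (f (x + t n *\<^sub>R v) - f x) / of_real (t n)" for n x
  have q: "hol J (q n) (ball z d)" for n
    unfolding q_def using t[of n] by (intro difference_quotient_hol[OF assms(1) sub]) auto
  have "(\<lambda>n. dd (q n) w z) \<longlonglongrightarrow> dd (dd f v) w z"
    using hol_uniform_limit_ball[OF d q] lim by (auto simp: q_def[abs_def])
  moreover have "dd (q n) w z = (dd f w (z + t n *\<^sub>R v) - dd f w z) / of_real (t n)" for n
  proof (rule dd_eq)
    have "has_cderiv J J (\<lambda>x. x + t n *\<^sub>R v) (\<lambda>v. v) z"
      unfolding has_cderiv_def by (auto intro!: derivative_eq_intros)
    from has_cderiv_compose[OF this has_cderiv_dd[OF assms(1) sub(2)]]
    have "has_cderiv J ((*) \<i>) (\<lambda>x. f (x + t n *\<^sub>R v)) (\<lambda>u. dd f u (z + t n *\<^sub>R v)) z"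
      using d by simp
    from has_cderiv_mult[OF has_cderiv_diff[OF this has_cderiv_dd[OF assms(1,3)]]
        has_cderiv_const[where c = "inverse (of_real (t n))"]]
    show "has_cderiv J ((*) \<i>) (q n) (\<lambda>w. (dd f w (z + t n *\<^sub>R v) - dd f w z) / of_real (t n)) z"
      by (simp add: q_def[abs_def] divide_inverse)
  qed
  ultimately have "(\<lambda>n. (dd f w (z + t n *\<^sub>R v) - dd f w z) / of_real (t n)) \<longlonglongrightarrow> dd (dd f v) w z"
    by simp
  moreover have "(\<lambda>n. (dd f w (z + t n *\<^sub>R v) - dd f w z) / of_real (t n)) \<longlonglongrightarrow> dd (dd f w) v z"
  proof -
    have "((\<lambda>c. dd f w (z + cm c v)) has_field_derivative dd (dd f w) v z) (at 0)"
      using slice_field_derivative_dd[OF hol_dd[OF assms(1,2)], of z 0 v w] assms(3) by simp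
    then have *: "((\<lambda>c. (dd f w (z + cm c v) - dd f w z) / c) \<longlongrightarrow> dd (dd f w) v z) (at 0)"
      by (simp add: DERIV_def)
    have "filterlim (\<lambda>n. complex_of_real (t n)) (at 0) sequentially"
      unfolding filterlim_at using t0 t by (auto simp: less_imp_neq[symmetric] intro!: tendsto_eq_intros)
    from filterlim_compose[OF * this] show ?thesis
      by (simp add: cm_of_real)
  qed
  ultimately show ?thesis
    by (rule LIMSEQ_unique)
qed

text \<open>A bijection from the naturals onto the index set turns the unordered sum into a series,
  to which the Weierstrass M-test and the theorem on uniform limits apply.\<close>

lemma hol_infsum:
  fixes f :: "'i \<Rightarrow> 'v \<Rightarrow> complex"
  assumes "countable I" "infinite I" "open S" and f: "\<And>i. i \<in> I \<Longrightarrow> hol J (f i) S"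
    and M: "\<And>i z. i \<in> I \<Longrightarrow> z \<in> S \<Longrightarrow> norm (f i z) \<le> M i" "M summable_on I"
  shows "hol J (\<lambda>z. \<Sum>\<^sub>\<infinity>i\<in>I. f i z) S"
proof -
  obtain g where g: "bij_betw g (UNIV::nat set) I"
    using assms(1,2) bij_betw_from_nat_into by blast
  have gI: "g n \<in> I" for n using g bij_betwE by blast
  have Mg: "summable (\<lambda>n. M (g n))"
    using M(2) summable_on_reindex_bij_betw[OF g, of M] summable_on_imp_summable by blast
  have lim: "uniform_limit S (\<lambda>n z. \<Sum>k<n. f (g k) z) (\<lambda>z. \<Sum>k. f (g k) z) sequentially"
    using M(1) gI by (intro Weierstrass_m_test[OF _ Mg]) auto
  have eq: "(\<Sum>k. f (g k) z) = (\<Sum>\<^sub>\<infinity>i\<in>I. f i z)" if "z \<in> S" for z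
  proof -
    have "(\<lambda>i. f i z) summable_on I"
      by (rule abs_summable_summable, rule summable_on_comparison_test[OF M(2)]) (simp_all add: M(1)[OF _ that])
    then have "((\<lambda>k. f (g k) z) has_sum (\<Sum>\<^sub>\<infinity>i\<in>I. f i z)) UNIV"
      using has_sum_reindex_bij_betw[OF g, of "\<lambda>i. f i z"] by simp
    then show ?thesis
      using has_sum_imp_sums sums_unique by metis
  qed
  have "hol J (\<lambda>z. \<Sum>k. f (g k) z) S"
    unfolding hol_def
  proof
    fix z assume "z \<in> S"
    then obtain d where d: "d > 0" "ball z d \<subseteq> S"
      using \<open>open S\<close> open_contains_ball by blast
    have "hol J (\<lambda>z. \<Sum>k<n. f (g k) z) (ball z d)" for n
      using f gI d(2) by (intro hol_sum) (blast intro: hol_subset)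
    then show "\<exists>D. has_cderiv J ((*) \<i>) (\<lambda>z. \<Sum>k. f (g k) z) D z"
      using hol_uniform_limit_ball[OF d(1) _ uniform_limit_on_subset[OF lim d(2)]] by blast
  qed
  then show ?thesis
    by (rule hol_transform[OF _ \<open>open S\<close> eq])
qed

text \<open>Shows that the Taylor coefficients along a fixed direction are values of holomorphic
  functions of the base point, so that they can be expanded again in the other coordinates.\<close>

lemma slice_higher_deriv:
  assumes f: "hol J f S" "open S" and T: "open T" "\<And>t. t \<in> T \<Longrightarrow> z + cm t v \<in> S" and t: "t \<in> T"
  shows "(deriv ^^ k) (\<lambda>t. f (z + cm t v)) t = ((\<lambda>g. dd g v) ^^ k) f (z + cm t v)"
  using t
proof (induction k arbitrary: t)
  case (Suc k)
  have h: "hol J (((\<lambda>g. dd g v) ^^ k) f) S" for k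
    by (induction k) (use f hol_dd in auto)
  have "((\<lambda>t. ((\<lambda>g. dd g v) ^^ k) f (z + cm t v)) has_field_derivative ((\<lambda>g. dd g v) ^^ Suc k) f (z + cm t v)) (at t)"
    using slice_field_derivative_dd[OF h[of k]] T(2) Suc.prems by simp
  then have "((deriv ^^ k) (\<lambda>t. f (z + cm t v)) has_field_derivative ((\<lambda>g. dd g v) ^^ Suc k) f (z + cm t v)) (at t)"
    using has_field_derivative_transform_within_open[OF _ T(1) Suc.prems] Suc.IH by fastforce
  then show ?case
    by (simp add: DERIV_imp_deriv)
qed simp

lemma hol_iterated_dd:
  assumes "hol J f S" "open S"
  shows "hol J (((\<lambda>g. dd g v) ^^ k) f) S"
  by (induction k) (use assms hol_dd in auto)

end

section \<open>Real analytic functions and holomorphic extensions\<close>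

definition cpl_J :: "'a::real_vector \<times> 'a \<Rightarrow> 'a \<times> 'a" where
  "cpl_J w = (- snd w, fst w)"

interpretation cpl: cplx_struct "cpl_J :: 'a::real_normed_vector \<times> 'a \<Rightarrow> _"
  by unfold_locales
    (auto simp: cpl_J_def norm_Pair add.commute intro!: linearI)

text \<open>The pair \<open>w\<close> stands for \<open>fst w\<close> + i \<open>snd w\<close>; this
  is its complex coordinate along \<open>b\<close>.\<close>

definition cc :: "'a::euclidean_space \<Rightarrow> 'a \<times> 'a \<Rightarrow> complex" where
  "cc b w = Complex (fst w \<bullet> b) (snd w \<bullet> b)"

lemma cc_real: "cc b (h, 0) = of_real (h \<bullet> b)"
  by (simp add: cc_def complex_eq_iff)

lemma cc_diff: "cc b (w - v) = cc b w - cc b v"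
  by (simp add: cc_def complex_eq_iff inner_diff_left)

lemma cc_add: "cc b (w + v) = cc b w + cc b v"
  by (simp add: cc_def complex_eq_iff inner_add_left)

lemma cc_cm_Basis:
  assumes "b \<in> Basis" "b' \<in> Basis"
  shows "cc b' (cpl.cm t (b, 0)) = (if b' = b then t else 0)"
  using assms by (simp add: cc_def complex_eq_iff cpl.cm_def cpl_J_def inner_Basis)

lemma cc_eqI:
  assumes "\<And>b. b \<in> Basis \<Longrightarrow> cc b w = cc b v"
  shows "w = v"
proof (rule prod_eqI)
  show "fst w = fst v" "snd w = snd v"
    using assms by (auto simp: cc_def intro: euclidean_eqI)
qed

lemma has_cderiv_cc: "has_cderiv cpl_J ((*) \<i>) (cc b) (cc b) w"
proof -
  have "(cc b has_derivative cc b) (at w)"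
    unfolding cc_def Complex_eq
    by (auto intro!: derivative_eq_intros)
  then show ?thesis
    by (auto simp: has_cderiv_def cc_def cpl_J_def complex_eq_iff)
qed

lemma hol_cc: "hol cpl_J (cc b) S"
  unfolding hol_def using has_cderiv_cc by blast

lemma norm_cc_le:
  assumes "b \<in> Basis"
  shows "norm (cc b w) \<le> norm w"
proof -
  have "(fst w \<bullet> b)\<^sup>2 \<le> (norm (fst w))\<^sup>2" "(snd w \<bullet> b)\<^sup>2 \<le> (norm (snd w))\<^sup>2"
    using Basis_le_norm[OF assms] by (metis abs_le_square_iff abs_norm_cancel)+
  then show ?thesis
    by (simp add: cc_def complex_norm norm_prod_def)
qed

definition polydisc :: "real \<Rightarrow> ('a::euclidean_space \<times> 'a) set" where
  "polydisc r = {w. \<forall>b\<in>Basis. norm (cc b w) < r}"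

lemma open_polydisc: "open (polydisc r :: ('a::euclidean_space \<times> 'a) set)"
proof -
  have "open {w. norm (cc b w) < r}" for b :: 'a
    unfolding cc_def complex_norm by (intro open_Collect_less continuous_intros)
  moreover have "polydisc r = (\<Inter>b\<in>(Basis::'a set). {w. norm (cc b w) < r})"
    by (auto simp: polydisc_def)
  ultimately show ?thesis
    by (simp add: open_INT)
qed

lemma polydisc_subset_ball:
  assumes "d > 0"
  obtains r where "r > 0" "polydisc r \<subseteq> (ball 0 d :: ('a::euclidean_space \<times> 'a) set)"
proof
  \<comment> \<open>With this radius the sum of the absolute coordinates of either half of a point
    is below d/2.\<close>
  define r where "r = d / (2 * DIM('a))"
  show "r > 0" using assms by (simp add: r_def)
  show "polydisc r \<subseteq> (ball 0 d :: ('a::euclidean_space \<times> 'a) set)"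
  proof
    fix w :: "'a \<times> 'a" assume w: "w \<in> polydisc r"
    have le: "\<bar>fst w \<bullet> b\<bar> < r" "\<bar>snd w \<bullet> b\<bar> < r" if "b \<in> Basis" for b
      using w that abs_Re_le_cmod[of "cc b w"] abs_Im_le_cmod[of "cc b w"]
      by (force simp: polydisc_def cc_def)+
    have "norm (fst w) < r * DIM('a)"
    proof -
      have "norm (fst w) \<le> (\<Sum>b\<in>Basis. \<bar>fst w \<bullet> b\<bar>)" by (rule norm_le_l1)
      also have "\<dots> < (\<Sum>b\<in>(Basis::'a set). r)" using le by (intro sum_strict_mono) auto
      finally show ?thesis by (simp add: mult.commute)
    qed
    moreover have "norm (snd w) < r * DIM('a)"
    proof -
      have "norm (snd w) \<le> (\<Sum>b\<in>Basis. \<bar>snd w \<bullet> b\<bar>)" by (rule norm_le_l1)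
      also have "\<dots> < (\<Sum>b\<in>(Basis::'a set). r)" using le by (intro sum_strict_mono) auto
      finally show ?thesis by (simp add: mult.commute)
    qed
    moreover have "norm w \<le> norm (fst w) + norm (snd w)"
      using norm_Pair_le[of "fst w" "snd w"] by simp
    ultimately show "w \<in> ball 0 d"
      using assms by (simp add: r_def field_simps)
  qed
qed

lemma infinite_multi_indices: "infinite (Basis \<rightarrow>\<^sub>E (UNIV :: nat set) :: ('a::euclidean_space \<Rightarrow> nat) set)"
proof -
  have "inj_on (\<lambda>n. \<lambda>b\<in>(Basis::'a set). n::nat) UNIV"
    by (rule inj_onI) (metis nonempty_Basis ex_in_conv restrict_apply')
  moreover have "range (\<lambda>n. \<lambda>b\<in>(Basis::'a set). n::nat) \<subseteq> Basis \<rightarrow>\<^sub>E UNIV"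
    by auto
  ultimately show ?thesis
    using finite_subset finite_imageD infinite_UNIV_nat by blast
qed

text \<open>The extension is the power series itself with complex coordinates inserted; what has to
  be supplied is a summable majorant near 0.\<close>

lemma real_analytic_hol_extension:
  fixes f :: "'a::euclidean_space \<Rightarrow> real"
  assumes "real_analytic_at f a"
  obtains d G where "d > 0" "hol cpl_J G (ball 0 d)" "\<And>h. norm h < d \<Longrightarrow> G (h, 0) = of_real (f (a + h))"
proof -
  define I where "I = (Basis \<rightarrow>\<^sub>E UNIV :: ('a \<Rightarrow> nat) set)"
  obtain r c where r: "r > 0" and c: "\<And>h. (\<forall>b\<in>Basis. \<bar>h \<bullet> b\<bar> < r) \<Longrightarrow>
      ((\<lambda>\<alpha>. (\<Prod>b\<in>Basis. (h \<bullet> b) ^ \<alpha> b) *\<^sub>R c \<alpha>) has_sum f (a + h)) I"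
    using assms unfolding real_analytic_at_def I_def by blast
  define d where "d = r / 2"
  have d: "d > 0" "d < r" using r by (auto simp: d_def)
  define G where "G w = (\<Sum>\<^sub>\<infinity>\<alpha>\<in>I. (\<Prod>b\<in>Basis. cc b w ^ \<alpha> b) * of_real (c \<alpha>))" for w
  define M where "M \<alpha> = \<bar>(\<Prod>b\<in>(Basis::'a set). d ^ \<alpha> b) * c \<alpha>\<bar>" for \<alpha>
  \<comment> \<open>Evaluation at the point whose coordinates all equal d. Real unordered
    summability is absolute, so the terms at this corner dominate those at all points with complex
    coordinates of modulus at most d.\<close>
  have "((\<lambda>\<alpha>. (\<Prod>b\<in>Basis. ((\<Sum>b\<in>Basis. d *\<^sub>R b) \<bullet> b) ^ \<alpha> b) *\<^sub>R c \<alpha>) has_sum f (a + (\<Sum>b\<in>Basis. d *\<^sub>R b))) I"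
    using d by (intro c) simp
  then have "(\<lambda>\<alpha>. (\<Prod>b\<in>(Basis::'a set). d ^ \<alpha> b) * c \<alpha>) summable_on I"
    unfolding summable_on_def by (auto simp: inner_sum_left_Basis)
  then have M: "M summable_on I"
    unfolding M_def using summable_on_iff_abs_summable_on_real by fastforce
  have "hol cpl_J G (ball 0 d)"
    unfolding G_def
  proof (rule cpl.hol_infsum[where M = M])
    show "countable I" unfolding I_def by (intro countable_PiE) auto
    show "infinite I" unfolding I_def by (rule infinite_multi_indices)
    fix \<alpha> :: "'a \<Rightarrow> nat" and w :: "'a \<times> 'a" assume w: "w \<in> ball 0 d"
    have "norm (\<Prod>b\<in>Basis. cc b w ^ \<alpha> b) \<le> (\<Prod>b\<in>(Basis::'a set). d ^ \<alpha> b)"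
      unfolding prod_norm[symmetric] norm_power
      using w norm_cc_le[of _ w] by (intro prod_mono) (force intro!: power_mono)
    then show "norm ((\<Prod>b\<in>Basis. cc b w ^ \<alpha> b) * of_real (c \<alpha>)) \<le> M \<alpha>"
      unfolding M_def norm_mult abs_mult norm_of_real
      by (intro mult_right_mono) auto
  qed (use M in \<open>auto intro!: hol_intros hol_cc\<close>)
  moreover have "G (h, 0) = of_real (f (a + h))" if "norm h < d" for h
  proof -
    have "\<forall>b\<in>Basis. \<bar>h \<bullet> b\<bar> < r"
      using that d Basis_le_norm[of _ h] by (meson order_le_less_trans order_less_trans)
    from has_sum_of_real[OF c[OF this], where 'a = complex]
    have "((\<lambda>\<alpha>. (\<Prod>b\<in>Basis. cc b (h, 0) ^ \<alpha> b) * of_real (c \<alpha>)) has_sum (of_real (f (a + h)))) I"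
      by (simp add: cc_real)
    then show ?thesis
      unfolding G_def by (rule infsumI)
  qed
  ultimately show ?thesis
    using that d(1) by blast
qed

section \<open>Power series of holomorphic functions of several variables\<close>

lemma prod_power_fun_upd:
  assumes "finite B" "b \<notin> B"
  shows "(\<Prod>b'\<in>insert b B. q b' ^ (\<alpha>(b := k)) b') = q b ^ k * (\<Prod>b'\<in>B. q b' ^ \<alpha> b')"
proof -
  have "(\<Prod>b'\<in>B. q b' ^ (\<alpha>(b := k)) b') = (\<Prod>b'\<in>B. q b' ^ \<alpha> b')"
    using assms(2) by (intro prod.cong) auto
  then show ?thesis
    using assms by simp
qed

lemma geometric_summable_PiE:
  assumes "finite B" "\<And>b. b \<in> B \<Longrightarrow> 0 \<le> q b \<and> q b < (1::real)"
  shows "(\<lambda>\<alpha>. \<Prod>b\<in>B. q b ^ \<alpha> b) summable_on (B \<rightarrow>\<^sub>E (UNIV::nat set))"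
  using assms
proof (induction B rule: finite_induct)
  case empty
  then show ?case by simp
next
  case (insert b B)
  have q: "(\<lambda>k. q b ^ k) summable_on UNIV"
    using insert.prems by (intro norm_summable_imp_summable_on) (auto simp: summable_geometric_iff)
  define S where "S = (\<Sum>\<^sub>\<infinity>\<alpha>\<in>B \<rightarrow>\<^sub>E (UNIV::nat set). \<Prod>b\<in>B. q b ^ \<alpha> b)"
  have S: "((\<lambda>\<alpha>. \<Prod>b\<in>B. q b ^ \<alpha> b) has_sum S) (B \<rightarrow>\<^sub>E (UNIV::nat set))"
    using insert by (auto simp: S_def)
  have "(\<lambda>(k, \<alpha>). q b ^ k * (\<Prod>b\<in>B. q b ^ \<alpha> b)) summable_on UNIV \<times> (B \<rightarrow>\<^sub>E (UNIV::nat set))"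
  proof (rule summable_on_SigmaI)
    show "((\<lambda>\<alpha>. case (k, \<alpha>) of (k, \<alpha>) \<Rightarrow> q b ^ k * (\<Prod>b\<in>B. q b ^ \<alpha> b)) has_sum q b ^ k * S) (B \<rightarrow>\<^sub>E UNIV)" for k
      using has_sum_cmult_right[OF S] by simp
    show "(\<lambda>k. q b ^ k * S) summable_on UNIV"
      by (intro summable_on_cmult_left q)
  qed (use insert.prems in \<open>auto intro!: mult_nonneg_nonneg prod_nonneg\<close>)
  also have "(\<lambda>(k, \<alpha>). q b ^ k * (\<Prod>b\<in>B. q b ^ \<alpha> b)) = (\<lambda>\<alpha>. \<Prod>b\<in>insert b B. q b ^ \<alpha> b) \<circ> (\<lambda>(k, \<alpha>). \<alpha>(b := k))"
    using prod_power_fun_upd[OF insert.hyps, of q] by (auto simp: fun_eq_iff simp del: prod.insert fun_upd_apply)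
  also have "\<dots> summable_on UNIV \<times> (B \<rightarrow>\<^sub>E (UNIV::nat set)) \<longleftrightarrow>
      (\<lambda>\<alpha>. \<Prod>b\<in>insert b B. q b ^ \<alpha> b) summable_on (\<lambda>(k, \<alpha>). \<alpha>(b := k)) ` (UNIV \<times> (B \<rightarrow>\<^sub>E (UNIV::nat set)))"
    using inj_combinator[OF insert.hyps(2), of "\<lambda>_. UNIV"] by (intro summable_on_reindex[symmetric])
  finally show ?case
    by (simp add: PiE_insert_eq)
qed

text \<open>Holomorphy and the bound are known on the open disc only, so Cauchy's inequality is
  applied on circles of radius s < r, and s tends to r.\<close>

lemma holomorphic_coeff_bound:
  assumes h: "h holomorphic_on ball 0 r" and M: "\<And>t. t \<in> ball 0 r \<Longrightarrow> norm (h t) \<le> M" and r: "r > 0"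
  shows "norm ((deriv ^^ k) h 0 / fact k) * r ^ k \<le> M"
proof -
  have *: "norm ((deriv ^^ k) h 0 / fact k) * s ^ k \<le> M" if "0 < s" "s < r" for s
  proof -
    have "norm ((deriv ^^ k) h 0) \<le> fact k * M / s ^ k"
    proof (rule Cauchy_inequality)
      show "h holomorphic_on ball 0 s"
        using h that by (auto elim: holomorphic_on_subset)
      show "continuous_on (cball 0 s) h"
        using h that by (intro holomorphic_on_imp_continuous_on) (auto elim: holomorphic_on_subset)
    qed (use that M in auto)
    then show ?thesis
      using that by (simp add: norm_divide field_simps)
  qed
  have "((\<lambda>s. norm ((deriv ^^ k) h 0 / fact k) * s ^ k) \<longlongrightarrow> norm ((deriv ^^ k) h 0 / fact k) * r ^ k) (at_left r)"
    by (intro tendsto_intros)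
  moreover have "\<forall>\<^sub>F s in at_left r. norm ((deriv ^^ k) h 0 / fact k) * s ^ k \<le> M"
    using eventually_at_left_real[OF r] by eventually_elim (use * in auto)
  ultimately show ?thesis
    by (intro tendsto_upperbound[of _ _ "at_left r"]) auto
qed

text \<open>Induction over the coordinates that may be nonzero. For a new coordinate b the Taylor
  coefficients along b are holomorphic on the same polydisc and bounded by M / r^k, so the induction
  hypothesis expands them in the remaining coordinates. The bound on the coefficients belongs to the
  claim because it gives the absolute summability that merges the iterated sum into one sum over
  multi-indices.\<close>

lemma hol_power_series_on_subspace:
  fixes G :: "'a::euclidean_space \<times> 'a \<Rightarrow> complex"
  assumes r: "r > 0" and B: "finite B" "B \<subseteq> Basis"
    and G: "hol cpl_J G (polydisc r)" "\<And>w. w \<in> polydisc r \<Longrightarrow> norm (G w) \<le> M"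
  shows "\<exists>c. (\<forall>\<alpha>\<in>B \<rightarrow>\<^sub>E UNIV. norm (c \<alpha>) * (\<Prod>b\<in>B. r ^ \<alpha> b) \<le> M) \<and>
    (\<forall>w\<in>polydisc r. (\<forall>b\<in>Basis - B. cc b w = 0) \<longrightarrow>
      ((\<lambda>\<alpha>. (\<Prod>b\<in>B. cc b w ^ \<alpha> b) * c \<alpha>) has_sum G w) (B \<rightarrow>\<^sub>E (UNIV::nat set)))"
  using B G
proof (induction B arbitrary: G M rule: finite_induct)
  case empty
  have z: "(0::'a \<times> 'a) \<in> polydisc r"
    using r by (simp add: polydisc_def cc_def zero_complex.code[symmetric])
  have "w = 0" if "\<forall>b\<in>Basis - {}. cc b w = 0" for w :: "'a \<times> 'a"
    using that by (intro cc_eqI) (simp add: cc_def zero_complex.code)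
  then have "\<forall>w\<in>polydisc r. (\<forall>b\<in>Basis - {}. cc b w = 0) \<longrightarrow> G w = G 0"
    by blast
  then show ?case
    using empty.prems(3)[OF z] by (intro exI[of _ "\<lambda>_. G 0"]) (simp add: has_sum_finite_iff)
next
  case (insert b B)
  have b: "b \<in> Basis" "b \<notin> B" and B: "B \<subseteq> Basis" "finite B" using insert by auto
  define e where "e = (b, 0 :: 'a)"
  \<comment> \<open>Removes the coordinate along \<open>b\<close>. The expansion takes place on the
    complex line through \<open>pr w\<close>, on which \<open>w\<close> has the parameter
    \<open>cc b w\<close>.\<close>
  define pr where "pr w = w - cpl.cm (cc b w) e" for w
  have cc_pr: "cc b' (pr w) = (if b' = b then 0 else cc b' w)" if "b' \<in> Basis" for b' w
    using cc_cm_Basis[OF b(1) that] by (simp add: pr_def cc_diff e_def)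
  have cc_prB: "cc b' (pr w) = cc b' w" if "b' \<in> B" for b' w
    using cc_pr[of b' w] that B(1) b(2) by auto
  have pr_disc: "pr w \<in> polydisc r" if "w \<in> polydisc r" for w
    using that cc_pr r by (auto simp: polydisc_def)
  have slice_disc: "pr w + cpl.cm t e \<in> polydisc r" if "w \<in> polydisc r" "t \<in> ball 0 r" for w t
    using that cc_pr cc_cm_Basis[OF b(1)] by (auto simp: polydisc_def cc_add e_def)
  define F where "F k = ((\<lambda>g. cpl.dd g e) ^^ k) G" for k
  define H where "H k w = F k (pr w) / fact k" for k w
  have H_coeff: "H k w = (deriv ^^ k) (\<lambda>t. G (pr w + cpl.cm t e)) 0 / fact k" if "w \<in> polydisc r" for k w
    using cpl.slice_higher_deriv[OF insert.prems(2) open_polydisc open_ball, of "0::complex" r "pr w" e 0 k]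
      slice_disc[OF that] r
    by (simp add: H_def F_def)
  have slice_hol: "(\<lambda>t. G (pr w + cpl.cm t e)) holomorphic_on ball 0 r" if "w \<in> polydisc r" for w
    by (rule cpl.slice_holomorphic[OF insert.prems(2) slice_disc[OF that] open_ball])
  have H_bound: "norm (H k w) \<le> M / r ^ k" if "w \<in> polydisc r" for k w
    using holomorphic_coeff_bound[OF slice_hol[OF that] insert.prems(3)[OF slice_disc[OF that]] r, of k]
      r unfolding H_coeff[OF that, symmetric] by (simp add: pos_le_divide_eq)
  have H_hol: "hol cpl_J (H k) (polydisc r)" for k
  proof -
    have pr_deriv: "has_cderiv cpl_J cpl_J pr pr w" for w
    proof -
      have "(pr has_derivative pr) (at w)"
        unfolding pr_def cpl.cm_def unfolding cpl_J_def cc_def e_def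
        by (auto intro!: derivative_eq_intros)
      then show ?thesis
        unfolding has_cderiv_def pr_def cpl.cm_def by (simp add: cpl_J_def cc_def e_def prod_eq_iff)
    qed
    have F: "hol cpl_J (F k) (polydisc r)"
      unfolding F_def using cpl.hol_iterated_dd[OF insert.prems(2) open_polydisc] .
    have "hol cpl_J (\<lambda>w. F k (pr w)) (polydisc r)"
      unfolding hol_def
    proof
      fix w :: "'a \<times> 'a" assume "w \<in> polydisc r"
      then obtain D where "has_cderiv cpl_J ((*) \<i>) (F k) D (pr w)"
        using F pr_disc unfolding hol_def by blast
      from has_cderiv_compose[OF pr_deriv this]
      show "\<exists>D. has_cderiv cpl_J ((*) \<i>) (\<lambda>w. F k (pr w)) D w" by blast
    qed
    then show ?thesis
      unfolding H_def by (intro hol_divide hol_const) auto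
  qed
  define Q where "Q k c \<longleftrightarrow> (\<forall>\<alpha>\<in>B \<rightarrow>\<^sub>E UNIV. norm (c \<alpha>) * (\<Prod>b\<in>B. r ^ \<alpha> b) \<le> M / r ^ k) \<and>
    (\<forall>w\<in>polydisc r. (\<forall>b\<in>Basis - B. cc b w = 0) \<longrightarrow>
      ((\<lambda>\<alpha>. (\<Prod>b\<in>B. cc b w ^ \<alpha> b) * c \<alpha>) has_sum H k w) (B \<rightarrow>\<^sub>E (UNIV::nat set)))" for k c
  have "\<exists>c. Q k c" for k
    unfolding Q_def by (rule insert.IH[OF B(1) H_hol H_bound])
  then obtain c where Q: "Q k (c k)" for k
    by metis
  have c: "norm (c k \<alpha>) * (\<Prod>b\<in>B. r ^ \<alpha> b) \<le> M / r ^ k" if "\<alpha> \<in> B \<rightarrow>\<^sub>E UNIV" for k \<alpha>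
    using Q[of k] that unfolding Q_def by blast
  have c_sum: "((\<lambda>\<alpha>. (\<Prod>b\<in>B. cc b w ^ \<alpha> b) * c k \<alpha>) has_sum H k w) (B \<rightarrow>\<^sub>E (UNIV::nat set))"
    if "w \<in> polydisc r" "\<forall>b\<in>Basis - B. cc b w = 0" for k w
    using Q[of k] that unfolding Q_def by blast
  \<comment> \<open>Multi-indices are extensional, so a multi-index on \<open>B\<close> is recovered
    by resetting the entry at \<open>b\<close> to \<open>undefined\<close>.\<close>
  define c' where "c' \<alpha> = c (\<alpha> b) (\<alpha>(b := undefined))" for \<alpha>
  have c'_upd: "c' (\<alpha>(b := k)) = c k \<alpha>" if "\<alpha> \<in> B \<rightarrow>\<^sub>E UNIV" for \<alpha> k
  proof -
    have "\<alpha>(b := undefined) = \<alpha>"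
      using PiE_arb[OF that b(2)] by (metis fun_upd_triv)
    then show ?thesis by (simp add: c'_def)
  qed
  note upd_prod = prod_power_fun_upd[OF B(2) b(2)]
  have bij: "bij_betw (\<lambda>(k, \<alpha>). \<alpha>(b := k)) (UNIV \<times> (B \<rightarrow>\<^sub>E UNIV)) (insert b B \<rightarrow>\<^sub>E (UNIV::nat set))"
    using inj_combinator[OF b(2), of "\<lambda>_. UNIV"] unfolding bij_betw_def PiE_insert_eq by blast
  show ?case
  proof (intro exI conjI ballI impI)
    fix \<alpha> assume "\<alpha> \<in> insert b B \<rightarrow>\<^sub>E (UNIV::nat set)"
    then obtain k \<beta> where \<alpha>: "\<alpha> = \<beta>(b := k)" "\<beta> \<in> B \<rightarrow>\<^sub>E UNIV"
      by (auto simp: PiE_insert_eq)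
    show "norm (c' \<alpha>) * (\<Prod>b\<in>insert b B. r ^ \<alpha> b) \<le> M"
      using c[OF \<alpha>(2), of k] r unfolding \<alpha>(1) c'_upd[OF \<alpha>(2)] upd_prod
      by (simp add: field_simps)
  next
    fix w :: "'a \<times> 'a" assume w: "w \<in> polydisc r" and w0: "\<forall>b\<in>Basis - insert b B. cc b w = 0"
    define g where "g k \<alpha> = cc b w ^ k * ((\<Prod>b\<in>B. cc b w ^ \<alpha> b) * c k \<alpha>)" for k \<alpha>
    \<comment> \<open>These ratios are below 1 on the polydisc; by the coefficient bound the terms
      are dominated by M times a product of geometric series.\<close>
    define q where "q b' = norm (cc b' w) / r" for b'
    have q: "0 \<le> q b'" "q b' < 1" if "b' \<in> Basis" for b'
      using w that r by (auto simp: q_def polydisc_def)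
    have inner: "(g k has_sum cc b w ^ k * H k w) (B \<rightarrow>\<^sub>E UNIV)" for k
    proof -
      have "((\<lambda>\<alpha>. (\<Prod>b\<in>B. cc b (pr w) ^ \<alpha> b) * c k \<alpha>) has_sum H k (pr w)) (B \<rightarrow>\<^sub>E (UNIV::nat set))"
          using w0 cc_pr by (intro c_sum pr_disc[OF w]) auto
      moreover have "pr (pr w) = pr w"
        using cc_pr[OF b(1), of w] by (simp add: pr_def[of "pr w"])
      moreover have "(\<Prod>b\<in>B. cc b (pr w) ^ \<alpha> b) = (\<Prod>b\<in>B. cc b w ^ \<alpha> b)" for \<alpha> :: "'a \<Rightarrow> nat"
        by (intro prod.cong refl) (simp add: cc_prB)
      ultimately show ?thesis
        unfolding g_def using has_sum_cmult_right by (fastforce simp: H_def)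
    qed
    have bound: "norm (g k \<alpha>) \<le> M * (\<Prod>b'\<in>insert b B. q b' ^ (\<alpha>(b := k)) b')"
      if "\<alpha> \<in> B \<rightarrow>\<^sub>E UNIV" for k \<alpha>
    proof -
      have "(\<Prod>b\<in>B. r ^ \<alpha> b) > 0"
        using r by (intro prod_pos) auto
      then have rn: "(\<Prod>b\<in>B. r ^ \<alpha> b) \<noteq> 0" by simp
      have "norm (g k \<alpha>) = (norm (cc b w) ^ k * (\<Prod>b\<in>B. norm (cc b w) ^ \<alpha> b)) * norm (c k \<alpha>)"
        by (simp add: g_def norm_mult norm_power prod_norm[symmetric])
      also have "norm (cc b w) ^ k * (\<Prod>b\<in>B. norm (cc b w) ^ \<alpha> b) =
          (q b ^ k * (\<Prod>b'\<in>B. q b' ^ \<alpha> b')) * (r ^ k * (\<Prod>b\<in>B. r ^ \<alpha> b))"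
        using r rn by (simp add: q_def power_divide prod_dividef)
      also have "\<dots> * norm (c k \<alpha>) = (q b ^ k * (\<Prod>b'\<in>B. q b' ^ \<alpha> b')) * (r ^ k * (norm (c k \<alpha>) * (\<Prod>b\<in>B. r ^ \<alpha> b)))"
        by (simp add: algebra_simps)
      also have "\<dots> \<le> (q b ^ k * (\<Prod>b'\<in>B. q b' ^ \<alpha> b')) * M"
        using c[OF that, of k] r q b B
        by (intro mult_left_mono mult_nonneg_nonneg prod_nonneg) (auto simp: field_simps)
      finally show ?thesis
        unfolding upd_prod by (simp add: mult.commute)
    qed
    have "(\<lambda>\<alpha>. \<Prod>b'\<in>insert b B. q b' ^ \<alpha> b') summable_on (insert b B \<rightarrow>\<^sub>E (UNIV::nat set))"
      using q insert.prems(1) insert.hyps(1) by (intro geometric_summable_PiE) auto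
    then have "(\<lambda>(k, \<alpha>). \<Prod>b'\<in>insert b B. q b' ^ (\<alpha>(b := k)) b') summable_on (UNIV \<times> (B \<rightarrow>\<^sub>E UNIV))"
      using summable_on_reindex_bij_betw[OF bij, of "\<lambda>\<alpha>. \<Prod>b'\<in>insert b B. q b' ^ \<alpha> b'"]
      by (simp add: case_prod_unfold)
    then have "(\<lambda>p. M * (case p of (k, \<alpha>) \<Rightarrow> \<Prod>b'\<in>insert b B. q b' ^ (\<alpha>(b := k)) b')) summable_on (UNIV \<times> (B \<rightarrow>\<^sub>E UNIV))"
      by (rule summable_on_cmult_right)
    then have "(\<lambda>(k, \<alpha>). g k \<alpha>) summable_on (UNIV \<times> (B \<rightarrow>\<^sub>E UNIV))"
    proof (rule abs_summable_summable[OF Infinite_Sum.abs_summable_on_comparison_test'])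
      fix p :: "nat \<times> ('a \<Rightarrow> nat)" assume "p \<in> UNIV \<times> (B \<rightarrow>\<^sub>E UNIV)"
      then show "norm (case p of (k, \<alpha>) \<Rightarrow> g k \<alpha>)
          \<le> M * (case p of (k, \<alpha>) \<Rightarrow> \<Prod>b'\<in>insert b B. q b' ^ (\<alpha>(b := k)) b')"
        using bound[of "snd p" "fst p"] unfolding case_prod_beta mem_Times_iff by blast
    qed
    moreover have "((\<lambda>k. cc b w ^ k * H k w) has_sum G w) UNIV"
    proof (rule norm_summable_imp_has_sum)
      have t: "cc b w \<in> ball 0 r" using w b(1) by (simp add: polydisc_def)
      have "(\<lambda>k. (deriv ^^ k) (\<lambda>t. G (pr w + cpl.cm t e)) 0 / fact k * (cc b w - 0) ^ k) sums G (pr w + cpl.cm (cc b w) e)"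
        by (rule holomorphic_power_series[OF slice_hol[OF w] t])
      then show "(\<lambda>k. cc b w ^ k * H k w) sums G w"
        by (simp add: H_coeff[OF w] pr_def mult.commute)
      have "summable (\<lambda>k. M * q b ^ k)"
        using q[OF b(1)] by (intro summable_mult summable_geometric) auto
      then show "summable (\<lambda>k. norm (cc b w ^ k * H k w))"
      proof (rule summable_comparison_test')
        fix k
        have "norm (cc b w) ^ k * norm (H k w) \<le> norm (cc b w) ^ k * (M / r ^ k)"
          using H_bound[OF w, of k] by (intro mult_left_mono) auto
        then show "norm (norm (cc b w ^ k * H k w)) \<le> M * q b ^ k"
          by (simp add: q_def power_divide norm_mult norm_power mult.commute)
      qed
    qed
    ultimately have "((\<lambda>(k, \<alpha>). g k \<alpha>) has_sum G w) (UNIV \<times> (B \<rightarrow>\<^sub>E UNIV))"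
      using inner by (intro has_sum_SigmaI[where g = "\<lambda>k. cc b w ^ k * H k w"]) auto
    also have "?this \<longleftrightarrow> ((\<lambda>(k, \<alpha>). (\<Prod>b'\<in>insert b B. cc b' w ^ (\<alpha>(b := k)) b') * c' (\<alpha>(b := k))) has_sum G w) (UNIV \<times> (B \<rightarrow>\<^sub>E UNIV))"
      by (intro has_sum_cong) (auto simp: upd_prod c'_upd g_def mult.assoc simp del: fun_upd_apply)
    also have "\<dots> \<longleftrightarrow> ((\<lambda>\<alpha>. (\<Prod>b\<in>insert b B. cc b w ^ \<alpha> b) * c' \<alpha>) has_sum G w) (insert b B \<rightarrow>\<^sub>E UNIV)"
      using has_sum_reindex_bij_betw[OF bij, of "\<lambda>\<alpha>. (\<Prod>b\<in>insert b B. cc b w ^ \<alpha> b) * c' \<alpha>"]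
      by (simp add: case_prod_unfold)
    finally show "((\<lambda>\<alpha>. (\<Prod>b\<in>insert b B. cc b w ^ \<alpha> b) * c' \<alpha>) has_sum G w) (insert b B \<rightarrow>\<^sub>E UNIV)" .
  qed
qed

lemma hol_power_series:
  fixes G :: "'a::euclidean_space \<times> 'a \<Rightarrow> complex"
  assumes "d > 0" "hol cpl_J G (ball 0 d)"
  obtains r c where "r > 0" "\<And>h. \<forall>b\<in>Basis. \<bar>h \<bullet> b\<bar> < r \<Longrightarrow> norm h < d \<and>
    ((\<lambda>\<alpha>. (\<Prod>b\<in>Basis. of_real (h \<bullet> b) ^ \<alpha> b) * c \<alpha>) has_sum G (h, 0)) (Basis \<rightarrow>\<^sub>E (UNIV::nat set))"
proof -
  have "(0 :: 'a \<times> 'a) \<in> ball 0 d" using assms(1) by simp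
  then obtain e M where e: "e > 0" "ball 0 e \<subseteq> (ball 0 d :: ('a \<times> 'a) set)"
    and M: "\<And>w. w \<in> ball 0 e \<Longrightarrow> norm (G w) \<le> M"
    using cpl.hol_locally_bounded[OF assms(2) _ open_ball] by blast
  obtain r where r: "r > 0" "polydisc r \<subseteq> (ball 0 e :: ('a \<times> 'a) set)"
    using polydisc_subset_ball[OF e(1)] by blast
  have "hol cpl_J G (polydisc r)" "\<And>w. w \<in> polydisc r \<Longrightarrow> norm (G w) \<le> M"
    using assms(2) e(2) r(2) M by (auto intro: hol_subset)
  from hol_power_series_on_subspace[OF r(1) finite_Basis order_refl this]
  obtain c where c: "\<And>w. w \<in> polydisc r \<Longrightarrow>
      ((\<lambda>\<alpha>. (\<Prod>b\<in>Basis. cc b w ^ \<alpha> b) * c \<alpha>) has_sum G w) (Basis \<rightarrow>\<^sub>E (UNIV::nat set))"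
    by auto
  show ?thesis
  proof (rule that[OF r(1)])
    fix h :: 'a assume "\<forall>b\<in>Basis. \<bar>h \<bullet> b\<bar> < r"
    then have h: "(h, 0) \<in> polydisc r"
      by (simp add: polydisc_def cc_real)
    then have "norm h < d"
      using r(2) e(2) by (force simp: dist_norm norm_prod_def)
    then show "norm h < d \<and> ((\<lambda>\<alpha>. (\<Prod>b\<in>Basis. of_real (h \<bullet> b) ^ \<alpha> b) * c \<alpha>) has_sum G (h, 0)) (Basis \<rightarrow>\<^sub>E (UNIV::nat set))"
      using c[OF h] by (simp add: cc_real)
  qed
qed

lemma has_sum_sum:
  fixes f :: "'i \<Rightarrow> 'k \<Rightarrow> 'b::real_normed_vector"
  assumes "\<And>i. i \<in> I \<Longrightarrow> (f i has_sum s i) A"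
  shows "((\<lambda>x. \<Sum>i\<in>I. f i x) has_sum (\<Sum>i\<in>I. s i)) A"
  using assms by (induction I rule: infinite_finite_induct) (auto intro: has_sum_add)

text \<open>Only the real part of \<open>G\<close> has to match: at real points the real parts of
  its coefficients give a series for \<open>Re G\<close>, so this criterion also covers functions
  \<open>G\<close> that are not real there.\<close>

definition hol_extendable :: "('a::euclidean_space \<Rightarrow> real) \<Rightarrow> 'a \<Rightarrow> bool" where
  "hol_extendable f a \<longleftrightarrow>
     (\<exists>d>0. \<exists>G. hol cpl_J G (ball 0 d) \<and> (\<forall>h. norm h < d \<longrightarrow> f (a + h) = Re (G (h, 0))))"

lemma real_analytic_at_hol_extendable:
  fixes F :: "'a::euclidean_space \<Rightarrow> 'b::euclidean_space"
  assumes "\<And>i. i \<in> Basis \<Longrightarrow> hol_extendable (\<lambda>x. F x \<bullet> i) a"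
  shows "real_analytic_at F a"
proof -
  define Q where "Q i r c \<longleftrightarrow> r > 0 \<and> (\<forall>h. (\<forall>b\<in>Basis. \<bar>h \<bullet> b\<bar> < r) \<longrightarrow>
      ((\<lambda>\<alpha>. (\<Prod>b\<in>Basis. (h \<bullet> b) ^ \<alpha> b) * c \<alpha>) has_sum (F (a + h) \<bullet> i)) (Basis \<rightarrow>\<^sub>E (UNIV::nat set)))" for i r c
  have "\<exists>r c. Q i r c" if i: "i \<in> Basis" for i
  proof -
    obtain d G where d: "d > 0" "hol cpl_J G (ball 0 d)" and G: "\<And>h. norm h < d \<Longrightarrow> F (a + h) \<bullet> i = Re (G (h, 0))"
      using assms[OF i] unfolding hol_extendable_def by blast
    obtain r c where r: "r > 0" and c: "\<And>h. \<forall>b\<in>Basis. \<bar>h \<bullet> b\<bar> < r \<Longrightarrow> norm h < d \<and>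
      ((\<lambda>\<alpha>. (\<Prod>b\<in>Basis. of_real (h \<bullet> b) ^ \<alpha> b) * c \<alpha>) has_sum G (h, 0)) (Basis \<rightarrow>\<^sub>E (UNIV::nat set))"
      by (rule hol_power_series[OF d]) (rule that)
    have "((\<lambda>\<alpha>. (\<Prod>b\<in>Basis. (h \<bullet> b) ^ \<alpha> b) * Re (c \<alpha>)) has_sum (F (a + h) \<bullet> i)) (Basis \<rightarrow>\<^sub>E (UNIV::nat set))"
      if "\<forall>b\<in>Basis. \<bar>h \<bullet> b\<bar> < r" for h
    proof -
      have "Re ((\<Prod>b\<in>Basis. of_real (h \<bullet> b) ^ \<alpha> b) * c \<alpha>) = (\<Prod>b\<in>Basis. (h \<bullet> b) ^ \<alpha> b) * Re (c \<alpha>)" for \<alpha> :: "'a \<Rightarrow> nat"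
      proof -
        have "(\<Prod>b\<in>Basis. of_real (h \<bullet> b) ^ \<alpha> b) = complex_of_real (\<Prod>b\<in>Basis. (h \<bullet> b) ^ \<alpha> b)"
          by simp
        then show ?thesis by (simp only: Re_complex_of_real Im_complex_of_real times_complex.sel)
      qed
      then show ?thesis
        using has_sum_bounded_linear[OF bounded_linear_Re conjunct2[OF c[OF that]]] G[OF conjunct1[OF c[OF that]]]
        by simp
    qed
    then have "Q i r (\<lambda>\<alpha>. Re (c \<alpha>))" using r by (simp add: Q_def)
    then show ?thesis by blast
  qed
  then obtain r c where Q: "\<And>i. i \<in> Basis \<Longrightarrow> Q i (r i) (c i)"
    by metis
  have r: "r i > 0" if "i \<in> Basis" for i
    using Q[OF that] by (simp add: Q_def)
  have c: "((\<lambda>\<alpha>. (\<Prod>b\<in>Basis. (h \<bullet> b) ^ \<alpha> b) * c i \<alpha>) has_sum (F (a + h) \<bullet> i)) (Basis \<rightarrow>\<^sub>E (UNIV::nat set))"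
    if "i \<in> Basis" "\<forall>b\<in>Basis. \<bar>h \<bullet> b\<bar> < r i" for i h
    using Q[OF that(1)] that(2) by (simp add: Q_def)
  define \<rho> where "\<rho> = Min (r ` Basis)"
  have \<rho>: "\<rho> > 0" "\<And>i. i \<in> Basis \<Longrightarrow> \<rho> \<le> r i"
    using r by (auto simp: \<rho>_def)
  show ?thesis
    unfolding real_analytic_at_def
  proof (intro exI conjI allI impI)
    show "\<rho> > 0" by (rule \<rho>)
    fix h :: 'a assume h: "\<forall>b\<in>Basis. \<bar>h \<bullet> b\<bar> < \<rho>"
    have "((\<lambda>\<alpha>. \<Sum>i\<in>Basis. ((\<Prod>b\<in>Basis. (h \<bullet> b) ^ \<alpha> b) * c i \<alpha>) *\<^sub>R i) has_sum (\<Sum>i\<in>Basis. (F (a + h) \<bullet> i) *\<^sub>R i)) (Basis \<rightarrow>\<^sub>E UNIV)"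
    proof (rule has_sum_sum)
      fix i :: 'b assume i: "i \<in> Basis"
      have "\<forall>b\<in>Basis. \<bar>h \<bullet> b\<bar> < r i" using h \<rho>(2)[OF i] by force
      from has_sum_bounded_linear[OF bounded_linear_scaleR_left c[OF i this]]
      show "((\<lambda>\<alpha>. ((\<Prod>b\<in>Basis. (h \<bullet> b) ^ \<alpha> b) * c i \<alpha>) *\<^sub>R i) has_sum (F (a + h) \<bullet> i) *\<^sub>R i) (Basis \<rightarrow>\<^sub>E UNIV)" .
    qed
    then show "((\<lambda>\<alpha>. (\<Prod>b\<in>Basis. (h \<bullet> b) ^ \<alpha> b) *\<^sub>R (\<Sum>i\<in>Basis. c i \<alpha> *\<^sub>R i)) has_sum F (a + h)) (Basis \<rightarrow>\<^sub>E UNIV)"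
      by (simp add: scaleR_sum_right euclidean_representation)
  qed
qed

section \<open>The standard $r$-matrix\<close>

lemma position_strict_mono: "i < j \<Longrightarrow> position i < position (j :: 'n::{finite,linorder})"
proof -
  assume "i < j"
  then have "{k. k \<le> i} \<subseteq> {k. k \<le> j}" "j \<in> {k. k \<le> j} - {k. k \<le> i}"
    by auto
  then show ?thesis
    unfolding position_def by (intro psubset_card_mono) auto
qed

lemma inj_position: "inj (position :: 'n::{finite,linorder} \<Rightarrow> nat)"
  by (rule linorder_injI) (metis position_strict_mono less_irrefl)

lemma range_position: "range (position :: 'n::{finite,linorder} \<Rightarrow> nat) = {1..CARD('n)}"
proof (rule card_subset_eq)
  have "position j \<ge> 1" for j :: 'n
    unfolding position_def by (simp add: Suc_le_eq card_gt_0_iff) blast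
  moreover have "position j \<le> CARD('n)" for j :: 'n
    unfolding position_def by (intro card_mono) auto
  ultimately show "range (position :: 'n \<Rightarrow> nat) \<subseteq> {1..CARD('n)}"
    by auto
  show "card (range (position :: 'n \<Rightarrow> nat)) = card {1..CARD('n)}"
    by (simp add: card_image[OF inj_position])
qed auto

lemma position_opposite: "position (opposite j) = CARD('n) + 1 - position (j :: 'n::{finite,linorder})"
proof -
  have "position j \<in> {1..CARD('n)}"
    using range_position[where 'n = 'n] by blast
  then have "CARD('n) + 1 - position j \<in> range (position :: 'n \<Rightarrow> nat)"
    unfolding range_position by auto
  then obtain k :: 'n where k: "position k = CARD('n) + 1 - position j"
    by force
  then have "opposite j = k"
    unfolding opposite_def by (intro the_equality) (simp_all add: injD[OF inj_position])
  with k show ?thesis by simp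
qed

lemma opposite_opposite [simp]: "opposite (opposite j) = (j :: 'n::{finite,linorder})"
proof -
  have "position j \<in> {1..CARD('n)}"
    using range_position[where 'n = 'n] by blast
  then have "position (opposite (opposite j)) = position j"
    unfolding position_opposite by auto
  then show ?thesis
    by (rule injD[OF inj_position])
qed

lemma opposite_less_iff: "opposite j < opposite k \<longleftrightarrow> k < (j :: 'n::{finite,linorder})"
proof -
  have *: "opposite k < opposite j" if "j < k" for j k :: 'n
  proof (rule ccontr)
    assume "\<not> opposite k < opposite j"
    then have "position (opposite j) \<le> position (opposite k)"
      using position_strict_mono by (metis le_less linorder_not_less)
    moreover have "position k \<in> {1..CARD('n)}"
      using range_position[where 'n = 'n] by blast
    ultimately show False
      using position_strict_mono[OF that] unfolding position_opposite by auto
  qed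
  show ?thesis
    using *[of k j] *[of "opposite j" "opposite k"] by auto
qed

lemma opposite_eq_iff: "opposite j = k \<longleftrightarrow> j = opposite (k :: 'n::{finite,linorder})"
  by auto

type_synonym 'n cvec = "complex ^ 'n"
type_synonym 'n cmat = "complex ^ 'n ^ 'n"

section \<open>Signs and the modified Yang-Baxter equation\<close>

definition th :: "'n::linorder \<Rightarrow> 'n \<Rightarrow> complex" where
  "th j k = (if j < k then 1 else if k < j then - 1 else 0)"

lemma th_opposite: "th (opposite j) (opposite k) = - th j (k :: 'n::{finite,linorder})"
  by (auto simp: th_def opposite_less_iff)

lemma th_swap: "th k j = - th j k"
  by (auto simp: th_def)

text \<open>At least two of the indices differ, and every possible order gives the same value. This
  is the modified Yang-Baxter equation for a single product of matrix entries; at i = j = k the left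
  side would be 0.\<close>

lemma th_triple:
  assumes "\<not> (i = j \<and> j = k)"
  shows "th i j * th j k - th i k * (th i j + th j k) = - 1"
  using assms by (cases i j rule: linorder_cases; cases j k rule: linorder_cases; cases i k rule: linorder_cases)
    (auto simp: th_def)

text \<open>The operator on matrices that the standard $r$-matrix induces; in the coordinates
  $u_j + i u_{j'}$ it multiplies the entries of a matrix by signs, see \<open>Rop_conj\<close>.\<close>

definition Rop :: "real \<Rightarrow> 'n::{finite,linorder} cmat \<Rightarrow> 'n cmat" where
  "Rop \<epsilon> Y = (\<chi> a b. of_real \<epsilon> * ((th a b + th (opposite a) b) * Y $ a $ opposite b
     + (th (opposite a) b - th a b) * Y $ opposite a $ b))"

definition Qop :: "real \<Rightarrow> 'n::{finite,linorder} cmat \<Rightarrow> 'n cmat" where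
  "Qop \<epsilon> A = (\<chi> j k. - 2 * \<i> * of_real \<epsilon> * th j k * A $ j $ k)"

definition Cmat :: "'n::{finite,linorder} cmat" where
  "Cmat = (\<chi> a b. (if a = b then 1 else 0) + (if opposite a = b then \<i> else 0))"

text \<open>With F the matrix that exchanges j and j', \<open>Cmat\<close> is 1 + iF. As F^2 = 1,
  the product (1 + iF)(1 - iF) equals 2, which explains the halves.\<close>

definition Cinv :: "'n::{finite,linorder} cmat" where
  "Cinv = (\<chi> a b. (if a = b then 1/2 else 0) - (if opposite a = b then \<i>/2 else 0))"

lemma Cmat_mult: "(Cmat ** Y) $ a $ b = Y $ a $ b + \<i> * Y $ opposite a $ b"
  by (simp add: Cmat_def matrix_matrix_mult_def distrib_right sum.distrib if_distribR if_distrib[of "\<lambda>x. x * _"] cong: if_cong)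

lemma mult_Cmat: "(Y ** Cmat) $ a $ b = Y $ a $ b + \<i> * Y $ a $ opposite b"
  by (simp add: Cmat_def matrix_matrix_mult_def distrib_left sum.distrib opposite_eq_iff if_distrib[of "\<lambda>x. _ * x"] cong: if_cong)

lemma Cinv_mult: "(Cinv ** Y) $ a $ b = (Y $ a $ b - \<i> * Y $ opposite a $ b) / 2"
  by (simp add: Cinv_def matrix_matrix_mult_def left_diff_distrib sum_subtractf if_distrib[of "\<lambda>x. x * _"] diff_divide_distrib cong: if_cong)

lemma mult_Cinv: "(Y ** Cinv) $ a $ b = (Y $ a $ b - \<i> * Y $ a $ opposite b) / 2"
  by (simp add: Cinv_def matrix_matrix_mult_def right_diff_distrib sum_subtractf opposite_eq_iff if_distrib[of "\<lambda>x. _ * x"] diff_divide_distrib cong: if_cong)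

lemma Cmat_Cinv:
  "Cmat ** Cinv = (mat 1 :: 'a::{finite,linorder} cmat)" "Cinv ** Cmat = (mat 1 :: 'a cmat)"
proof -
  have C: "Cmat $ a $ b = (if a = b then 1 else 0) + (if opposite a = b then \<i> else 0)"
    and D: "Cinv $ a $ b = (if a = b then 1/2 else 0) - (if opposite a = b then \<i>/2 else 0)" for a b :: 'a
    by (simp_all add: Cmat_def Cinv_def)
  show "Cmat ** Cinv = (mat 1 :: 'a cmat)" "Cinv ** Cmat = (mat 1 :: 'a cmat)"
    by (auto simp: vec_eq_iff Cmat_mult Cinv_mult C D mat_def opposite_eq_iff distrib_left right_diff_distrib)
qed

lemma Rop_conj: "Rop \<epsilon> Y = Cmat ** Qop \<epsilon> (Cinv ** Y ** Cmat) ** Cinv"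
proof -
  have "th a (opposite b) = - th (opposite a) b" for a b :: 'a
    using th_opposite[of a "opposite b"] by simp
  then show ?thesis
    by (simp add: vec_eq_iff Rop_def Qop_def mult_Cinv Cmat_mult mult_Cmat Cinv_mult th_opposite)
      (simp add: field_simps)
qed

lemma trace_matrix_mult: "trace (A ** B) = (\<Sum>i\<in>UNIV. \<Sum>j\<in>UNIV. A $ i $ j * B $ j $ i)"
  by (simp add: trace_def matrix_matrix_mult_def)

definition comm :: "'n::finite cmat \<Rightarrow> 'n cmat \<Rightarrow> 'n cmat" where
  "comm A B = A ** B - B ** A"

lemma comm_nth: "comm A B $ i $ k = (\<Sum>j\<in>UNIV. A $ i $ j * B $ j $ k - B $ i $ j * A $ j $ k)"
  by (simp add: comm_def matrix_matrix_mult_def sum_subtractf)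

text \<open>In each entry (i, k) the summand with middle index j carries the sign combination of
  \<open>th_triple\<close>, multiplied by \<kappa>^2 = -4 \<epsilon>^2. In the exceptional case i =
  j = k the corresponding summand of the commutator vanishes.\<close>

lemma Qop_mCYBE:
  "comm (Qop \<epsilon> A) (Qop \<epsilon> B) = Qop \<epsilon> (comm (Qop \<epsilon> A) B + comm A (Qop \<epsilon> B)) + (4 * \<epsilon>\<^sup>2) *\<^sub>R comm A B"
proof -
  define \<kappa> where "\<kappa> = - 2 * \<i> * complex_of_real \<epsilon>"
  have \<kappa>: "\<kappa> * \<kappa> = - of_real (4 * \<epsilon>\<^sup>2)"
    unfolding \<kappa>_def by (simp add: power2_eq_square algebra_simps)
  have Q: "Qop \<epsilon> X $ i $ j = \<kappa> * th i j * X $ i $ j" for X :: "'a cmat" and i j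
    by (simp add: Qop_def \<kappa>_def)
  have "comm (Qop \<epsilon> A) (Qop \<epsilon> B) $ i $ k
      = (Qop \<epsilon> (comm (Qop \<epsilon> A) B + comm A (Qop \<epsilon> B)) + (4 * \<epsilon>\<^sup>2) *\<^sub>R comm A B) $ i $ k" for i k
  proof -
    have eq: "\<kappa> * \<kappa> * (th i j * th j k - th i k * (th i j + th j k)) * (A $ i $ j * B $ j $ k - B $ i $ j * A $ j $ k)
          = of_real (4 * \<epsilon>\<^sup>2) * (A $ i $ j * B $ j $ k - B $ i $ j * A $ j $ k)" for j
    proof (cases "i = j \<and> j = k")
      case True
      then have "i = k" "j = k" by auto
      then have "A $ i $ j * B $ j $ k - B $ i $ j * A $ j $ k = 0"
        using mult.commute[of "A $ k $ k" "B $ k $ k"] by (simp only: diff_self)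
      then show ?thesis by (simp only: mult_zero_right)
    next
      case False
      show ?thesis
        unfolding th_triple[OF False] \<kappa> by (simp only: mult_minus_left mult_minus_right minus_minus mult_1_right)
    qed
    have "comm (Qop \<epsilon> A) (Qop \<epsilon> B) $ i $ k - Qop \<epsilon> (comm (Qop \<epsilon> A) B + comm A (Qop \<epsilon> B)) $ i $ k
        = (\<Sum>j\<in>UNIV. \<kappa> * \<kappa> * (th i j * th j k - th i k * (th i j + th j k)) * (A $ i $ j * B $ j $ k - B $ i $ j * A $ j $ k))"
      unfolding Q vector_add_component comm_nth sum.distrib[symmetric] sum_distrib_left sum_subtractf[symmetric]
      by (intro sum.cong refl) (simp add: algebra_simps)
    also have "\<dots> = (\<Sum>j\<in>UNIV. of_real (4 * \<epsilon>\<^sup>2) * (A $ i $ j * B $ j $ k - B $ i $ j * A $ j $ k))"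
      by (simp only: eq)
    also have "\<dots> = ((4 * \<epsilon>\<^sup>2) *\<^sub>R comm A B) $ i $ k"
      unfolding vector_scaleR_component comm_nth sum_distrib_left[symmetric] by (simp add: scaleR_conv_of_real)
    finally show ?thesis by (simp add: algebra_simps)
  qed
  then show ?thesis by (simp add: vec_eq_iff)
qed

lemma matrix_add_rdistrib: "(A + B) ** C = A ** C + B ** (C :: 'n::finite cmat)"
  by (vector matrix_matrix_mult_def sum.distrib[symmetric] field_simps)

lemma matrix_sub_distrib:
  "(A - B) ** C = A ** C - B ** (C :: 'n::finite cmat)" "C ** (A - B) = C ** A - C ** B"
  by (vector matrix_matrix_mult_def sum_subtractf[symmetric] field_simps)+

lemma comm_conj:
  fixes C D :: "'n::finite cmat"
  assumes "D ** C = mat 1"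
  shows "comm (C ** A ** D) (C ** B ** D) = C ** comm A B ** D"
proof -
  have "(C ** A ** D) ** (C ** B ** D) = C ** (A ** B) ** D" for A B
  proof -
    have "(C ** A ** D) ** (C ** B ** D) = C ** A ** (D ** C) ** B ** D"
      by (simp only: matrix_mul_assoc)
    then show ?thesis
      by (simp add: assms matrix_mul_assoc)
  qed
  then show ?thesis
    by (simp add: comm_def matrix_sub_distrib)
qed

lemma conj_conj:
  fixes C D :: "'n::finite cmat"
  assumes "D ** C = mat 1"
  shows "D ** (C ** A ** D) ** C = A"
proof -
  have "D ** (C ** A ** D) ** C = (D ** C) ** A ** (D ** C)"
    by (simp only: matrix_mul_assoc)
  then show ?thesis by (simp add: assms)
qed

lemma Qop_conj_Rop: "Qop \<epsilon> (Cinv ** Y ** Cmat) = Cinv ** Rop \<epsilon> Y ** Cmat"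
  unfolding Rop_conj by (simp add: conj_conj Cmat_Cinv)

text \<open>Conjugation by \<open>Cmat\<close> respects commutators and turns \<open>Rop\<close>
  into \<open>Qop\<close>, so the equation is carried over.\<close>

lemma Rop_mCYBE:
  "comm (Rop \<epsilon> X) (Rop \<epsilon> Y) = Rop \<epsilon> (comm (Rop \<epsilon> X) Y + comm X (Rop \<epsilon> Y)) + (4 * \<epsilon>\<^sup>2) *\<^sub>R comm X Y"
proof -
  let ?c = "\<lambda>X. Cinv ** X ** Cmat"
  have c: "comm (?c X) (?c Y) = ?c (comm X Y)" for X Y :: "'a cmat"
    by (rule comm_conj[OF Cmat_Cinv(1)])
  have "?c (comm (Rop \<epsilon> X) (Rop \<epsilon> Y)) = comm (Qop \<epsilon> (?c X)) (Qop \<epsilon> (?c Y))"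
    by (simp add: c Qop_conj_Rop)
  also have "\<dots> = Qop \<epsilon> (comm (Qop \<epsilon> (?c X)) (?c Y) + comm (?c X) (Qop \<epsilon> (?c Y))) + (4 * \<epsilon>\<^sup>2) *\<^sub>R comm (?c X) (?c Y)"
    by (rule Qop_mCYBE)
  also have "comm (Qop \<epsilon> (?c X)) (?c Y) + comm (?c X) (Qop \<epsilon> (?c Y)) = ?c (comm (Rop \<epsilon> X) Y + comm X (Rop \<epsilon> Y))"
    by (simp only: Qop_conj_Rop c matrix_add_ldistrib matrix_add_rdistrib)
  also have "comm (?c X) (?c Y) = ?c (comm X Y)"
    by (rule c)
  also have "Qop \<epsilon> (?c (comm (Rop \<epsilon> X) Y + comm X (Rop \<epsilon> Y))) + (4 * \<epsilon>\<^sup>2) *\<^sub>R ?c (comm X Y)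
      = ?c (Rop \<epsilon> (comm (Rop \<epsilon> X) Y + comm X (Rop \<epsilon> Y)) + (4 * \<epsilon>\<^sup>2) *\<^sub>R comm X Y)"
    unfolding Qop_conj_Rop
    by (simp add: matrix_add_ldistrib matrix_add_rdistrib matrix_scalar_ac scalar_matrix_assoc[symmetric])
  finally have "Cmat ** ?c (comm (Rop \<epsilon> X) (Rop \<epsilon> Y)) ** Cinv
      = Cmat ** ?c (Rop \<epsilon> (comm (Rop \<epsilon> X) Y + comm X (Rop \<epsilon> Y)) + (4 * \<epsilon>\<^sup>2) *\<^sub>R comm X Y) ** Cinv"
    by simp
  then show ?thesis
    by (simp only: conj_conj[OF Cmat_Cinv(1)])
qed

lemma trace_Rop: "trace (X ** Rop \<epsilon> Y) = - trace (Rop \<epsilon> X ** Y)"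
proof -
  have Q: "trace (A ** Qop \<epsilon> B) = - trace (Qop \<epsilon> A ** B)" for A B :: "'a cmat"
    unfolding trace_matrix_mult sum_negf[symmetric] Qop_def
  proof (intro sum.cong refl)
    fix i j :: 'a
    show "A $ i $ j * (\<chi> j k. - 2 * \<i> * of_real \<epsilon> * th j k * B $ j $ k) $ j $ i
        = - ((\<chi> j k. - 2 * \<i> * of_real \<epsilon> * th j k * A $ j $ k) $ i $ j * B $ j $ i)"
      by (simp add: th_swap[of j i])
  qed
  have t: "trace (X ** (Cmat ** B ** Cinv)) = trace ((Cinv ** X ** Cmat) ** B)" for X B :: "'a cmat"
    using trace_mul_sym[of "X ** Cmat ** B" Cinv] by (simp add: matrix_mul_assoc)
  have t': "trace ((Cmat ** B ** Cinv) ** X) = trace (B ** (Cinv ** X ** Cmat))" for X B :: "'a cmat"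
    using trace_mul_sym[of "Cmat" "B ** Cinv ** X"] by (simp add: matrix_mul_assoc)
  show ?thesis
    unfolding Rop_conj t t' Q ..
qed

text \<open>In the formula for \<open>Rop\<close> the sign \<open>th (opposite a) b\<close> is
  symmetric in a and b, while \<open>th a b\<close> is antisymmetric. Hence so(n) is preserved, and
  the contractions of r act as infinitesimal rotations.\<close>

lemma Rop_antisym:
  assumes "transpose Y = - Y"
  shows "transpose (Rop \<epsilon> Y) = - Rop \<epsilon> Y"
proof -
  have Y: "Y $ b $ a = - Y $ a $ b" for a b
  proof -
    have "transpose Y $ a $ b = (- Y) $ a $ b" unfolding assms ..
    then show ?thesis unfolding transpose_def by simp
  qed
  have th: "th (opposite b) a = th (opposite a) b" "th b a = - th a b" for a b :: 'a
  proof -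
    have "th (opposite b) a = th (opposite b) (opposite (opposite a))" by simp
    also have "\<dots> = - th b (opposite a)" by (rule th_opposite)
    also have "\<dots> = th (opposite a) b" by (subst th_swap) simp
    finally show "th (opposite b) a = th (opposite a) b" .
  qed (rule th_swap)
  show ?thesis
  proof -
    have "Rop \<epsilon> Y $ b $ a = - Rop \<epsilon> Y $ a $ b" for a b
      unfolding Rop_def vec_lambda_beta th(1)[of b a] th(2)[of b a] Y[of b "opposite a"] Y[of "opposite b" a]
      by (simp add: algebra_simps)
    then have "transpose (Rop \<epsilon> Y) $ a $ b = (- Rop \<epsilon> Y) $ a $ b" for a b
      unfolding transpose_def vec_lambda_beta vector_uminus_component .
    then show ?thesis unfolding vec_eq_iff by blast
  qed
qed

section \<open>Contractions of the r-matrix with vectors\<close>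

lemma dotc_simps:
  "dotc (a + b) x = dotc a x + dotc b x" "dotc x (a + b) = dotc x a + dotc x b"
  "dotc (a - b) x = dotc a x - dotc b x" "dotc x (a - b) = dotc x a - dotc x b"
  "dotc (k *s a) x = k * dotc a x" "dotc x (k *s a) = k * dotc x a"
  "dotc (- a) x = - dotc a x" "dotc x (- a) = - dotc x a"
  "dotc 0 x = 0" "dotc x 0 = 0"
  by (simp_all add: dotc_def algebra_simps sum.distrib sum_subtractf sum_distrib_left sum_negf)

lemma dotc_commute: "dotc a b = dotc b a"
  unfolding dotc_def by (intro sum.cong refl mult.commute)

definition rr :: "real \<Rightarrow> 'n::{finite,linorder} cvec \<Rightarrow> 'n cvec \<Rightarrow> 'n cvec \<Rightarrow> 'n cvec \<Rightarrow> complex" where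
  "rr \<epsilon> a b u v = (\<Sum>j\<in>UNIV. \<Sum>k\<in>UNIV. \<Sum>l\<in>UNIV. \<Sum>m\<in>UNIV. r_mat \<epsilon> j k l m * a $ j * b $ k * u $ l * v $ m)"

lemma rr_simps:
  "rr \<epsilon> (a + a') b u v = rr \<epsilon> a b u v + rr \<epsilon> a' b u v"
  "rr \<epsilon> a (b + b') u v = rr \<epsilon> a b u v + rr \<epsilon> a b' u v"
  "rr \<epsilon> a b (u + u') v = rr \<epsilon> a b u v + rr \<epsilon> a b u' v"
  "rr \<epsilon> a b u (v + v') = rr \<epsilon> a b u v + rr \<epsilon> a b u v'"
  "rr \<epsilon> (k *s a) b u v = k * rr \<epsilon> a b u v"
  "rr \<epsilon> a (k *s b) u v = k * rr \<epsilon> a b u v"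
  "rr \<epsilon> a b (k *s u) v = k * rr \<epsilon> a b u v"
  "rr \<epsilon> a b u (k *s v) = k * rr \<epsilon> a b u v"
  unfolding rr_def vector_add_component vector_smult_component
  by (simp_all only: distrib_left distrib_right sum.distrib sum_distrib_left mult_ac)

lemma rr_diff:
  "rr \<epsilon> a b (u - u') v = rr \<epsilon> a b u v - rr \<epsilon> a b u' v"
  "rr \<epsilon> a b u (v - v') = rr \<epsilon> a b u v - rr \<epsilon> a b u v'"
proof -
  show "rr \<epsilon> a b (u - u') v = rr \<epsilon> a b u v - rr \<epsilon> a b u' v"
    using rr_simps(3)[of \<epsilon> a b "u - u'" u' v] by (simp add: eq_diff_eq)
  show "rr \<epsilon> a b u (v - v') = rr \<epsilon> a b u v - rr \<epsilon> a b u v'"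
    using rr_simps(4)[of \<epsilon> a b u "v - v'" v'] by (simp add: eq_diff_eq)
qed

definition wd :: "'n::finite cvec \<Rightarrow> 'n cvec \<Rightarrow> 'n cmat" where
  "wd a u = (\<chi> i j. a $ i * u $ j - u $ i * a $ j)"

lemma transpose_wd: "transpose (wd a u) = - wd a u"
  by (simp add: vec_eq_iff transpose_def wd_def)

lemma M_gen_nth: "M_gen a b $ k $ m = (if a = k \<and> b = m then 1 else 0) - (if b = k \<and> a = m then 1 else 0)"
proof -
  have "mat_unit a b $ k $ m = (if a = k \<and> b = m then 1 else 0)" for a b :: 'a
    unfolding mat_unit_def vec_lambda_beta by (intro if_cong) auto
  then show ?thesis
    by (simp only: M_gen_def vector_minus_component)
qed

lemma sum_sum_delta:
  "(\<Sum>a\<in>UNIV. \<Sum>b\<in>UNIV. if a = j \<and> b = l then G a b else 0) = (G j l :: 'd::comm_monoid_add)"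
  for j l :: "'n::finite"
proof -
  have "(\<Sum>b\<in>UNIV. if a = j \<and> b = l then G a b else 0) = (if a = j then G a l else 0)" for a
    by (cases "a = j") simp_all
  then show ?thesis by simp
qed

lemma if_one_mult: "(if P then 1 else 0) * x = (if P then x else (0 :: complex))"
  by simp

lemma sum_M_gen:
  assumes "transpose Y = - Y"
  shows "(\<Sum>k\<in>UNIV. \<Sum>m\<in>UNIV. M_gen a b $ k $ m * Y $ k $ m) = 2 * Y $ a $ b"
proof -
  have "transpose Y $ a $ b = (- Y) $ a $ b" unfolding assms ..
  then have Y: "Y $ b $ a = - Y $ a $ b" unfolding transpose_def by simp
  have "M_gen a b $ k $ m * Y $ k $ m
      = (if k = a \<and> m = b then Y $ k $ m else 0) - (if k = b \<and> m = a then Y $ k $ m else 0)" for k m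
  proof -
    have "a = k \<and> b = m \<longleftrightarrow> k = a \<and> m = b" "b = k \<and> a = m \<longleftrightarrow> k = b \<and> m = a" by blast+
    then show ?thesis
      by (simp only: M_gen_nth left_diff_distrib if_one_mult)
  qed
  then have "(\<Sum>k\<in>UNIV. \<Sum>m\<in>UNIV. M_gen a b $ k $ m * Y $ k $ m) = Y $ a $ b - Y $ b $ a"
    by (simp only: sum_subtractf sum_sum_delta)
  then show ?thesis using Y by simp
qed

text \<open>The origin of the formula for \<open>Rop\<close>. Contracting a generator with a matrix
  in so(n) gives twice one of its entries, so each wedge becomes a combination of two generators. At
  the position (j, l) at most four pairs (a, b) contribute, and comparing l with j and j' collects
  them into two sign factors.\<close>

lemma r_mat_contract:
  fixes Y :: "'n::{finite,linorder} cmat"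
  assumes "transpose Y = - Y"
  shows "(\<Sum>k\<in>UNIV. \<Sum>m\<in>UNIV. r_mat \<epsilon> j k l m * Y $ k $ m) = Rop \<epsilon> Y $ j $ l"
proof -
  define S where "S = {(a, b). a < b \<and> b < opposite (a :: 'n)}"
  have Y: "Y $ b $ a = - Y $ a $ b" for a b
  proof -
    have "transpose Y $ a $ b = (- Y) $ a $ b" unfolding assms ..
    then show ?thesis unfolding transpose_def by simp
  qed
  define T where "T a b = M_gen a b $ j $ l * (2 * Y $ b $ opposite a) - M_gen b (opposite a) $ j $ l * (2 * Y $ a $ b)" for a b
  have "(\<Sum>k\<in>UNIV. \<Sum>m\<in>UNIV. r_mat \<epsilon> j k l m * Y $ k $ m)
      = of_real \<epsilon> * (\<Sum>k\<in>UNIV. \<Sum>m\<in>UNIV. \<Sum>p\<in>S. (case p of (a, b) \<Rightarrow> wedge (M_gen a b) (M_gen b (opposite a)) j k l m) * Y $ k $ m)"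
    unfolding r_mat_def S_def by (simp only: sum_distrib_left sum_distrib_right mult.assoc)
  also have "(\<Sum>k\<in>UNIV. \<Sum>m\<in>UNIV. \<Sum>p\<in>S. (case p of (a, b) \<Rightarrow> wedge (M_gen a b) (M_gen b (opposite a)) j k l m) * Y $ k $ m)
      = (\<Sum>p\<in>S. \<Sum>k\<in>UNIV. \<Sum>m\<in>UNIV. (case p of (a, b) \<Rightarrow> wedge (M_gen a b) (M_gen b (opposite a)) j k l m) * Y $ k $ m)"
    by (subst (2) sum.swap, subst sum.swap) (rule refl)
  also have "\<dots> = (\<Sum>p\<in>S. case p of (a, b) \<Rightarrow> T a b)"
  proof (intro sum.cong refl)
    fix p :: "'n \<times> 'n"
    obtain a b where p: "p = (a, b)" by (cases p)
    have "(\<Sum>k\<in>UNIV. \<Sum>m\<in>UNIV. wedge (M_gen a b) (M_gen b (opposite a)) j k l m * Y $ k $ m)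
        = M_gen a b $ j $ l * (\<Sum>k\<in>UNIV. \<Sum>m\<in>UNIV. M_gen b (opposite a) $ k $ m * Y $ k $ m)
        - M_gen b (opposite a) $ j $ l * (\<Sum>k\<in>UNIV. \<Sum>m\<in>UNIV. M_gen a b $ k $ m * Y $ k $ m)"
      unfolding wedge_def tensor_def
      by (simp only: left_diff_distrib sum_subtractf sum_distrib_left mult.assoc)
    then show "(\<Sum>k\<in>UNIV. \<Sum>m\<in>UNIV. (case p of (a, b) \<Rightarrow> wedge (M_gen a b) (M_gen b (opposite a)) j k l m) * Y $ k $ m)
        = (case p of (a, b) \<Rightarrow> T a b)"
      unfolding p prod.case T_def sum_M_gen[OF assms] .
  qed
  also have "\<dots> = (\<Sum>p\<in>UNIV. if p \<in> S then (case p of (a, b) \<Rightarrow> T a b) else 0)"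
    by (simp add: sum.If_cases)
  also have "\<dots> = (\<Sum>a\<in>UNIV. \<Sum>b\<in>UNIV. if (a, b) \<in> S then T a b else 0)"
    unfolding UNIV_Times_UNIV[symmetric] sum.cartesian_product by (intro sum.cong refl) auto
  \<comment> \<open>\<open>M_gen a b\<close> is nonzero at (j, l) only if (a, b) is (j, l) or (l,
    j), and \<open>M_gen b (opposite a)\<close> only if (b, a') is one of these; the four conditions
    are written as Kronecker deltas in a and b.\<close>
  also have "\<dots> = (\<Sum>a\<in>UNIV. \<Sum>b\<in>UNIV.
        (if a = j \<and> b = l then (if (a, b) \<in> S then 2 * Y $ b $ opposite a else 0) else 0)
      - (if a = l \<and> b = j then (if (a, b) \<in> S then 2 * Y $ b $ opposite a else 0) else 0)
      - (if a = opposite l \<and> b = j then (if (a, b) \<in> S then 2 * Y $ a $ b else 0) else 0)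
      + (if a = opposite j \<and> b = l then (if (a, b) \<in> S then 2 * Y $ a $ b else 0) else 0))"
  proof (intro sum.cong refl)
    fix a b :: 'n
    have "b = j \<and> a = l \<longleftrightarrow> a = l \<and> b = j" "b = j \<and> opposite a = l \<longleftrightarrow> a = opposite l \<and> b = j"
      "opposite a = j \<and> b = l \<longleftrightarrow> a = opposite j \<and> b = l"
      by (auto simp: opposite_eq_iff)
    then have T: "T a b = (if a = j \<and> b = l then 2 * Y $ b $ opposite a else 0)
        - (if a = l \<and> b = j then 2 * Y $ b $ opposite a else 0)
        - (if a = opposite l \<and> b = j then 2 * Y $ a $ b else 0)
        + (if a = opposite j \<and> b = l then 2 * Y $ a $ b else 0)"
      unfolding T_def M_gen_nth left_diff_distrib if_one_mult by (simp only: diff_diff_eq2 add_diff_eq add.commute)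
    show "(if (a, b) \<in> S then T a b else 0) =
        (if a = j \<and> b = l then (if (a, b) \<in> S then 2 * Y $ b $ opposite a else 0) else 0)
      - (if a = l \<and> b = j then (if (a, b) \<in> S then 2 * Y $ b $ opposite a else 0) else 0)
      - (if a = opposite l \<and> b = j then (if (a, b) \<in> S then 2 * Y $ a $ b else 0) else 0)
      + (if a = opposite j \<and> b = l then (if (a, b) \<in> S then 2 * Y $ a $ b else 0) else 0)"
      unfolding T by (cases "(a, b) \<in> S") (simp_all only: if_True if_False if_cancel diff_self add_0_right)
  qed
  also have "\<dots> = (if (j, l) \<in> S then 2 * Y $ l $ opposite j else 0) - (if (l, j) \<in> S then 2 * Y $ j $ opposite l else 0)
      - (if (opposite l, j) \<in> S then 2 * Y $ opposite l $ j else 0) + (if (opposite j, l) \<in> S then 2 * Y $ opposite j $ l else 0)"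
    unfolding sum.distrib sum_subtractf sum_sum_delta ..
  also have "\<dots> = (th j l + th (opposite j) l) * Y $ j $ opposite l + (th (opposite j) l - th j l) * Y $ opposite j $ l"
  proof -
    have Ya: "Y $ a $ a = 0" for a
    proof -
      have "Y $ a $ a = - Y $ a $ a" by (rule Y)
      then show ?thesis by simp
    qed
    have lt: "j < opposite l \<longleftrightarrow> l < opposite j" "opposite l < j \<longleftrightarrow> opposite j < l"
      using opposite_less_iff[of l "opposite j"] opposite_less_iff[of "opposite j" l] by simp_all
    have Yl: "Y $ l $ opposite j = - Y $ opposite j $ l" "Y $ opposite l $ j = - Y $ j $ opposite l"
      by (rule Y)+
    show ?thesis
    proof (cases "l = j \<or> l = opposite j")
      \<comment> \<open>At these ties one of the two signs is 0. For l = j the two remaining terms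
        cancel by antisymmetry, for l = j' they contain diagonal entries of
        \<open>Y\<close>.\<close>
      case True
      then show ?thesis
      proof
        assume "l = j"
        then show ?thesis using Y[of "opposite j" j] by (auto simp: S_def th_def Ya)
      qed (auto simp: S_def th_def Ya)
    next
      case False
      then show ?thesis
        unfolding Yl S_def mem_Collect_eq prod.case opposite_opposite lt
        by (cases l j rule: linorder_cases; cases l "opposite j" rule: linorder_cases)
            (simp_all add: th_def order_less_not_sym)
    qed
  qed
  finally show ?thesis
    by (simp add: Rop_def)
qed

text \<open>The half appears because \<open>wd b v\<close> antisymmetrizes the product of b and v,
  while r is already antisymmetric in the index pair of its second factor.\<close>

lemma rr_Rop: "rr \<epsilon> a b u v = dotc a (Rop \<epsilon> (wd b v) *v u) / 2"
proof -
  have swap: "r_mat \<epsilon> j m l k = - r_mat \<epsilon> j k l m" for j k l m :: 'a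
  proof -
    have M: "M_gen a b $ m $ k = - M_gen a b $ k $ m" for a b :: 'a
      by (simp add: M_gen_nth conj_commute)
    have "wedge (M_gen a b) (M_gen c d) j m l k = - wedge (M_gen a b) (M_gen c d) j k l m" for a b c d :: 'a
      unfolding wedge_def tensor_def M by simp
    then show ?thesis
      unfolding r_mat_def by (simp add: case_prod_unfold sum_negf)
  qed
  have inner: "(\<Sum>k\<in>UNIV. \<Sum>m\<in>UNIV. r_mat \<epsilon> j k l m * (b $ k * v $ m)) = Rop \<epsilon> (wd b v) $ j $ l / 2" for j l :: 'a
  proof -
    have "(\<Sum>k\<in>UNIV. \<Sum>m\<in>UNIV. r_mat \<epsilon> j k l m * (v $ k * b $ m))
        = (\<Sum>k\<in>UNIV. \<Sum>m\<in>UNIV. r_mat \<epsilon> j m l k * (v $ m * b $ k))"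
      by (rule sum.swap)
    also have "\<dots> = - (\<Sum>k\<in>UNIV. \<Sum>m\<in>UNIV. r_mat \<epsilon> j k l m * (b $ k * v $ m))"
      unfolding sum_negf[symmetric] by (intro sum.cong refl) (subst swap, simp)
    finally have *: "(\<Sum>k\<in>UNIV. \<Sum>m\<in>UNIV. r_mat \<epsilon> j k l m * (v $ k * b $ m))
        = - (\<Sum>k\<in>UNIV. \<Sum>m\<in>UNIV. r_mat \<epsilon> j k l m * (b $ k * v $ m))" .
    have "Rop \<epsilon> (wd b v) $ j $ l = (\<Sum>k\<in>UNIV. \<Sum>m\<in>UNIV. r_mat \<epsilon> j k l m * wd b v $ k $ m)"
      by (rule r_mat_contract[OF transpose_wd, symmetric])
    also have "\<dots> = (\<Sum>k\<in>UNIV. \<Sum>m\<in>UNIV. r_mat \<epsilon> j k l m * (b $ k * v $ m))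
        - (\<Sum>k\<in>UNIV. \<Sum>m\<in>UNIV. r_mat \<epsilon> j k l m * (v $ k * b $ m))"
      unfolding wd_def vec_lambda_beta right_diff_distrib sum_subtractf ..
    finally show ?thesis unfolding * by simp
  qed
  have "rr \<epsilon> a b u v = (\<Sum>j\<in>UNIV. \<Sum>l\<in>UNIV. a $ j * u $ l * (\<Sum>k\<in>UNIV. \<Sum>m\<in>UNIV. r_mat \<epsilon> j k l m * (b $ k * v $ m)))"
    unfolding rr_def sum_distrib_left
  proof (rule sum.cong[OF refl])
    fix j :: 'a
    show "(\<Sum>k\<in>UNIV. \<Sum>l\<in>UNIV. \<Sum>m\<in>UNIV. r_mat \<epsilon> j k l m * a $ j * b $ k * u $ l * v $ m)
        = (\<Sum>l\<in>UNIV. \<Sum>k\<in>UNIV. \<Sum>m\<in>UNIV. a $ j * u $ l * (r_mat \<epsilon> j k l m * (b $ k * v $ m)))"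
      by (subst sum.swap) (intro sum.cong refl, simp add: mult_ac)
  qed
  also have "\<dots> = dotc a (Rop \<epsilon> (wd b v) *v u) / 2"
    unfolding inner dotc_def matrix_vector_mult_def
    by (simp add: sum_distrib_left sum_divide_distrib mult_ac)
  finally show ?thesis .
qed

lemma dotc_matrix:
  assumes "transpose K = - K"
  shows "dotc a (K *v u) = - dotc u (K *v a)"
proof -
  have K: "K $ j $ i = - K $ i $ j" for i j
  proof -
    have "transpose K $ i $ j = (- K) $ i $ j" unfolding assms ..
    then show ?thesis unfolding transpose_def by simp
  qed
  have "dotc a (K *v u) = (\<Sum>i\<in>UNIV. \<Sum>j\<in>UNIV. a $ i * K $ i $ j * u $ j)"
    by (simp add: dotc_def matrix_vector_mult_def sum_distrib_left mult.assoc)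
  also have "\<dots> = (\<Sum>j\<in>UNIV. \<Sum>i\<in>UNIV. a $ i * K $ i $ j * u $ j)"
    by (rule sum.swap)
  also have "\<dots> = (\<Sum>j\<in>UNIV. \<Sum>i\<in>UNIV. - (u $ j * K $ j $ i * a $ i))"
    by (intro sum.cong refl) (subst K, simp)
  also have "\<dots> = - dotc u (K *v a)"
    by (simp add: dotc_def matrix_vector_mult_def sum_distrib_left mult.assoc sum_negf)
  finally show ?thesis .
qed

lemma trace_wd:
  assumes "transpose K = - K"
  shows "trace (wd b v ** K) = - 2 * dotc b (K *v v)"
proof -
  have "trace (wd b v ** K) = (\<Sum>i\<in>UNIV. \<Sum>j\<in>UNIV. b $ i * v $ j * K $ j $ i) - (\<Sum>i\<in>UNIV. \<Sum>j\<in>UNIV. v $ i * b $ j * K $ j $ i)"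
    unfolding trace_matrix_mult wd_def vec_lambda_beta left_diff_distrib sum_subtractf ..
  also have "(\<Sum>i\<in>UNIV. \<Sum>j\<in>UNIV. b $ i * v $ j * K $ j $ i) = dotc v (K *v b)"
    by (subst sum.swap) (simp add: dotc_def matrix_vector_mult_def sum_distrib_left mult_ac)
  also have "(\<Sum>i\<in>UNIV. \<Sum>j\<in>UNIV. v $ i * b $ j * K $ j $ i) = dotc b (K *v v)"
    by (subst sum.swap) (simp add: dotc_def matrix_vector_mult_def sum_distrib_left mult_ac)
  finally show ?thesis
    using dotc_matrix[OF assms, of v b] by simp
qed

lemma rr_antisym1: "rr \<epsilon> u b a v = - rr \<epsilon> a b u v"
  unfolding rr_Rop using dotc_matrix[OF Rop_antisym[OF transpose_wd], of u _ _ _ a] by simp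

lemma wd_swap: "wd v b = - wd b v"
  by (simp add: vec_eq_iff wd_def)

lemma Rop_linear:
  "Rop \<epsilon> (X + Y) = Rop \<epsilon> X + Rop \<epsilon> Y" "Rop \<epsilon> (- X) = - Rop \<epsilon> X"
  by (simp_all add: vec_eq_iff Rop_def algebra_simps)

lemma matrix_minus_vector: "(- K) *v (u :: 'n::finite cvec) = - (K *v u)"
  by (simp add: vec_eq_iff matrix_vector_mult_def sum_negf)

lemma rr_antisym2: "rr \<epsilon> a v u b = - rr \<epsilon> a b u v"
  unfolding rr_Rop wd_swap[of v b] Rop_linear matrix_minus_vector dotc_simps by simp

text \<open>Skewness of \<open>Rop\<close> for the trace form, which expresses that r changes sign
  when its two tensor factors are exchanged.\<close>

lemma rr_swap: "rr \<epsilon> b a v u = - rr \<epsilon> a b u v"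
proof -
  have "- 4 * rr \<epsilon> b a v u = trace (wd b v ** Rop \<epsilon> (wd a u))"
    unfolding rr_Rop trace_wd[OF Rop_antisym[OF transpose_wd]] by simp
  also have "\<dots> = - trace (wd a u ** Rop \<epsilon> (wd b v))"
    unfolding trace_Rop[of "wd b v"] by (subst trace_mul_sym) (rule refl)
  also have "\<dots> = 4 * rr \<epsilon> a b u v"
    unfolding rr_Rop trace_wd[OF Rop_antisym[OF transpose_wd]] by simp
  finally show ?thesis by algebra
qed

text \<open>The infinitesimal rotation by which the r-part of the Hamiltonian field of a linear
  function acts on positions and momenta alike, see \<open>dotc_RM\<close>.\<close>

definition RM :: "real \<Rightarrow> 'n::{finite,linorder} cvec \<Rightarrow> 'n cvec \<Rightarrow> 'n cmat" where
  "RM \<epsilon> a u = (\<chi> i j. - Rop \<epsilon> (wd a u) $ i $ j / 2)"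

lemma RM_vector: "RM \<epsilon> a u *v v = - 1/2 *s (Rop \<epsilon> (wd a u) *v v)"
  by (simp add: vec_eq_iff RM_def matrix_vector_mult_def sum_distrib_left sum_negf)

lemma dotc_RM: "dotc b (RM \<epsilon> a u *v v) = rr \<epsilon> a b u v"
  unfolding RM_vector dotc_simps rr_swap[of \<epsilon> a b u v, symmetric] using rr_swap[of \<epsilon> b a v u]
  by (simp add: rr_Rop)

lemma comm_vector: "comm A B *v v = A *v (B *v v) - B *v (A *v v)"
  unfolding comm_def by (simp add: matrix_vector_mul_assoc matrix_vector_mult_diff_rdistrib)

lemma transpose_comm:
  assumes "transpose A = - A" "transpose B = - B"
  shows "transpose (comm A B) = - comm A B"
proof -
  have neg: "(- X) ** (- Y) = X ** (Y :: 'a::finite cmat)" for X Y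
    by (simp add: vec_eq_iff matrix_matrix_mult_def)
  have "transpose (A ** B) = B ** A" "transpose (B ** A) = A ** B"
    by (simp_all add: matrix_transpose_mul assms neg)
  moreover have "transpose (comm A B) = transpose (A ** B) - transpose (B ** A)"
    by (simp add: comm_def vec_eq_iff transpose_def)
  ultimately show ?thesis by (simp add: comm_def)
qed

lemma trace_diff: "trace (A - B) = trace A - trace (B :: 'n::finite cmat)"
  by (simp add: trace_def sum_subtractf)

lemma trace_comm: "trace (Y ** comm P Q) = trace (comm Y P ** Q)"
proof -
  have "trace (Y ** (Q ** P)) = trace (P ** Y ** Q)"
    using trace_mul_sym[of "Y ** Q" P] by (simp add: matrix_mul_assoc)
  then show ?thesis
    by (simp add: comm_def matrix_sub_distrib trace_diff matrix_mul_assoc)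
qed

lemma comm_swap: "comm Q P = - comm P Q"
  by (simp add: comm_def)

lemma wd_vector: "wd a u *v z = dotc u z *s a - dotc a z *s u"
proof -
  have "(\<Sum>j\<in>UNIV. (a $ i * u $ j - u $ i * a $ j) * z $ j)
      = (\<Sum>j\<in>UNIV. u $ j * z $ j) * a $ i - (\<Sum>j\<in>UNIV. a $ j * z $ j) * u $ i" for i
    unfolding left_diff_distrib sum_subtractf sum_distrib_right by (simp only: mult_ac)
  then show ?thesis
    by (simp add: vec_eq_iff wd_def matrix_vector_mult_def dotc_def)
qed

text \<open>Skewness of \<open>Rop\<close> and invariance of the trace form rewrite all three terms
  as traces against \<open>W\<close>; the modified Yang-Baxter equation then leaves only the
  commutator of \<open>X\<close> and \<open>Y\<close>.\<close>

lemma trace_Rop_jacobi: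
  "trace (Y ** comm (Rop \<epsilon> X) (Rop \<epsilon> W)) + trace (W ** comm (Rop \<epsilon> Y) (Rop \<epsilon> X)) + trace (X ** comm (Rop \<epsilon> W) (Rop \<epsilon> Y))
    = - of_real (4 * \<epsilon>\<^sup>2) * trace (comm X Y ** W)"
proof -
  let ?R = "Rop \<epsilon>"
  have neg: "trace (- A ** B) = - trace (A ** B)" "trace (B ** - A) = - trace (B ** A)" for A B :: "'a cmat"
    by (simp_all add: trace_matrix_mult sum_negf)
  have scale: "trace (s *\<^sub>R A ** B) = of_real s * trace (A ** B)" for s and A B :: "'a cmat"
    unfolding trace_matrix_mult vector_scaleR_component sum_distrib_left
    by (intro sum.cong refl) (simp add: scaleR_conv_of_real)
  have add: "trace ((A + B) ** C) = trace (A ** C) + trace (B ** C)" for A B C :: "'a cmat"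
    by (simp add: trace_matrix_mult sum.distrib distrib_right)
  have "trace (Y ** comm (?R X) (?R W)) = trace (?R (comm (?R X) Y) ** W)"
    unfolding trace_comm comm_swap[of Y "?R X"] neg trace_Rop Rop_linear by simp
  moreover have "trace (X ** comm (?R W) (?R Y)) = trace (?R (comm X (?R Y)) ** W)"
    unfolding comm_swap[of "?R W" "?R Y"] neg trace_comm trace_Rop by simp
  moreover have "trace (W ** comm (?R Y) (?R X)) = - trace (comm (?R X) (?R Y) ** W)"
    unfolding comm_swap[of "?R Y" "?R X"] neg trace_mul_sym[of W] ..
  ultimately show ?thesis
    unfolding Rop_mCYBE Rop_linear add scale by simp
qed

text \<open>The left side is the Jacobiator of the r-part with u, v, w as independent points. The
  right side is the trace of [wd a u, wd b v] against wd c w times \<epsilon>^2 / 2, expanded in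
  scalar products because the invariant part of the bracket produces its Jacobiator in that
  form.\<close>

lemma rr_mCYBE:
  "rr \<epsilon> b c (RM \<epsilon> a u *v v) w + rr \<epsilon> b c v (RM \<epsilon> a u *v w)
   + rr \<epsilon> c a (RM \<epsilon> b v *v w) u + rr \<epsilon> c a w (RM \<epsilon> b v *v u)
   + rr \<epsilon> a b (RM \<epsilon> c w *v u) v + rr \<epsilon> a b u (RM \<epsilon> c w *v v)
   = of_real (\<epsilon>\<^sup>2) * (dotc u b * dotc v c * dotc w a - dotc u b * dotc v w * dotc c a
     - dotc u v * dotc b c * dotc w a + dotc u v * dotc b w * dotc c a
     - dotc a b * dotc v c * dotc w u + dotc a b * dotc v w * dotc c u
     + dotc a v * dotc b c * dotc w u - dotc a v * dotc b w * dotc c u)"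
proof -
  let ?X = "wd a u" and ?Y = "wd b v" and ?W = "wd c w"
  let ?R = "Rop \<epsilon>"
  have R: "transpose (?R (wd a u)) = - ?R (wd a u)" for a u :: "'a cvec"
    by (rule Rop_antisym[OF transpose_wd])
  have e1: "rr \<epsilon> b c (RM \<epsilon> a u *v x) y = - dotc b (RM \<epsilon> c y *v (RM \<epsilon> a u *v x))" for a b c u x y :: "'a cvec"
    unfolding dotc_RM by (rule rr_swap)
  have e2: "rr \<epsilon> b c v (RM \<epsilon> a u *v w) = dotc c (RM \<epsilon> b v *v (RM \<epsilon> a u *v w))" for a b c u v w :: "'a cvec"
    unfolding dotc_RM ..
  \<comment> \<open>The denominator 8 comes from the two halves in \<open>RM_vector\<close> and the
    factor -2 in \<open>trace_wd\<close>.\<close>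
  have q: "dotc b (RM \<epsilon> a u *v (RM \<epsilon> c w *v v)) - dotc b (RM \<epsilon> c w *v (RM \<epsilon> a u *v v))
      = - trace (wd b v ** comm (?R (wd a u)) (?R (wd c w))) / 8" for a b c u v w :: "'a cvec"
  proof -
    have half: "K *v (k *s z) = k *s (K *v z)" for K :: "'a cmat" and k z
      by (simp add: vec_eq_iff matrix_vector_mult_def sum_distrib_left mult_ac)
    show ?thesis
      unfolding RM_vector half dotc_simps trace_wd[OF transpose_comm[OF R R]] comm_vector
      by (simp add: algebra_simps)
  qed
  have "rr \<epsilon> b c (RM \<epsilon> a u *v v) w + rr \<epsilon> b c v (RM \<epsilon> a u *v w)
   + rr \<epsilon> c a (RM \<epsilon> b v *v w) u + rr \<epsilon> c a w (RM \<epsilon> b v *v u)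
   + rr \<epsilon> a b (RM \<epsilon> c w *v u) v + rr \<epsilon> a b u (RM \<epsilon> c w *v v)
   = (dotc b (RM \<epsilon> a u *v (RM \<epsilon> c w *v v)) - dotc b (RM \<epsilon> c w *v (RM \<epsilon> a u *v v)))
   + (dotc c (RM \<epsilon> b v *v (RM \<epsilon> a u *v w)) - dotc c (RM \<epsilon> a u *v (RM \<epsilon> b v *v w)))
   + (dotc a (RM \<epsilon> c w *v (RM \<epsilon> b v *v u)) - dotc a (RM \<epsilon> b v *v (RM \<epsilon> c w *v u)))"
    unfolding e1 e2 by simp
  also have "\<dots> = - (trace (?Y ** comm (?R ?X) (?R ?W)) + trace (?W ** comm (?R ?Y) (?R ?X)) + trace (?X ** comm (?R ?W) (?R ?Y))) / 8"
    unfolding q by (simp add: add_divide_distrib)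
  also have "\<dots> = of_real (\<epsilon>\<^sup>2) / 2 * trace (comm ?X ?Y ** ?W)"
    unfolding trace_Rop_jacobi by simp
  also have "trace (comm ?X ?Y ** ?W) = - 2 * dotc c (comm ?X ?Y *v w)"
    unfolding trace_mul_sym[of "comm ?X ?Y"] by (rule trace_wd[OF transpose_comm[OF transpose_wd transpose_wd]])
  also have "dotc c (comm ?X ?Y *v w)
     = - (dotc u b * dotc v c * dotc w a - dotc u b * dotc v w * dotc c a
     - dotc u v * dotc b c * dotc w a + dotc u v * dotc b w * dotc c a
     - dotc a b * dotc v c * dotc w u + dotc a b * dotc v w * dotc c u
     + dotc a v * dotc b c * dotc w u - dotc a v * dotc b w * dotc c u)"
    unfolding comm_vector wd_vector dotc_simps
    by (simp add: algebra_simps dotc_commute[of c] dotc_commute[of _ u] dotc_commute[of v b] dotc_commute[of b a]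
        dotc_commute[of w a] dotc_commute[of v a])
  moreover have "of_real (\<epsilon>\<^sup>2) / 2 * (- 2 * - t) = of_real (\<epsilon>\<^sup>2) * t" for t :: complex
    by simp
  ultimately show ?thesis by (simp only:)
qed

section \<open>The Jacobi identity\<close>

definition cmp :: "bool \<Rightarrow> 'n::finite phase \<Rightarrow> 'n cvec" where
  "cmp s z = (if s then snd z else fst z)"

definition om :: "bool \<Rightarrow> bool \<Rightarrow> complex" where
  "om s t = (if s = t then 0 else if s then 1 else - 1)"

lemma om_swap: "om t s = - om s t"
  by (auto simp: om_def)

text \<open>A covector at \<open>z\<close> is written as a point of the phase space, and \<open>cmp False\<close>, \<open>cmp True\<close> are its
  \<open>x\<close>- and \<open>p\<close>-parts. In this notation the $r$-part of the bracket has the same shape for all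
  pairs of coordinates, and \<open>om\<close> is the symplectic form on the labels. The linear functions \<open>a\<close>
  of \<open>cmp s z\<close> and \<open>b\<close> of \<open>cmp t z\<close> have the bracket \<open>br1\<close>, whose derivative in the direction \<open>h\<close> is
  \<open>dbr1\<close>; the first of them has the Hamiltonian vector field \<open>ham1\<close>, with rotation invariant part \<open>inv1\<close>.\<close>

definition kap :: "real \<Rightarrow> complex" where
  "kap \<epsilon> = \<i> * of_real \<epsilon>"

definition lam1 :: "real \<Rightarrow> 'n::finite phase \<Rightarrow> complex" where
  "lam1 \<epsilon> z = 1 + kap \<epsilon> * dotc (fst z) (snd z)"

definition br1 :: "real \<Rightarrow> 'n::{finite,linorder} phase \<Rightarrow> bool \<Rightarrow> bool \<Rightarrow> 'n cvec \<Rightarrow> 'n cvec \<Rightarrow> complex" where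
  "br1 \<epsilon> z s t a b = rr \<epsilon> a b (cmp s z) (cmp t z) + om s t * (dotc a b * lam1 \<epsilon> z
     + kap \<epsilon> * (dotc a (cmp s z) * dotc b (cmp t z) - dotc a (cmp t z) * dotc b (cmp s z)))"

definition ham1 :: "real \<Rightarrow> 'n::{finite,linorder} phase \<Rightarrow> bool \<Rightarrow> 'n cvec \<Rightarrow> bool \<Rightarrow> 'n cvec" where
  "ham1 \<epsilon> z s a t = RM \<epsilon> a (cmp s z) *v cmp t z + om s t *s (lam1 \<epsilon> z *s a
     + (kap \<epsilon> * dotc a (cmp s z)) *s cmp t z - (kap \<epsilon> * dotc a (cmp t z)) *s cmp s z)"

definition dbr1 :: "real \<Rightarrow> 'n::{finite,linorder} phase \<Rightarrow> 'n phase \<Rightarrow> bool \<Rightarrow> bool \<Rightarrow> 'n cvec \<Rightarrow> 'n cvec \<Rightarrow> complex" where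
  "dbr1 \<epsilon> z h s t a b = rr \<epsilon> a b (cmp s h) (cmp t z) + rr \<epsilon> a b (cmp s z) (cmp t h)
     + om s t * (dotc a b * (kap \<epsilon> * (dotc (fst h) (snd z) + dotc (fst z) (snd h)))
     + kap \<epsilon> * (dotc a (cmp s h) * dotc b (cmp t z) + dotc a (cmp s z) * dotc b (cmp t h)
         - dotc a (cmp t h) * dotc b (cmp s z) - dotc a (cmp t z) * dotc b (cmp s h)))"

lemma dotc_ham1: "dotc b (ham1 \<epsilon> z s a t) = br1 \<epsilon> z s t a b"
  unfolding ham1_def br1_def dotc_simps dotc_RM by (simp add: dotc_commute[of b] algebra_simps)

lemma br1_swap: "br1 \<epsilon> z t s b a = - br1 \<epsilon> z s t a b"
  unfolding br1_def om_swap[of t s] rr_swap[of \<epsilon> b a] by (simp add: dotc_commute[of b] algebra_simps)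

text \<open>The terms that are bilinear in the $r$-part and the remaining part cancel because the
  latter is invariant under rotations.\<close>

lemma rr_invariance:
  "k * (rr \<epsilon> a b u v * dotc c w + dotc b v * rr \<epsilon> a c u w - rr \<epsilon> a b u w * dotc c v - dotc b w * rr \<epsilon> a c u v)
   + (q * rr \<epsilon> c a b u + k * (dotc b v * rr \<epsilon> c a w u - dotc b w * rr \<epsilon> c a v u))
   - (q * rr \<epsilon> a b u c + k * (dotc c w * rr \<epsilon> a b u v - dotc c v * rr \<epsilon> a b u w)) = 0"
  unfolding rr_swap[of \<epsilon> c a b u] rr_swap[of \<epsilon> c a w u] rr_swap[of \<epsilon> c a v u] rr_antisym2[of \<epsilon> a c u b]
  by (simp add: algebra_simps)

text \<open>\<open>RM\<close> is antisymmetric and preserves scalar products infinitesimally. With x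
  and p inserted this says that \<open>lam1\<close> does not change along the r-part of a
  Hamiltonian field.\<close>

lemma dotc_RM_invariant: "dotc (RM \<epsilon> a u *v x) p + dotc x (RM \<epsilon> a u *v p) = 0"
proof -
  have "dotc (RM \<epsilon> a u *v x) p = rr \<epsilon> a p u x"
    unfolding dotc_commute[of _ p] dotc_RM ..
  then show ?thesis
    unfolding dotc_RM using rr_antisym2[of \<epsilon> a p u x] by simp
qed

definition inv1 :: "real \<Rightarrow> 'n::{finite,linorder} phase \<Rightarrow> bool \<Rightarrow> 'n cvec \<Rightarrow> bool \<Rightarrow> 'n cvec" where
  "inv1 \<epsilon> z s a t = om s t *s (lam1 \<epsilon> z *s a
     + (kap \<epsilon> * dotc a (cmp s z)) *s cmp t z - (kap \<epsilon> * dotc a (cmp t z)) *s cmp s z)"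

text \<open>The derivative of the rotation invariant part of \<open>br1 \<epsilon> z t r b c\<close>
  along the field \<open>inv1\<close> of a. Its cyclic sum is the Jacobiator of the invariant part
  alone.\<close>

definition dinv1 :: "real \<Rightarrow> 'n::{finite,linorder} phase \<Rightarrow> bool \<Rightarrow> 'n cvec \<Rightarrow> bool \<Rightarrow> 'n cvec \<Rightarrow> bool \<Rightarrow> 'n cvec \<Rightarrow> complex" where
  "dinv1 \<epsilon> z s a t b r c = om t r * (dotc b c * (kap \<epsilon> * (dotc (inv1 \<epsilon> z s a False) (snd z) + dotc (fst z) (inv1 \<epsilon> z s a True)))
     + kap \<epsilon> * (dotc b (inv1 \<epsilon> z s a t) * dotc c (cmp r z) + dotc b (cmp t z) * dotc c (inv1 \<epsilon> z s a r)
         - dotc b (inv1 \<epsilon> z s a r) * dotc c (cmp t z) - dotc b (cmp r z) * dotc c (inv1 \<epsilon> z s a t)))"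

text \<open>For fixed labels both sides are polynomials in the scalar products of x, p, a, b, c,
  which leaves eight polynomial identities. The factor -\<epsilon>^2 is the square of
  \<open>kap \<epsilon>\<close> and is opposite to the constant in \<open>rr_mCYBE\<close>.\<close>

lemma dinv1_cyclic:
  "dinv1 \<epsilon> z s a t b r c + dinv1 \<epsilon> z t b r c s a + dinv1 \<epsilon> z r c s a t b
   = - of_real (\<epsilon>\<^sup>2) * (dotc (cmp s z) b * dotc (cmp t z) c * dotc (cmp r z) a - dotc (cmp s z) b * dotc (cmp t z) (cmp r z) * dotc c a
     - dotc (cmp s z) (cmp t z) * dotc b c * dotc (cmp r z) a + dotc (cmp s z) (cmp t z) * dotc b (cmp r z) * dotc c a
     - dotc a b * dotc (cmp t z) c * dotc (cmp r z) (cmp s z) + dotc a b * dotc (cmp t z) (cmp r z) * dotc c (cmp s z)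
     + dotc a (cmp t z) * dotc b c * dotc (cmp r z) (cmp s z) - dotc a (cmp t z) * dotc b (cmp r z) * dotc c (cmp s z))"
proof -
  obtain x p where z: "z = (x, p)" by (cases z)
  have e: "- of_real (\<epsilon>\<^sup>2) = kap \<epsilon> * kap \<epsilon>"
    unfolding kap_def by (simp add: power2_eq_square algebra_simps)
  note comm = dotc_commute[of b a] dotc_commute[of c a] dotc_commute[of c b] dotc_commute[of p x]
    dotc_commute[of x a] dotc_commute[of x b] dotc_commute[of x c] dotc_commute[of p a] dotc_commute[of p b] dotc_commute[of p c]
  show ?thesis
    unfolding e z dinv1_def inv1_def lam1_def dotc_simps cmp_def fst_conv snd_conv
    by (cases s; cases t; cases r; simp add: om_def comm; algebra)
qed

text \<open>The mixed terms cancel in triples: in \<open>cross\<close> the cyclic shifts are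
  arranged so that all three terms carry the factor \<open>om t r\<close> up to sign. The pure terms
  cancel between \<open>rr_mCYBE\<close> and \<open>dinv1_cyclic\<close>.\<close>

lemma jacobi1:
  "dbr1 \<epsilon> z (ham1 \<epsilon> z s a False, ham1 \<epsilon> z s a True) t r b c
   + dbr1 \<epsilon> z (ham1 \<epsilon> z t b False, ham1 \<epsilon> z t b True) r s c a
   + dbr1 \<epsilon> z (ham1 \<epsilon> z r c False, ham1 \<epsilon> z r c True) s t a b = 0"
proof -
  \<comment> \<open>\<open>X\<close> and \<open>Y\<close> come from differentiating the r-part along
    the invariant field, in its first and its second point; \<open>Z\<close> comes from
    differentiating the invariant part along the rotation \<open>RM\<close>, and \<open>W\<close>
    from the r-part along \<open>RM\<close>.\<close>
  define X where "X = (\<lambda>s t r (a :: 'a cvec) b c. om s t * (lam1 \<epsilon> z * rr \<epsilon> b c a (cmp r z)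
     + kap \<epsilon> * (dotc a (cmp s z) * rr \<epsilon> b c (cmp t z) (cmp r z) - dotc a (cmp t z) * rr \<epsilon> b c (cmp s z) (cmp r z))))"
  define Y where "Y = (\<lambda>s t r (a :: 'a cvec) b c. om s r * (lam1 \<epsilon> z * rr \<epsilon> b c (cmp t z) a
     + kap \<epsilon> * (dotc a (cmp s z) * rr \<epsilon> b c (cmp t z) (cmp r z) - dotc a (cmp r z) * rr \<epsilon> b c (cmp t z) (cmp s z))))"
  define Z where "Z = (\<lambda>s t r (a :: 'a cvec) b c. om t r * (kap \<epsilon> *
     (rr \<epsilon> a b (cmp s z) (cmp t z) * dotc c (cmp r z) + dotc b (cmp t z) * rr \<epsilon> a c (cmp s z) (cmp r z)
      - rr \<epsilon> a b (cmp s z) (cmp r z) * dotc c (cmp t z) - dotc b (cmp r z) * rr \<epsilon> a c (cmp s z) (cmp t z))))"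
  define W where "W = (\<lambda>s t r (a :: 'a cvec) b c.
     rr \<epsilon> b c (RM \<epsilon> a (cmp s z) *v cmp t z) (cmp r z) + rr \<epsilon> b c (cmp t z) (RM \<epsilon> a (cmp s z) *v cmp r z))"
  have ham: "ham1 \<epsilon> z s a t = RM \<epsilon> a (cmp s z) *v cmp t z + inv1 \<epsilon> z s a t" for s a t
    by (simp add: ham1_def inv1_def)
  have cmp_ham: "cmp t (ham1 \<epsilon> z s a False, ham1 \<epsilon> z s a True) = ham1 \<epsilon> z s a t" for s a t
    by (simp add: cmp_def)
  have split: "dbr1 \<epsilon> z (ham1 \<epsilon> z s a False, ham1 \<epsilon> z s a True) t r b c
      = W s t r a b c + X s t r a b c + Y s t r a b c + Z s t r a b c + dinv1 \<epsilon> z s a t b r c" for s t r a b c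
  proof -
    have E: "dotc (ham1 \<epsilon> z s a False) (snd z) + dotc (fst z) (ham1 \<epsilon> z s a True)
        = dotc (inv1 \<epsilon> z s a False) (snd z) + dotc (fst z) (inv1 \<epsilon> z s a True)"
      unfolding ham dotc_simps using dotc_RM_invariant[of \<epsilon> a "cmp s z" "fst z" "snd z"]
      by (simp add: cmp_def add.assoc[symmetric])
    have rr1: "rr \<epsilon> b c (inv1 \<epsilon> z s a t) (cmp r z) = X s t r a b c"
      unfolding inv1_def X_def rr_simps rr_diff by (simp add: algebra_simps)
    have rr2: "rr \<epsilon> b c (cmp t z) (inv1 \<epsilon> z s a r) = Y s t r a b c"
      unfolding inv1_def Y_def rr_simps rr_diff by (simp add: algebra_simps)
    show ?thesis
      unfolding dbr1_def cmp_ham fst_conv snd_conv E unfolding ham rr_simps rr1 rr2 dotc_simps dotc_RM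
      unfolding W_def Z_def dinv1_def by (simp add: algebra_simps)
  qed
  have cross: "Z s t r a b c + X t r s b c a + Y r s t c a b = 0" for s t r a b c
  proof -
    have "Z s t r a b c + X t r s b c a + Y r s t c a b = om t r *
        (kap \<epsilon> * (rr \<epsilon> a b (cmp s z) (cmp t z) * dotc c (cmp r z) + dotc b (cmp t z) * rr \<epsilon> a c (cmp s z) (cmp r z)
            - rr \<epsilon> a b (cmp s z) (cmp r z) * dotc c (cmp t z) - dotc b (cmp r z) * rr \<epsilon> a c (cmp s z) (cmp t z))
        + (lam1 \<epsilon> z * rr \<epsilon> c a b (cmp s z) + kap \<epsilon> * (dotc b (cmp t z) * rr \<epsilon> c a (cmp r z) (cmp s z) - dotc b (cmp r z) * rr \<epsilon> c a (cmp t z) (cmp s z)))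
        - (lam1 \<epsilon> z * rr \<epsilon> a b (cmp s z) c + kap \<epsilon> * (dotc c (cmp r z) * rr \<epsilon> a b (cmp s z) (cmp t z) - dotc c (cmp t z) * rr \<epsilon> a b (cmp s z) (cmp r z))))"
      unfolding X_def Y_def Z_def om_swap[of r t] by (simp only: distrib_left right_diff_distrib mult_minus_left) simp
    then show ?thesis
      unfolding rr_invariance by simp
  qed
  have "W s t r a b c + W t r s b c a + W r s t c a b
      + (dinv1 \<epsilon> z s a t b r c + dinv1 \<epsilon> z t b r c s a + dinv1 \<epsilon> z r c s a t b) = 0"
    unfolding dinv1_cyclic W_def
    using rr_mCYBE[of \<epsilon> b c a "cmp s z" "cmp t z" "cmp r z"] by (simp add: add.assoc)
  then show ?thesis
    unfolding split using cross[of s t r a b c] cross[of t r s b c a] cross[of r s t c a b]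
    by algebra
qed

section \<open>Holomorphic functions and gradients on the phase space\<close>

lemma vec_eq_sum_axis: "(v :: 'n::finite cvec) = (\<Sum>i\<in>UNIV. axis i (v $ i))"
  by (simp add: vec_eq_iff axis_def if_distrib cong: if_cong)

lemma linear_axis: "linear (axis i :: complex \<Rightarrow> 'n::finite cvec)"
  by (rule linearI) (simp_all add: vec_eq_iff axis_def)

lemma has_derivative_vec:
  fixes f :: "'a::real_normed_vector \<Rightarrow> 'n::finite cvec"
  assumes "\<And>i. ((\<lambda>x. f x $ i) has_derivative (\<lambda>h. f' h $ i)) F"
  shows "(f has_derivative f') F"
proof -
  have "((\<lambda>x. \<Sum>i\<in>UNIV. axis i (f x $ i)) has_derivative (\<lambda>h. \<Sum>i\<in>UNIV. axis i (f' h $ i))) F"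
    by (intro has_derivative_sum bounded_linear.has_derivative[OF _ assms])
      (simp add: linear_axis linear_conv_bounded_linear[symmetric])
  then show ?thesis
    by (simp add: vec_eq_sum_axis[symmetric])
qed

definition ph_J :: "'n::finite phase \<Rightarrow> 'n phase" where
  "ph_J z = (\<i> *s fst z, \<i> *s snd z)"

lemma cplx_struct_ph_J: "cplx_struct (ph_J :: 'n::finite phase \<Rightarrow> 'n phase)"
proof (rule cplx_struct.intro)
  have n: "norm (\<i> *s x) = norm x" for x :: "'n cvec"
    by (simp add: norm_vec_def norm_mult)
  show "linear (ph_J :: 'n phase \<Rightarrow> 'n phase)"
    by (rule linearI) (simp_all add: ph_J_def vec_eq_iff algebra_simps)
  fix v :: "'n phase"
  show "ph_J (ph_J v) = - v"
    by (simp add: ph_J_def prod_eq_iff vec_eq_iff)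
  show "norm (ph_J v) = norm v"
    by (simp add: ph_J_def norm_prod_def n)
qed

interpretation ph: cplx_struct ph_J
  by (rule cplx_struct_ph_J)

lemma ph_cm: "ph.cm c v = (c *s fst v, c *s snd v)"
proof -
  have "Re c *\<^sub>R u + Im c *\<^sub>R (\<i> *s u) = c *s u" for u :: "'a cvec"
    unfolding vec_eq_iff
  proof
    fix i
    have "complex_of_real (Re c) * u $ i + complex_of_real (Im c) * (\<i> * u $ i) = (of_real (Re c) + \<i> * of_real (Im c)) * u $ i"
      by (simp add: algebra_simps)
    then show "(Re c *\<^sub>R u + Im c *\<^sub>R (\<i> *s u)) $ i = (c *s u) $ i"
      unfolding complex_eq[symmetric] by (simp add: scaleR_conv_of_real[where 'a = complex])
  qed
  then show ?thesis
    by (simp add: ph.cm_def ph_J_def prod_eq_iff)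
qed

text \<open>A real linear map that commutes with multiplication by \<i> is complex linear, so the
  results for abstract complex structures apply to the phase space.\<close>

lemma holomorphic_phase_iff: "holomorphic_phase f N \<longleftrightarrow> hol ph_J f N"
proof -
  have "(f has_derivative D) (at z) \<and> (\<forall>c x p. D (c *s x, c *s p) = c * D (x, p))
      \<longleftrightarrow> has_cderiv ph_J ((*) \<i>) f D z" for D z
  proof
    assume D: "has_cderiv ph_J ((*) \<i>) f D z"
    then have "D (c *s x, c *s p) = c * D (x, p)" for c x p
      using ph.has_cderiv_cm[OF D, of c "(x, p)"] by (simp add: ph_cm)
    then show "(f has_derivative D) (at z) \<and> (\<forall>c x p. D (c *s x, c *s p) = c * D (x, p))"
      using D by (simp add: has_cderiv_def)
  qed (auto simp: has_cderiv_def ph_J_def)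
  then show ?thesis
    unfolding holomorphic_phase_def hol_def by simp
qed

lemma smult_axis: "c *s axis j 1 = (axis j c :: 'n::finite cvec)"
  by (simp add: vec_eq_iff axis_def)

lemma partial_x_dd: "partial_x j f z = ph.dd f (axis j 1, 0) z"
  by (cases z) (simp add: partial_x_def ph.dd_def ph_cm smult_axis)

lemma partial_p_dd: "partial_p j f z = ph.dd f (0, axis j 1) z"
  by (cases z) (simp add: partial_p_def ph.dd_def ph_cm smult_axis)

definition grad :: "('n::finite phase \<Rightarrow> complex) \<Rightarrow> 'n phase \<Rightarrow> 'n phase" where
  "grad f z = (\<chi> j. partial_x j f z, \<chi> j. partial_p j f z)"

definition pair :: "'n::finite phase \<Rightarrow> 'n phase \<Rightarrow> complex" where
  "pair \<alpha> v = dotc (fst \<alpha>) (fst v) + dotc (snd \<alpha>) (snd v)"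

lemma complex_linear_pair:
  assumes D: "linear D" "\<And>v. D (ph_J v) = \<i> * D (v :: 'n::finite phase)"
  shows "D v = pair (\<chi> j. D (axis j 1, 0), \<chi> j. D (0, axis j 1)) v"
proof -
  have cm: "D (ph.cm c v) = c * D v" for c v
  proof -
    have "D (ph.cm c v) = Re c *\<^sub>R D v + Im c *\<^sub>R D (ph_J v)"
      by (simp add: ph.cm_def linear_add[OF D(1)] linear_scale[OF D(1)])
    also have "\<dots> = (of_real (Re c) + \<i> * of_real (Im c)) * D v"
      unfolding D(2) by (simp add: scaleR_conv_of_real algebra_simps)
    finally show ?thesis unfolding complex_eq[symmetric] .
  qed
  have "(fst v, 0) = (\<Sum>j\<in>UNIV. ph.cm (fst v $ j) (axis j 1, 0))"
    using vec_eq_sum_axis[of "fst v"] by (simp add: ph_cm smult_axis prod_eq_iff fst_sum snd_sum)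
  moreover have "(0, snd v) = (\<Sum>j\<in>UNIV. ph.cm (snd v $ j) (0, axis j 1))"
    using vec_eq_sum_axis[of "snd v"] by (simp add: ph_cm smult_axis prod_eq_iff fst_sum snd_sum)
  ultimately have "D (fst v, 0) + D (0, snd v) = pair (\<chi> j. D (axis j 1, 0), \<chi> j. D (0, axis j 1)) v"
    by (simp add: linear_sum[OF D(1)] cm pair_def dotc_def mult.commute)
  then show ?thesis
    using linear_add[OF D(1), of "(fst v, 0)" "(0, snd v)"] by simp
qed

lemma dd_pair:
  assumes "hol ph_J f N" "z \<in> N"
  shows "ph.dd f v z = pair (grad f z) v"
proof -
  have D: "has_cderiv ph_J ((*) \<i>) f (\<lambda>v. ph.dd f v z) z"
    by (rule ph.has_cderiv_dd[OF assms])
  then have "linear (\<lambda>v. ph.dd f v z)"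
    unfolding has_cderiv_def using has_derivative_linear by blast
  from complex_linear_pair[OF this] D show ?thesis
    unfolding has_cderiv_def grad_def partial_x_dd partial_p_dd by blast
qed

lemma has_derivative_nth:
  "(f has_derivative f') F \<Longrightarrow> ((\<lambda>x. f x $ i) has_derivative (\<lambda>h. (f' h :: 'n::finite cvec) $ i)) F"
  by (rule bounded_linear.has_derivative[OF bounded_linear_vec_nth])

lemma hol_fst_nth: "hol ph_J (\<lambda>z. fst z $ j) S"
  unfolding hol_def has_cderiv_def
  by (auto intro!: exI[of _ "\<lambda>z. fst z $ j"] has_derivative_nth derivative_eq_intros simp: ph_J_def)

lemma hol_snd_nth: "hol ph_J (\<lambda>z. snd z $ j) S"
  unfolding hol_def has_cderiv_def
  by (auto intro!: exI[of _ "\<lambda>z. snd z $ j"] has_derivative_nth derivative_eq_intros simp: ph_J_def)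

lemma hol_hol_bracket:
  assumes "hol ph_J f N" "hol ph_J g N" "open N"
  shows "hol ph_J (hol_bracket \<epsilon> f g) N"
proof -
  have xx: "hol ph_J (bracket_xx \<epsilon> j k) N" for j k
    unfolding bracket_xx_def case_prod_unfold by (intro hol_intros hol_fst_nth)
  have pp: "hol ph_J (bracket_pp \<epsilon> j k) N" for j k
    unfolding bracket_pp_def case_prod_unfold by (intro hol_intros hol_snd_nth)
  have px: "hol ph_J (bracket_px \<epsilon> j k) N" for j k
    unfolding bracket_px_def case_prod_unfold by (intro hol_intros hol_fst_nth hol_snd_nth)
  have partial: "hol ph_J (partial_x j f) N" "hol ph_J (partial_p j f) N" if "hol ph_J f N" for j f
    using ph.hol_dd[OF that assms(3)] unfolding partial_x_dd[abs_def] partial_p_dd[abs_def] by auto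
  then show ?thesis
    unfolding hol_bracket_def[abs_def] by (intro hol_intros xx pp px partial assms)
qed

section \<open>The bracket as a bilinear form in covectors\<close>

definition PB :: "real \<Rightarrow> 'n::{finite,linorder} phase \<Rightarrow> 'n phase \<Rightarrow> 'n phase \<Rightarrow> complex" where
  "PB \<epsilon> z \<alpha> \<beta> = (\<Sum>s\<in>UNIV. \<Sum>t\<in>UNIV. br1 \<epsilon> z s t (cmp s \<alpha>) (cmp t \<beta>))"

lemma s_lam_eq: "s_lam \<epsilon> j k l m = of_real \<epsilon> *
  ((if j = m \<and> k = l then 1 else 0) - (if j = k \<and> l = m then 1 else 0) + (if j = l \<and> k = m then 1 else 0))"
proof -
  have mu: "mat_unit a b $ i $ i' = (if a = i \<and> b = i' then 1 else 0)" for a b i i' :: 'a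
    unfolding mat_unit_def vec_lambda_beta by (intro if_cong) auto
  have ifs: "(if P then 1 else 0) * (if Q then 1 else 0) = (if R then (if S then 1 else 0) else (0 :: complex))"
    if "P \<and> Q \<longleftrightarrow> R \<and> S" for P Q R S
    using that by auto
  have "tensor (mat_unit a b) (mat_unit b a) j k l m = (if a = j \<and> b = l then (if j = m \<and> k = l then 1 else 0) else 0)"
    "tensor (mat_unit a b) (mat_unit a b) j k l m = (if a = j \<and> b = l then (if j = k \<and> l = m then 1 else 0) else 0)"
    "tensor (mat_unit a a) (mat_unit b b) j k l m = (if a = j \<and> b = k then (if j = l \<and> k = m then 1 else 0) else 0)"
    for a b
    unfolding tensor_def mu by (rule ifs, blast)+
  then show ?thesis
    unfolding s_lam_def by (simp only: sum.distrib sum_subtractf sum_sum_delta)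
qed

lemma sum_bracket_xx:
  "(\<Sum>j\<in>UNIV. \<Sum>k\<in>UNIV. a $ j * b $ k * bracket_xx \<epsilon> j k z) = br1 \<epsilon> z False False a b"
  by (simp add: bracket_xx_def case_prod_unfold br1_def om_def cmp_def rr_def sum_distrib_left mult_ac)

text \<open>Here r carries the momenta on its upper indices. Exchanging them with the covectors in
  both tensor factors changes the sign twice, so the momentum bracket takes the form of the position
  bracket.\<close>

lemma sum_bracket_pp:
  "(\<Sum>l\<in>UNIV. \<Sum>m\<in>UNIV. a $ l * b $ m * bracket_pp \<epsilon> l m z) = br1 \<epsilon> z True True a b"
proof -
  have "(\<Sum>l\<in>UNIV. \<Sum>m\<in>UNIV. a $ l * b $ m * bracket_pp \<epsilon> l m z)
      = (\<Sum>l\<in>UNIV. \<Sum>m\<in>UNIV. \<Sum>j\<in>UNIV. \<Sum>k\<in>UNIV. r_mat \<epsilon> j k l m * snd z $ j * snd z $ k * a $ l * b $ m)"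
    by (simp add: bracket_pp_def case_prod_unfold sum_distrib_left mult_ac)
  also have "\<dots> = (\<Sum>l\<in>UNIV. \<Sum>j\<in>UNIV. \<Sum>k\<in>UNIV. \<Sum>m\<in>UNIV. r_mat \<epsilon> j k l m * snd z $ j * snd z $ k * a $ l * b $ m)"
    by (rule sum.cong[OF refl], subst sum.swap, rule sum.cong[OF refl], rule sum.swap)
  also have "\<dots> = (\<Sum>j\<in>UNIV. \<Sum>k\<in>UNIV. \<Sum>l\<in>UNIV. \<Sum>m\<in>UNIV. r_mat \<epsilon> j k l m * snd z $ j * snd z $ k * a $ l * b $ m)"
    by (subst sum.swap, rule sum.cong[OF refl], rule sum.swap)
  also have "\<dots> = rr \<epsilon> (snd z) (snd z) a b" by (simp add: rr_def)
  also have "\<dots> = rr \<epsilon> a b (snd z) (snd z)"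
    using rr_antisym1[of \<epsilon> "snd z" "snd z" a b] rr_antisym2[of \<epsilon> a b "snd z" "snd z"] by simp
  finally show ?thesis
    by (simp add: br1_def om_def cmp_def)
qed

text \<open>The Kronecker delta of the bracket and the flip tensor in \<open>s_lam\<close> combine
  to \<open>lam1\<close>; the other two tensors of \<open>s_lam\<close> give the two
  \<open>kap\<close> terms. The minus sign of r disappears when p and the covector are exchanged in
  its first factor.\<close>

lemma sum_bracket_px:
  "(\<Sum>l\<in>UNIV. \<Sum>k\<in>UNIV. a $ l * b $ k * bracket_px \<epsilon> l k z) = br1 \<epsilon> z True False a b"
proof -
  define x p where "x = fst z" and "p = snd z"
  have sum_s: "(\<Sum>j\<in>UNIV. \<Sum>m\<in>UNIV. p $ j * s_lam \<epsilon> j k l m * x $ m)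
      = of_real \<epsilon> * ((if k = l then dotc p x else 0) - p $ k * x $ l + p $ l * x $ k)" for k l :: 'a
  proof -
    have "p $ j * s_lam \<epsilon> j k l m * x $ m = of_real \<epsilon> *
        ((if m = j then (if k = l then p $ j * x $ m else 0) else 0)
         - (if j = k \<and> m = l then p $ j * x $ m else 0) + (if j = l \<and> m = k then p $ j * x $ m else 0))" for j m
    proof -
      have sel: "(if j = m \<and> k = l then 1 else 0) = (if m = j then (if k = l then 1 else 0) else (0 :: complex))"
        "(if j = k \<and> l = m then 1 else 0) = (if j = k \<and> m = l then 1 else (0 :: complex))"
        "(if j = l \<and> k = m then 1 else 0) = (if j = l \<and> m = k then 1 else (0 :: complex))"
        by auto
      have "u * (w * (A - B + C)) * v = w * (A * (u * v) - B * (u * v) + C * (u * v))" for u v w A B C :: complex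
        by (simp add: algebra_simps)
      then show ?thesis
        unfolding s_lam_eq sel by (simp only: if_one_mult if_distribR if_distrib[of "\<lambda>A. A * _"] mult_zero_left mult_1_left)
    qed
    then have "(\<Sum>j\<in>UNIV. \<Sum>m\<in>UNIV. p $ j * s_lam \<epsilon> j k l m * x $ m) = of_real \<epsilon> *
        ((\<Sum>j\<in>UNIV. if k = l then p $ j * x $ j else 0) - p $ k * x $ l + p $ l * x $ k)"
      by (simp only: sum_distrib_left[symmetric] sum.distrib sum_subtractf sum_sum_delta sum.delta[OF finite] UNIV_I if_True)
    then show ?thesis by (cases "k = l") (simp_all add: dotc_def)
  qed
  have px: "bracket_px \<epsilon> l k z = (if k = l then lam1 \<epsilon> z else 0) - kap \<epsilon> * (p $ k * x $ l) + kap \<epsilon> * (p $ l * x $ k)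
      - (\<Sum>j\<in>UNIV. \<Sum>m\<in>UNIV. p $ j * r_mat \<epsilon> j k l m * x $ m)" for k l
  proof -
    have ws: "(\<Sum>j\<in>UNIV. \<Sum>m\<in>UNIV. p $ j * w_lam \<epsilon> j k l m * x $ m)
        = (\<Sum>j\<in>UNIV. \<Sum>m\<in>UNIV. p $ j * r_mat \<epsilon> j k l m * x $ m) - \<i> * (\<Sum>j\<in>UNIV. \<Sum>m\<in>UNIV. p $ j * s_lam \<epsilon> j k l m * x $ m)"
      unfolding w_lam_def sum_distrib_left sum_subtractf[symmetric] by (intro sum.cong refl) (simp add: algebra_simps)
    have b: "bracket_px \<epsilon> l k z = (if l = k then 1 else 0) - (\<Sum>j\<in>UNIV. \<Sum>m\<in>UNIV. p $ j * w_lam \<epsilon> j k l m * x $ m)"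
      by (simp add: bracket_px_def case_prod_unfold x_def p_def)
    have l: "lam1 \<epsilon> z = 1 + \<i> * of_real \<epsilon> * dotc p x"
      by (simp add: lam1_def kap_def x_def p_def dotc_commute[of "fst z"])
    show ?thesis
      unfolding b ws sum_s l kap_def by (cases "k = l") (simp_all add: algebra_simps)
  qed
  have "a $ l * b $ k * bracket_px \<epsilon> l k z = (if k = l then a $ l * b $ k * lam1 \<epsilon> z else 0)
      - kap \<epsilon> * ((x $ l * a $ l) * (p $ k * b $ k)) + kap \<epsilon> * ((p $ l * a $ l) * (x $ k * b $ k))
      - a $ l * b $ k * (\<Sum>j\<in>UNIV. \<Sum>m\<in>UNIV. p $ j * r_mat \<epsilon> j k l m * x $ m)" for l k
    unfolding px by (cases "k = l") (simp_all add: algebra_simps)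
  then have "(\<Sum>l\<in>UNIV. \<Sum>k\<in>UNIV. a $ l * b $ k * bracket_px \<epsilon> l k z)
      = (\<Sum>l\<in>UNIV. a $ l * b $ l * lam1 \<epsilon> z) - kap \<epsilon> * (dotc x a * dotc p b) + kap \<epsilon> * (dotc p a * dotc x b)
      - (\<Sum>l\<in>UNIV. \<Sum>k\<in>UNIV. a $ l * b $ k * (\<Sum>j\<in>UNIV. \<Sum>m\<in>UNIV. p $ j * r_mat \<epsilon> j k l m * x $ m))"
    unfolding dotc_def sum_product by (simp add: sum.distrib sum_subtractf sum_distrib_left)
  also have "(\<Sum>l\<in>UNIV. \<Sum>k\<in>UNIV. a $ l * b $ k * (\<Sum>j\<in>UNIV. \<Sum>m\<in>UNIV. p $ j * r_mat \<epsilon> j k l m * x $ m))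
      = (\<Sum>l\<in>UNIV. \<Sum>k\<in>UNIV. \<Sum>j\<in>UNIV. \<Sum>m\<in>UNIV. r_mat \<epsilon> j k l m * p $ j * b $ k * a $ l * x $ m)"
    by (simp add: sum_distrib_left mult_ac)
  also have "\<dots> = (\<Sum>l\<in>UNIV. \<Sum>j\<in>UNIV. \<Sum>k\<in>UNIV. \<Sum>m\<in>UNIV. r_mat \<epsilon> j k l m * p $ j * b $ k * a $ l * x $ m)"
    by (rule sum.cong[OF refl]) (rule sum.swap)
  also have "\<dots> = (\<Sum>j\<in>UNIV. \<Sum>k\<in>UNIV. \<Sum>l\<in>UNIV. \<Sum>m\<in>UNIV. r_mat \<epsilon> j k l m * p $ j * b $ k * a $ l * x $ m)"
    by (subst sum.swap, rule sum.cong[OF refl], rule sum.swap)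
  also have "\<dots> = rr \<epsilon> p b a x" by (simp add: rr_def)
  also have "\<dots> = - rr \<epsilon> a b p x" by (rule rr_antisym1)
  also have "(\<Sum>l\<in>UNIV. a $ l * b $ l * lam1 \<epsilon> z) = dotc a b * lam1 \<epsilon> z"
    by (simp add: dotc_def sum_distrib_right)
  finally show ?thesis
    by (simp add: br1_def om_def cmp_def x_def[symmetric] p_def[symmetric] dotc_commute[of x] dotc_commute[of p] algebra_simps)
qed

lemma hol_bracket_eq_PB: "hol_bracket \<epsilon> f g z = PB \<epsilon> z (grad f z) (grad g z)"
proof -
  have px: "(\<Sum>l\<in>UNIV. \<Sum>k\<in>UNIV. (partial_p l f z * partial_x k g z - partial_x k f z * partial_p l g z) * bracket_px \<epsilon> l k z)
      = br1 \<epsilon> z True False (snd (grad f z)) (fst (grad g z)) - br1 \<epsilon> z True False (snd (grad g z)) (fst (grad f z))"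
    unfolding sum_bracket_px[symmetric] sum_subtractf[symmetric] by (intro sum.cong refl) (simp add: grad_def algebra_simps)
  have xx: "(\<Sum>j\<in>UNIV. \<Sum>k\<in>UNIV. partial_x j f z * partial_x k g z * bracket_xx \<epsilon> j k z) = br1 \<epsilon> z False False (fst (grad f z)) (fst (grad g z))"
    unfolding sum_bracket_xx[symmetric] by (simp add: grad_def)
  have pp: "(\<Sum>l\<in>UNIV. \<Sum>m\<in>UNIV. partial_p l f z * partial_p m g z * bracket_pp \<epsilon> l m z) = br1 \<epsilon> z True True (snd (grad f z)) (snd (grad g z))"
    unfolding sum_bracket_pp[symmetric] by (simp add: grad_def)
  show ?thesis
    unfolding hol_bracket_def px xx pp PB_def UNIV_bool
    using br1_swap[of \<epsilon> z True False "snd (grad g z)" "fst (grad f z)"] by (simp add: cmp_def)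
qed

definition Ham :: "real \<Rightarrow> 'n::{finite,linorder} phase \<Rightarrow> 'n phase \<Rightarrow> 'n phase" where
  "Ham \<epsilon> z \<alpha> = (\<Sum>s\<in>UNIV. (ham1 \<epsilon> z s (cmp s \<alpha>) False, ham1 \<epsilon> z s (cmp s \<alpha>) True))"

text \<open>The derivative of \<open>PB\<close> with respect to the point, both covectors being held
  fixed.\<close>

definition DPB :: "real \<Rightarrow> 'n::{finite,linorder} phase \<Rightarrow> 'n phase \<Rightarrow> 'n phase \<Rightarrow> 'n phase \<Rightarrow> complex" where
  "DPB \<epsilon> z h \<alpha> \<beta> = (\<Sum>s\<in>UNIV. \<Sum>t\<in>UNIV. dbr1 \<epsilon> z h s t (cmp s \<alpha>) (cmp t \<beta>))"

lemma PB_swap: "PB \<epsilon> z \<beta> \<alpha> = - PB \<epsilon> z \<alpha> \<beta>"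
  unfolding PB_def sum_negf[symmetric] br1_swap[symmetric] by (rule sum.swap)

lemma cmp_add: "cmp s (v + w) = cmp s v + cmp s w"
  by (simp add: cmp_def)

lemma PB_eq_pair: "PB \<epsilon> z \<alpha> \<beta> = pair \<beta> (Ham \<epsilon> z \<alpha>)"
  unfolding PB_def Ham_def UNIV_bool pair_def dotc_ham1[symmetric] by (simp add: cmp_def dotc_simps)

lemma dbr1_add: "dbr1 \<epsilon> z (h + h') s t a b = dbr1 \<epsilon> z h s t a b + dbr1 \<epsilon> z h' s t a b"
  unfolding dbr1_def cmp_add rr_simps dotc_simps fst_add snd_add by (simp add: algebra_simps)

lemma DPB_jacobi:
  "DPB \<epsilon> z (Ham \<epsilon> z \<alpha>) \<beta> \<gamma> + DPB \<epsilon> z (Ham \<epsilon> z \<beta>) \<gamma> \<alpha> + DPB \<epsilon> z (Ham \<epsilon> z \<gamma>) \<alpha> \<beta> = 0"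
proof -
  define F where "F s t r \<alpha> \<beta> \<gamma> = dbr1 \<epsilon> z (ham1 \<epsilon> z s (cmp s \<alpha>) False, ham1 \<epsilon> z s (cmp s \<alpha>) True) t r (cmp t \<beta>) (cmp r \<gamma>)"
    for s t r and \<alpha> \<beta> \<gamma> :: "'a phase"
  have F: "DPB \<epsilon> z (Ham \<epsilon> z \<alpha>) \<beta> \<gamma> = (\<Sum>t\<in>UNIV. \<Sum>r\<in>UNIV. \<Sum>s\<in>UNIV. F s t r \<alpha> \<beta> \<gamma>)" for \<alpha> \<beta> \<gamma> :: "'a phase"
    unfolding DPB_def Ham_def F_def UNIV_bool by (simp add: dbr1_add del: add_Pair)
  have 1: "DPB \<epsilon> z (Ham \<epsilon> z \<alpha>) \<beta> \<gamma> = (\<Sum>s\<in>UNIV. \<Sum>t\<in>UNIV. \<Sum>r\<in>UNIV. F s t r \<alpha> \<beta> \<gamma>)"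
    unfolding F UNIV_bool by simp
  have 2: "DPB \<epsilon> z (Ham \<epsilon> z \<beta>) \<gamma> \<alpha> = (\<Sum>s\<in>UNIV. \<Sum>t\<in>UNIV. \<Sum>r\<in>UNIV. F t r s \<beta> \<gamma> \<alpha>)"
    unfolding F UNIV_bool by simp
  have 3: "DPB \<epsilon> z (Ham \<epsilon> z \<gamma>) \<alpha> \<beta> = (\<Sum>s\<in>UNIV. \<Sum>t\<in>UNIV. \<Sum>r\<in>UNIV. F r s t \<gamma> \<alpha> \<beta>)"
    unfolding F UNIV_bool by simp
  have "F s t r \<alpha> \<beta> \<gamma> + F t r s \<beta> \<gamma> \<alpha> + F r s t \<gamma> \<alpha> \<beta> = 0" for s t r
    unfolding F_def by (rule jacobi1)
  then show ?thesis
    unfolding 1 2 3 sum.distrib[symmetric] by simp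
qed

lemma dotc_has_derivative:
  assumes "(a has_derivative a') (at z)" "(u has_derivative u') (at z)"
  shows "((\<lambda>z. dotc (a z) (u z)) has_derivative (\<lambda>h. dotc (a' h) (u z) + dotc (a z) (u' h))) (at z)"
proof -
  have "((\<lambda>z. dotc (a z) (u z)) has_derivative (\<lambda>h. \<Sum>j\<in>UNIV. a z $ j * u' h $ j + a' h $ j * u z $ j)) (at z)"
    unfolding dotc_def by (intro has_derivative_sum has_derivative_mult has_derivative_nth assms)
  then show ?thesis
    by (simp add: dotc_def sum.distrib add.commute)
qed

lemma rr_has_derivative:
  assumes "(a has_derivative a') (at z)" "(b has_derivative b') (at z)"
    "(u has_derivative u') (at z)" "(v has_derivative v') (at z)"
  shows "((\<lambda>z. rr \<epsilon> (a z) (b z) (u z) (v z)) has_derivative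
    (\<lambda>h. rr \<epsilon> (a' h) (b z) (u z) (v z) + rr \<epsilon> (a z) (b' h) (u z) (v z)
       + rr \<epsilon> (a z) (b z) (u' h) (v z) + rr \<epsilon> (a z) (b z) (u z) (v' h))) (at z)"
proof -
  have "((\<lambda>z. rr \<epsilon> (a z) (b z) (u z) (v z)) has_derivative (\<lambda>h. \<Sum>j\<in>UNIV. \<Sum>k\<in>UNIV. \<Sum>l\<in>UNIV. \<Sum>m\<in>UNIV.
      r_mat \<epsilon> j k l m * a z $ j * b z $ k * u z $ l * v' h $ m
      + (r_mat \<epsilon> j k l m * a z $ j * b z $ k * u' h $ l
      + (r_mat \<epsilon> j k l m * a z $ j * b' h $ k
      + r_mat \<epsilon> j k l m * a' h $ j * b z $ k) * u z $ l) * v z $ m)) (at z)"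
    unfolding rr_def
    by (intro has_derivative_sum has_derivative_mult has_derivative_mult_right has_derivative_nth assms)
  then show ?thesis
    unfolding rr_def by (simp only: distrib_right sum.distrib add_ac)
qed

lemma has_derivative_cmp: "(f has_derivative f') F \<Longrightarrow> ((\<lambda>z. cmp s (f z)) has_derivative (\<lambda>h. cmp s (f' h))) F"
  unfolding cmp_def by (cases s) (auto intro!: derivative_eq_intros)

lemma br1_has_derivative:
  assumes a: "(a has_derivative a') (at z)" and b: "(b has_derivative b') (at z)"
  shows "((\<lambda>z. br1 \<epsilon> z s t (a z) (b z)) has_derivative
    (\<lambda>h. dbr1 \<epsilon> z h s t (a z) (b z) + br1 \<epsilon> z s t (a' h) (b z) + br1 \<epsilon> z s t (a z) (b' h))) (at z)"
proof -
  note id = has_derivative_cmp[OF has_derivative_ident]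
  have lam: "((\<lambda>z. lam1 \<epsilon> z) has_derivative (\<lambda>h. kap \<epsilon> * (dotc (fst h) (snd z) + dotc (fst z) (snd h)))) (at z)"
    unfolding lam1_def
    using has_derivative_add[OF has_derivative_const[of 1] has_derivative_mult_right[OF
        dotc_has_derivative[OF has_derivative_fst[OF has_derivative_ident] has_derivative_snd[OF has_derivative_ident]]]]
    by simp
  note dot = has_derivative_mult[OF dotc_has_derivative[OF a id] dotc_has_derivative[OF b id]]
  show ?thesis
    unfolding br1_def
    by (rule has_derivative_eq_rhs[OF has_derivative_add[OF rr_has_derivative[OF a b id id]
          has_derivative_mult_right[OF has_derivative_add[OF has_derivative_mult[OF dotc_has_derivative[OF a b] lam]
              has_derivative_mult_right[OF has_derivative_diff[OF dot dot]]]]]])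
      (simp add: dbr1_def fun_eq_iff algebra_simps)
qed

lemma PB_has_derivative:
  assumes "(A has_derivative A') (at z)" "(B has_derivative B') (at z)"
  shows "((\<lambda>z. PB \<epsilon> z (A z) (B z)) has_derivative
    (\<lambda>h. DPB \<epsilon> z h (A z) (B z) + PB \<epsilon> z (A' h) (B z) + PB \<epsilon> z (A z) (B' h))) (at z)"
  unfolding PB_def DPB_def sum.distrib[symmetric]
  by (intro has_derivative_sum br1_has_derivative has_derivative_cmp assms)

definition grad2 :: "('n::finite phase \<Rightarrow> complex) \<Rightarrow> 'n phase \<Rightarrow> 'n phase \<Rightarrow> 'n phase" where
  "grad2 f z v = (\<chi> j. ph.dd (ph.dd f (axis j 1, 0)) v z, \<chi> j. ph.dd (ph.dd f (0, axis j 1)) v z)"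

lemma grad_has_derivative:
  assumes "hol ph_J f N" "open N" "z \<in> N"
  shows "(grad f has_derivative grad2 f z) (at z)"
proof -
  have "(ph.dd f w has_derivative (\<lambda>v. ph.dd (ph.dd f w) v z)) (at z)" for w
    using ph.has_cderiv_dd[OF ph.hol_dd[OF assms(1,2)] assms(3)] unfolding has_cderiv_def by blast
  then show ?thesis
    unfolding grad_def[abs_def] grad2_def[abs_def] partial_x_dd partial_p_dd
    by (intro has_derivative_Pair has_derivative_vec) (simp_all only: vec_lambda_beta)
qed

lemma grad2_symmetric:
  assumes "hol ph_J f N" "open N" "z \<in> N"
  shows "pair (grad2 f z v) w = pair (grad2 f z w) v"
proof -
  have *: "pair (grad2 f z v) w = ph.dd (ph.dd f v) w z" for v w
  proof -
    have c: "ph.dd (ph.dd f u) v z = ph.dd (ph.dd f v) u z" for u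
      by (rule ph.dd_commute[OF assms])
    show ?thesis
      unfolding dd_pair[OF ph.hol_dd[OF assms(1,2)] assms(3), of v w] grad2_def grad_def partial_x_dd partial_p_dd
      unfolding c[of "(axis _ 1, 0)"] c[of "(0, axis _ 1)"] ..
  qed
  show ?thesis
    unfolding * by (rule ph.dd_commute[OF assms])
qed

lemma dd_hol_bracket:
  assumes f: "hol ph_J f N" and g: "hol ph_J g N" and N: "open N" "z \<in> N"
  shows "ph.dd (hol_bracket \<epsilon> f g) v z
    = DPB \<epsilon> z v (grad f z) (grad g z) + PB \<epsilon> z (grad2 f z v) (grad g z) + PB \<epsilon> z (grad f z) (grad2 g z v)"
proof -
  have "(hol_bracket \<epsilon> f g has_derivative (\<lambda>v. ph.dd (hol_bracket \<epsilon> f g) v z)) (at z)"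
    using ph.has_cderiv_dd[OF hol_hol_bracket[OF f g N(1)] N(2)] unfolding has_cderiv_def by blast
  moreover have "(hol_bracket \<epsilon> f g has_derivative (\<lambda>v. DPB \<epsilon> z v (grad f z) (grad g z)
      + PB \<epsilon> z (grad2 f z v) (grad g z) + PB \<epsilon> z (grad f z) (grad2 g z v))) (at z)"
    unfolding hol_bracket_eq_PB[abs_def]
    by (intro PB_has_derivative grad_has_derivative[OF f N] grad_has_derivative[OF g N])
  ultimately show ?thesis
    by (rule has_derivative_unique[THEN fun_cong])
qed

text \<open>An outer bracket is differentiation along a Hamiltonian field. The product rule leaves
  three \<open>DPB\<close> terms, whose sum vanishes, and six terms with second derivatives, which
  cancel in pairs by the symmetry of \<open>grad2\<close>.\<close>

lemma hol_bracket_jacobi: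
  assumes f: "hol ph_J f N" and g: "hol ph_J g N" and h: "hol ph_J h N" and N: "open N" "z \<in> N"
  shows "hol_bracket \<epsilon> f (hol_bracket \<epsilon> g h) z + hol_bracket \<epsilon> g (hol_bracket \<epsilon> h f) z
    + hol_bracket \<epsilon> h (hol_bracket \<epsilon> f g) z = 0"
proof -
  have *: "hol_bracket \<epsilon> f (hol_bracket \<epsilon> g h) z = DPB \<epsilon> z (Ham \<epsilon> z (grad f z)) (grad g z) (grad h z)
      - pair (grad2 g z (Ham \<epsilon> z (grad f z))) (Ham \<epsilon> z (grad h z))
      + pair (grad2 h z (Ham \<epsilon> z (grad f z))) (Ham \<epsilon> z (grad g z))"
    if f: "hol ph_J f N" and g: "hol ph_J g N" and h: "hol ph_J h N" for f g h
  proof -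
    have "hol_bracket \<epsilon> f (hol_bracket \<epsilon> g h) z = ph.dd (hol_bracket \<epsilon> g h) (Ham \<epsilon> z (grad f z)) z"
      unfolding hol_bracket_eq_PB[of \<epsilon> f] PB_eq_pair dd_pair[OF hol_hol_bracket[OF g h N(1)] N(2)] ..
    also have "\<dots> = DPB \<epsilon> z (Ham \<epsilon> z (grad f z)) (grad g z) (grad h z)
      - PB \<epsilon> z (grad h z) (grad2 g z (Ham \<epsilon> z (grad f z))) + PB \<epsilon> z (grad g z) (grad2 h z (Ham \<epsilon> z (grad f z)))"
      unfolding dd_hol_bracket[OF g h N] using PB_swap[of \<epsilon> z "grad2 g z (Ham \<epsilon> z (grad f z))" "grad h z"] by simp
    finally show ?thesis
      unfolding PB_eq_pair .
  qed
  note sym = grad2_symmetric[OF _ N]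
  show ?thesis
    unfolding *[OF f g h] *[OF g h f] *[OF h f g]
    using DPB_jacobi[of \<epsilon> z "grad f z" "grad g z" "grad h z"]
      sym[OF f, of "Ham \<epsilon> z (grad g z)" "Ham \<epsilon> z (grad h z)"]
      sym[OF g, of "Ham \<epsilon> z (grad h z)" "Ham \<epsilon> z (grad f z)"]
      sym[OF h, of "Ham \<epsilon> z (grad f z)" "Ham \<epsilon> z (grad g z)"]
    by algebra
qed

section \<open>The involution and charts of its fixed point set\<close>

lemma kap_add: "kap (\<epsilon> + \<delta>) = kap \<epsilon> + kap \<delta>"
  by (simp add: kap_def algebra_simps)

lemma kap_simps [simp]: "kap 0 = 0" "kap (- \<epsilon>) = - kap \<epsilon>" "cnj (kap \<epsilon>) = - kap \<epsilon>" "kap (\<epsilon> / 2) = kap \<epsilon> / 2"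
  by (simp_all add: kap_def)

lemma kap_square: "kap \<epsilon> * kap \<epsilon> = - (of_real \<epsilon>)\<^sup>2"
  unfolding kap_def by (simp add: power2_eq_square algebra_simps)

lemma Lam_eq: "Lam \<epsilon> z = 1 + 2 * kap \<epsilon> * dotc (snd z) (fst z) + kap \<epsilon> * kap \<epsilon> * dotc (fst z) (fst z) * dotc (snd z) (snd z)"
  unfolding kap_square by (simp add: Lam_def case_prod_unfold kap_def mult.assoc)

lemma T_vec_eq: "T_vec \<epsilon> z = snd z + (kap \<epsilon> * dotc (snd z) (snd z)) *s fst z"
  by (simp add: T_vec_def case_prod_unfold kap_def vec_eq_iff)

definition Theta :: "real \<Rightarrow> 'n::finite phase \<Rightarrow> 'n phase" where
  "Theta \<epsilon> z = (fst z, (1 / Lam \<epsilon> z) *s T_vec \<epsilon> z)"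

lemma fst_Theta [simp]: "fst (Theta \<epsilon> z) = fst z"
  by (simp add: Theta_def)

lemma dotc_T_vec: "dotc (T_vec \<epsilon> z) (T_vec \<epsilon> z) = Lam \<epsilon> z * dotc (snd z) (snd z)"
  unfolding T_vec_eq Lam_eq dotc_simps by (simp add: dotc_commute[of "fst z" "snd z"] algebra_simps)

lemma dotc_Theta:
  assumes "Lam \<epsilon> z \<noteq> 0"
  shows "dotc (snd (Theta \<epsilon> z)) (snd (Theta \<epsilon> z)) = dotc (snd z) (snd z) / Lam \<epsilon> z"
  using assms by (simp add: Theta_def dotc_simps dotc_T_vec)

text \<open>Up to the common factor \<open>Lam\<close>, the map acts linearly on the triple (1, p,
  p^2) by sending it to (\<open>Lam\<close>, \<open>T_vec\<close>, p^2), with x as a parameter.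
  These matrices form an additive one-parameter group, so \<open>Lam\<close> is a cocycle.\<close>

lemma Lam_Theta:
  assumes "Lam \<epsilon> z \<noteq> 0"
  shows "Lam \<delta> (Theta \<epsilon> z) = Lam (\<epsilon> + \<delta>) z / Lam \<epsilon> z"
proof -
  have "dotc (snd (Theta \<epsilon> z)) (fst z) = (dotc (snd z) (fst z) + kap \<epsilon> * dotc (snd z) (snd z) * dotc (fst z) (fst z)) / Lam \<epsilon> z"
    by (simp add: Theta_def dotc_simps T_vec_eq add_divide_distrib)
  note E = this
  have "Lam \<delta> (Theta \<epsilon> z) = (Lam \<epsilon> z + 2 * kap \<delta> * (dotc (snd z) (fst z) + kap \<epsilon> * dotc (snd z) (snd z) * dotc (fst z) (fst z))
      + kap \<delta> * kap \<delta> * dotc (fst z) (fst z) * dotc (snd z) (snd z)) / Lam \<epsilon> z"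
    unfolding Lam_eq[of \<delta>] dotc_Theta[OF assms] fst_Theta E using assms by (simp add: field_simps)
  also have "Lam \<epsilon> z + 2 * kap \<delta> * (dotc (snd z) (fst z) + kap \<epsilon> * dotc (snd z) (snd z) * dotc (fst z) (fst z))
      + kap \<delta> * kap \<delta> * dotc (fst z) (fst z) * dotc (snd z) (snd z) = Lam (\<epsilon> + \<delta>) z"
    unfolding Lam_eq kap_add by (simp add: algebra_simps)
  finally show ?thesis .
qed

lemma Theta_Theta:
  assumes "Lam \<epsilon> z \<noteq> 0"
  shows "Theta \<delta> (Theta \<epsilon> z) = Theta (\<epsilon> + \<delta>) z"
proof -
  have "T_vec \<delta> (Theta \<epsilon> z) = (1 / Lam \<epsilon> z) *s T_vec (\<epsilon> + \<delta>) z"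
    unfolding T_vec_eq[of \<delta>] dotc_Theta[OF assms] fst_Theta
    by (simp add: Theta_def T_vec_eq kap_add vec_eq_iff field_simps assms)
  then show ?thesis
    unfolding Theta_def[of \<delta>] Lam_Theta[OF assms] fst_Theta using assms
    by (simp add: Theta_def[of "\<epsilon> + \<delta>"] vec_eq_iff)
qed

lemma Lam_0 [simp]: "Lam 0 z = 1"
  by (simp add: Lam_eq)

lemma Theta_0 [simp]: "Theta 0 z = z"
  by (simp add: Theta_def T_vec_eq prod_eq_iff vec_eq_iff)

definition cv :: "'n::finite cvec \<Rightarrow> 'n cvec" where
  "cv x = (\<chi> j. cnj (x $ j))"

definition cj :: "'n::finite phase \<Rightarrow> 'n phase" where
  "cj z = (cv (fst z), cv (snd z))"

lemma cv_simps [simp]: "cv (cv x) = x" "cv (x + y) = cv x + cv y" "cv (x - y) = cv x - cv y" "cv (c *s x) = cnj c *s cv x"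
  by (simp_all add: cv_def vec_eq_iff)

lemma dotc_cv [simp]: "dotc (cv x) (cv y) = cnj (dotc x y)"
  by (simp add: dotc_def cv_def)

lemma cj_simps [simp]: "fst (cj z) = cv (fst z)" "snd (cj z) = cv (snd z)" "cj (cj z) = z"
  by (simp_all add: cj_def)

lemma Lam_cj: "Lam \<epsilon> (cj z) = cnj (Lam (- \<epsilon>) z)"
  by (simp add: Lam_eq)

text \<open>\<open>kap\<close> is imaginary, so conjugation reverses the parameter of the
  one-parameter family.\<close>

lemma Theta_cj: "Theta \<epsilon> (cj z) = cj (Theta (- \<epsilon>) z)"
  by (simp add: Theta_def T_vec_eq Lam_cj prod_eq_iff)

lemma psi_eq: "psi \<epsilon> z = cj (Theta \<epsilon> z)"
  by (simp add: psi_def cj_def cv_def Theta_def vec_eq_iff)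

lemma P_real_iff: "z \<in> P_real \<epsilon> \<longleftrightarrow> Lam \<epsilon> z \<noteq> 0 \<and> Theta \<epsilon> z = cj z"
proof -
  have "cj (Theta \<epsilon> z) = z \<longleftrightarrow> Theta \<epsilon> z = cj z"
    by (metis cj_simps(3))
  then show ?thesis
    by (simp add: P_real_def PC_def psi_eq)
qed

section \<open>Holomorphic charts adapted to the fixed point set\<close>

definition hol_map :: "('n::finite phase \<Rightarrow> 'n phase) \<Rightarrow> 'n phase set \<Rightarrow> bool" where
  "hol_map F S \<longleftrightarrow> (\<forall>z\<in>S. \<exists>D. has_cderiv ph_J ph_J F D z)"

lemma hol_mapI:
  assumes "\<And>j. hol ph_J (\<lambda>z. fst (F z) $ j) S" "\<And>j. hol ph_J (\<lambda>z. snd (F z) $ j) S"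
  shows "hol_map F S"
  unfolding hol_map_def
proof
  fix z assume z: "z \<in> S"
  let ?D = "\<lambda>v. (\<chi> j. ph.dd (\<lambda>z. fst (F z) $ j) v z, \<chi> j. ph.dd (\<lambda>z. snd (F z) $ j) v z)"
  note D = ph.has_cderiv_dd[OF assms(1) z, unfolded has_cderiv_def] ph.has_cderiv_dd[OF assms(2) z, unfolded has_cderiv_def]
  have "((\<lambda>z. (fst (F z), snd (F z))) has_derivative ?D) (at z)"
    using D by (intro has_derivative_Pair has_derivative_vec) (simp_all only: vec_lambda_beta)
  moreover have "?D (ph_J v) = ph_J (?D v)" for v
  proof -
    have "ph.dd (\<lambda>z. fst (F z) $ j) (ph_J v) z = \<i> * ph.dd (\<lambda>z. fst (F z) $ j) v z"
      "ph.dd (\<lambda>z. snd (F z) $ j) (ph_J v) z = \<i> * ph.dd (\<lambda>z. snd (F z) $ j) v z" for j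
      using D by blast+
    then show ?thesis by (simp add: ph_J_def[of "?D v"] vec_eq_iff)
  qed
  ultimately show "\<exists>D. has_cderiv ph_J ph_J F D z"
    unfolding has_cderiv_def by (intro exI[of _ ?D]) simp
qed

lemma hol_compose_map:
  assumes "hol ph_J f S" "hol_map F T" "F ` T \<subseteq> S"
  shows "hol ph_J (\<lambda>z. f (F z)) T"
  using assms has_cderiv_compose unfolding hol_def hol_map_def by (metis image_subset_iff)

lemma hol_map_continuous_on: "hol_map F S \<Longrightarrow> continuous_on S F"
  unfolding has_cderiv_def hol_map_def by (meson continuous_at_imp_continuous_on has_derivative_continuous)

lemma hol_dotc:
  assumes "\<And>j. hol J (\<lambda>z. f z $ j) S" "\<And>j. hol J (\<lambda>z. g z $ j) S"
  shows "hol J (\<lambda>z. dotc (f z) (g z)) S"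
  unfolding dotc_def by (intro hol_intros assms)

lemma hol_Lam: "hol ph_J (Lam \<epsilon>) S"
  unfolding Lam_eq[abs_def] by (intro hol_intros hol_dotc hol_fst_nth hol_snd_nth)

lemma hol_map_Theta:
  assumes "\<And>z. z \<in> S \<Longrightarrow> Lam \<epsilon> z \<noteq> 0"
  shows "hol_map (Theta \<epsilon>) S"
proof (rule hol_mapI)
  show "hol ph_J (\<lambda>z. fst (Theta \<epsilon> z) $ j) S" for j
    by (simp add: hol_fst_nth)
  show "hol ph_J (\<lambda>z. snd (Theta \<epsilon> z) $ j) S" for j
    unfolding Theta_def snd_conv vector_smult_component T_vec_eq vector_add_component
    by (intro hol_intros hol_dotc hol_fst_nth hol_snd_nth hol_Lam assms)
qed

lemma open_nonzero:
  assumes "hol J f UNIV"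
  shows "open {z. f z \<noteq> 0}"
  using continuous_open_vimage[OF open_Compl[OF closed_singleton], of f 0] hol_continuous_on[OF assms]
  by (simp add: continuous_on_eq_continuous_at vimage_def)

text \<open>The charts are kept holomorphic: their restrictions to real points give the real
  analytic atlas, and their complex derivatives show that the fixed point set is totally
  real.\<close>

definition hol_chart ::
  "real \<Rightarrow> 'n::finite phase set \<Rightarrow> 'n phase set \<Rightarrow> ('n phase \<Rightarrow> 'n phase) \<Rightarrow> ('n phase \<Rightarrow> 'n phase) \<Rightarrow> bool" where
  "hol_chart \<epsilon> A B K H \<longleftrightarrow> open A \<and> open B \<and> K ` A \<subseteq> B \<and> H ` B \<subseteq> A \<and>
     (\<forall>z\<in>A. H (K z) = z) \<and> (\<forall>t\<in>B. K (H t) = t) \<and> hol_map K A \<and> hol_map H B \<and>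
     (\<forall>z\<in>A \<inter> P_real \<epsilon>. cj (K z) = K z) \<and> (\<forall>t\<in>B. cj t = t \<longrightarrow> H t \<in> P_real \<epsilon>)"

text \<open>On the fixed point set conjugation is \<open>Theta \<epsilon>\<close>, and conjugating
  the chart reverses its parameter. As \<epsilon> - \<epsilon>/2 = \<epsilon>/2, the image of such a
  point is its own conjugate.\<close>

lemma hol_chart_Theta:
  "hol_chart \<epsilon> {z. Lam (\<epsilon> / 2) z \<noteq> 0} {z. Lam (- (\<epsilon> / 2)) z \<noteq> 0} (Theta (\<epsilon> / 2)) (Theta (- (\<epsilon> / 2)))"
  unfolding hol_chart_def
proof (intro conjI ballI impI)
  show "open {z :: 'a phase. Lam (\<epsilon> / 2) z \<noteq> 0}" "open {z :: 'a phase. Lam (- (\<epsilon> / 2)) z \<noteq> 0}"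
    by (rule open_nonzero[OF hol_Lam])+
  show "hol_map (Theta (\<epsilon> / 2)) {z. Lam (\<epsilon> / 2) z \<noteq> 0}" "hol_map (Theta (- (\<epsilon> / 2))) {z. Lam (- (\<epsilon> / 2)) z \<noteq> 0}"
    by (rule hol_map_Theta, simp)+
  show "Theta (\<epsilon> / 2) ` {z. Lam (\<epsilon> / 2) z \<noteq> 0} \<subseteq> {z. Lam (- (\<epsilon> / 2)) z \<noteq> 0}"
    "Theta (- (\<epsilon> / 2)) ` {z. Lam (- (\<epsilon> / 2)) z \<noteq> 0} \<subseteq> {z. Lam (\<epsilon> / 2) z \<noteq> 0}"
    by (auto simp: Lam_Theta)
  show "Theta (- (\<epsilon> / 2)) (Theta (\<epsilon> / 2) z) = z" if "z \<in> {z. Lam (\<epsilon> / 2) z \<noteq> 0}" for z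
    using that by (simp add: Theta_Theta)
  show "Theta (\<epsilon> / 2) (Theta (- (\<epsilon> / 2)) z) = z" if "z \<in> {z. Lam (- (\<epsilon> / 2)) z \<noteq> 0}" for z
    using that by (simp add: Theta_Theta)
next
  fix z :: "'a phase" assume "z \<in> {z. Lam (\<epsilon> / 2) z \<noteq> 0} \<inter> P_real \<epsilon>"
  then have z: "Lam \<epsilon> z \<noteq> 0" "Theta \<epsilon> z = cj z"
    by (auto simp: P_real_iff)
  have "cj (Theta (\<epsilon> / 2) z) = Theta (- (\<epsilon> / 2)) (cj z)"
    by (simp add: Theta_cj)
  also have "\<dots> = Theta (\<epsilon> / 2) z"
    unfolding z(2)[symmetric] Theta_Theta[OF z(1)] by simp
  finally show "cj (Theta (\<epsilon> / 2) z) = Theta (\<epsilon> / 2) z" .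
next
  fix t :: "'a phase" assume "t \<in> {z. Lam (- (\<epsilon> / 2)) z \<noteq> 0}" and t: "cj t = t"
  then have L: "Lam (- (\<epsilon> / 2)) t \<noteq> 0" by simp
  have "Lam (\<epsilon> / 2) t = cnj (Lam (- (\<epsilon> / 2)) t)"
    using Lam_cj[of "\<epsilon> / 2" t] by (simp add: t)
  then have "Lam \<epsilon> (Theta (- (\<epsilon> / 2)) t) \<noteq> 0"
    using L by (simp add: Lam_Theta)
  moreover have "Theta \<epsilon> (Theta (- (\<epsilon> / 2)) t) = cj (Theta (- (\<epsilon> / 2)) t)"
    using Theta_cj[of "\<epsilon> / 2" t] by (simp add: Theta_Theta[OF L] t)
  ultimately show "Theta (- (\<epsilon> / 2)) t \<in> P_real \<epsilon>"
    by (simp add: P_real_iff)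
qed

text \<open>The second chart: in terms of the inverted momentum $p / p^2$ the map \<open>Theta\<close> is a translation.\<close>

definition invv :: "'n::finite cvec \<Rightarrow> 'n cvec" where
  "invv q = (1 / dotc q q) *s q"

lemma dotc_invv: "dotc (invv q) (invv q) = 1 / dotc q q"
  by (simp add: invv_def dotc_simps)

lemma invv_invv: "dotc q q \<noteq> 0 \<Longrightarrow> invv (invv q) = q"
  unfolding invv_def[of "invv q"] dotc_invv by (simp add: invv_def vec_eq_iff)

lemma cv_invv: "cv (invv q) = invv (cv q)"
  by (simp add: invv_def)

lemma Lam_invv:
  assumes "dotc (snd z) (snd z) \<noteq> 0"
  shows "dotc (invv (snd z) + kap \<epsilon> *s fst z) (invv (snd z) + kap \<epsilon> *s fst z) = Lam \<epsilon> z / dotc (snd z) (snd z)"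
  using assms unfolding dotc_simps dotc_invv Lam_eq
  by (simp add: invv_def dotc_simps dotc_commute[of "fst z" "snd z"] field_simps)

lemma Theta_invv:
  assumes "dotc (snd z) (snd z) \<noteq> 0"
  shows "snd (Theta \<epsilon> z) = invv (invv (snd z) + kap \<epsilon> *s fst z)"
  unfolding invv_def[of "_ + _"] Lam_invv[OF assms]
  using assms by (simp add: Theta_def T_vec_eq invv_def vec_eq_iff field_simps)

text \<open>On the fixed point set x is real and the conjugate of the inverted momentum q is q +
  \<open>kap \<epsilon>\<close> x. As \<open>kap \<epsilon>\<close> is imaginary, half of this
  translation takes q to a real vector.\<close>

lemma hol_chart_invv:
  "hol_chart \<epsilon> {z. dotc (snd z) (snd z) \<noteq> 0}
     {t. dotc (snd t - (kap \<epsilon> / 2) *s fst t) (snd t - (kap \<epsilon> / 2) *s fst t) \<noteq> 0}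
     (\<lambda>z. (fst z, invv (snd z) + (kap \<epsilon> / 2) *s fst z))
     (\<lambda>t. (fst t, invv (snd t - (kap \<epsilon> / 2) *s fst t)))"
  unfolding hol_chart_def
proof (intro conjI ballI impI)
  have h1: "hol ph_J (\<lambda>z :: 'a phase. dotc (snd z) (snd z)) S" for S
    by (intro hol_dotc hol_snd_nth)
  have h2: "hol ph_J (\<lambda>t :: 'a phase. (snd t - (kap \<epsilon> / 2) *s fst t) $ j) S" for S j
    unfolding vector_minus_component vector_smult_component by (intro hol_intros hol_fst_nth hol_snd_nth)
  have h3: "hol ph_J (\<lambda>t :: 'a phase. dotc (snd t - (kap \<epsilon> / 2) *s fst t) (snd t - (kap \<epsilon> / 2) *s fst t)) S" for S
    by (intro hol_dotc h2)
  show "open {z :: 'a phase. dotc (snd z) (snd z) \<noteq> 0}"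
    "open {t :: 'a phase. dotc (snd t - (kap \<epsilon> / 2) *s fst t) (snd t - (kap \<epsilon> / 2) *s fst t) \<noteq> 0}"
    by (rule open_nonzero[OF h1] open_nonzero[OF h3])+
  show "hol_map (\<lambda>z :: 'a phase. (fst z, invv (snd z) + (kap \<epsilon> / 2) *s fst z)) {z. dotc (snd z) (snd z) \<noteq> 0}"
    unfolding invv_def by (rule hol_mapI; simp only: fst_conv snd_conv vector_add_component vector_smult_component;
        intro hol_intros h1 hol_fst_nth hol_snd_nth; simp)
  show "hol_map (\<lambda>t :: 'a phase. (fst t, invv (snd t - (kap \<epsilon> / 2) *s fst t)))
      {t. dotc (snd t - (kap \<epsilon> / 2) *s fst t) (snd t - (kap \<epsilon> / 2) *s fst t) \<noteq> 0}"
  proof (rule hol_mapI)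
    fix j :: 'a
    let ?S = "{t :: 'a phase. dotc (snd t - (kap \<epsilon> / 2) *s fst t) (snd t - (kap \<epsilon> / 2) *s fst t) \<noteq> 0}"
    show "hol ph_J (\<lambda>t. fst (fst t, invv (snd t - (kap \<epsilon> / 2) *s fst t)) $ j) ?S"
      unfolding fst_conv by (rule hol_fst_nth)
    show "hol ph_J (\<lambda>t. snd (fst t, invv (snd t - (kap \<epsilon> / 2) *s fst t)) $ j) ?S"
      unfolding snd_conv invv_def vector_smult_component[of "1 / _"] by (intro hol_intros h3 h2) simp
  qed
next
  fix z :: "'a phase" assume z: "z \<in> {z. dotc (snd z) (snd z) \<noteq> 0} \<inter> P_real \<epsilon>"
  then have "dotc (snd z) (snd z) \<noteq> 0" "fst z = cv (fst z)" "snd (Theta \<epsilon> z) = cv (snd z)"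
    using fst_Theta[of \<epsilon> z] by (auto simp: P_real_iff)
  then have x: "cv (fst z) = fst z" and "invv (invv (snd z) + kap \<epsilon> *s fst z) = cv (snd z)"
    and n0: "dotc (invv (snd z) + kap \<epsilon> *s fst z) (invv (snd z) + kap \<epsilon> *s fst z) \<noteq> 0"
    using z by (auto simp: Theta_invv Lam_invv P_real_iff)
  then have "invv (cv (snd z)) = invv (snd z) + kap \<epsilon> *s fst z"
    using invv_invv by metis
  then show "cj (fst z, invv (snd z) + (kap \<epsilon> / 2) *s fst z) = (fst z, invv (snd z) + (kap \<epsilon> / 2) *s fst z)"
    by (simp add: cj_def cv_invv x vec_eq_iff)
next
  fix t :: "'a phase" assume t: "t \<in> {t. dotc (snd t - (kap \<epsilon> / 2) *s fst t) (snd t - (kap \<epsilon> / 2) *s fst t) \<noteq> 0}" and r: "cj t = t"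
  define q where "q = snd t - (kap \<epsilon> / 2) *s fst t"
  have r': "cv (fst t) = fst t" "cv (snd t) = snd t"
    using r by (metis cj_simps(1), metis cj_simps(2) r)
  have q: "dotc q q \<noteq> 0" "cv q = q + kap \<epsilon> *s fst t"
    using t by (simp_all add: q_def r' vec_eq_iff)
  have p: "dotc (invv q) (invv q) \<noteq> 0"
    using q(1) by (simp add: dotc_invv)
  have "Lam \<epsilon> (fst t, invv q) = dotc (cv q) (cv q) / dotc q q"
    using Lam_invv[of "(fst t, invv q)" \<epsilon>] p q by (simp add: invv_invv dotc_invv)
  then have "Lam \<epsilon> (fst t, invv q) \<noteq> 0"
    using q(1) by simp
  moreover have "Theta \<epsilon> (fst t, invv q) = cj (fst t, invv q)"
    using Theta_invv[of "(fst t, invv q)" \<epsilon>] p q by (simp add: prod_eq_iff r' cv_invv invv_invv)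
  ultimately show "(fst t, invv (snd t - (kap \<epsilon> / 2) *s fst t)) \<in> P_real \<epsilon>"
    by (simp add: P_real_iff q_def)
qed (auto simp: invv_invv dotc_invv)

text \<open>Where both charts fail, p^2 = 0 and 1 + \<open>kap \<epsilon>\<close> E = 0. Then
  \<open>Lam \<epsilon>\<close> is -1 and \<open>Theta\<close> merely changes the sign of p, so p is
  purely imaginary. Hence the sum of the |p_j|^2 equals -p^2 = 0, and p = 0 contradicts the second
  equation.\<close>

lemma hol_chart_exists:
  assumes z: "z \<in> P_real \<epsilon>"
  obtains A B K H where "hol_chart \<epsilon> A B K H" "z \<in> A"
proof (cases "Lam (\<epsilon> / 2) z = 0 \<and> dotc (snd z) (snd z) = 0")
  case False
  then show ?thesis
    using that[OF hol_chart_Theta[of \<epsilon>]] that[OF hol_chart_invv[of \<epsilon>]] by auto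
next
  case True
  then have pp: "dotc (snd z) (snd z) = 0" by simp
  with True have E: "1 + kap \<epsilon> * dotc (snd z) (fst z) = 0"
    by (simp add: Lam_eq)
  have L: "Lam \<epsilon> z = - 1"
    using E pp by (simp add: Lam_eq) algebra
  have "cv (snd z) = snd (Theta \<epsilon> z)"
    using z by (simp add: P_real_iff)
  also have "\<dots> = - snd z"
    by (simp add: Theta_def T_vec_eq pp L)
  finally have neg: "cv (snd z) = - snd z" .
  have "(\<Sum>j\<in>UNIV. (cmod (snd z $ j))\<^sup>2) = 0"
  proof -
    have "complex_of_real (\<Sum>j\<in>UNIV. (cmod (snd z $ j))\<^sup>2) = dotc (snd z) (cv (snd z))"
      by (simp add: dotc_def cv_def complex_norm_square[symmetric])
    also have "\<dots> = 0"
      unfolding neg dotc_simps pp by simp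
    finally show ?thesis
      using of_real_eq_0_iff by blast
  qed
  then have "snd z = 0"
    by (simp add: sum_nonneg_eq_0_iff vec_eq_iff)
  then show ?thesis
    using E by (simp add: dotc_simps)
qed

section \<open>Total reality of the fixed point set\<close>

lemma linear_cj: "linear cj"
  by (rule linearI) (simp_all add: cj_def cv_def vec_eq_iff)

lemma cj_J: "cj (ph_J v) = - ph_J (cj v)"
  by (simp add: cj_def ph_J_def vec_eq_iff)

text \<open>In a chart the function vanishes at real points, so its derivative annihilates real
  vectors, and by complex linearity all vectors. The derivatives of the chart and its inverse carry
  this back to z.\<close>

lemma cderiv_zero_on_P:
  fixes z :: "'n::finite phase"
  assumes z: "z \<in> P_real \<epsilon>" and f: "has_cderiv ph_J ((*) \<i>) f D z"
    and N: "open N" "z \<in> N" and zero: "\<And>w. w \<in> N \<inter> P_real \<epsilon> \<Longrightarrow> f w = 0"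
  shows "D v = 0"
proof -
  obtain A B K H where chart: "hol_chart \<epsilon> A B K H" and zA: "z \<in> A"
    using hol_chart_exists[OF z] by blast
  have AB: "open A" "open B" "K ` A \<subseteq> B" "H ` B \<subseteq> A"
    and HK: "\<And>z. z \<in> A \<Longrightarrow> H (K z) = z" and hol: "hol_map K A" "hol_map H B"
    and real: "\<And>z. z \<in> A \<inter> P_real \<epsilon> \<Longrightarrow> cj (K z) = K z" "\<And>t. t \<in> B \<Longrightarrow> cj t = t \<Longrightarrow> H t \<in> P_real \<epsilon>"
    using chart unfolding hol_chart_def by blast+
  have KzB: "K z \<in> B" using AB(3) zA by blast
  obtain DK DH where DK: "has_cderiv ph_J ph_J K DK z" and DH: "has_cderiv ph_J ph_J H DH (K z)"
    using hol zA KzB unfolding hol_map_def by blast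
  have "((\<lambda>w. H (K w)) has_derivative (\<lambda>v. DH (DK v))) (at z)"
    using has_cderiv_compose[OF DK DH] unfolding has_cderiv_def by blast
  then have "((\<lambda>w. w) has_derivative (\<lambda>v. DH (DK v))) (at z)"
    by (rule has_derivative_transform_within_open[OF _ AB(1) zA HK])
  then have inv: "DH (DK v) = v" for v
    using has_derivative_unique[OF _ has_derivative_ident] by metis
  have "has_cderiv ph_J ((*) \<i>) f D (H (K z))"
    using f by (simp add: HK zA)
  from has_cderiv_compose[OF DH this]
  have E: "((\<lambda>t. f (H t)) has_derivative (\<lambda>v. D (DH v))) (at (K z))" and EJ: "\<And>v. D (DH (ph_J v)) = \<i> * D (DH v)"
    unfolding has_cderiv_def by blast+
  have lin: "linear (\<lambda>v. D (DH v))"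
    using has_derivative_linear[OF E] .
  have real0: "D (DH v) = 0" if v: "cj v = v" for v
  proof -
    define S where "S = {s::real. K z + s *\<^sub>R v \<in> B \<inter> H -` N}"
    have "open (B \<inter> H -` N)"
      using hol_map_continuous_on[OF hol(2)] AB(2) N(1) by (rule continuous_open_preimage)
    then have S: "open S"
      unfolding S_def using continuous_open_vimage[of "B \<inter> H -` N" "\<lambda>s. K z + s *\<^sub>R v"]
      by (simp add: vimage_def)
    have S0: "0 \<in> S"
      using KzB N(2) by (simp add: S_def HK zA)
    have "((\<lambda>s. K z + s *\<^sub>R v) has_derivative (\<lambda>s. s *\<^sub>R v)) (at 0)"
      by (auto intro!: derivative_eq_intros)
    then have "((\<lambda>s. f (H (K z + s *\<^sub>R v))) has_derivative (\<lambda>s. D (DH (s *\<^sub>R v)))) (at 0)"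
      using has_derivative_compose[of "\<lambda>s. K z + s *\<^sub>R v" _ 0 UNIV "\<lambda>t. f (H t)"] E by simp
    moreover have "f (H (K z + s *\<^sub>R v)) = 0" if "s \<in> S" for s
    proof -
      have "cj (K z + s *\<^sub>R v) = K z + s *\<^sub>R v"
        using real(1)[of z] zA z v by (simp add: linear_add[OF linear_cj] linear_scale[OF linear_cj])
      then show ?thesis
        using zero real(2) that by (simp add: S_def)
    qed
    ultimately have "((\<lambda>s. 0) has_derivative (\<lambda>s. D (DH (s *\<^sub>R v)))) (at 0)"
      by (rule has_derivative_transform_within_open[OF _ S S0])
    then have "(\<lambda>s. D (DH (s *\<^sub>R v))) = (\<lambda>s::real. 0)"
      using has_derivative_unique[OF _ has_derivative_const] by blast
    then show ?thesis
      by (metis scaleR_one)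
  qed
  have all0: "D (DH v) = 0" for v
  proof -
    \<comment> \<open>Real and imaginary part of v: both are fixed by \<open>cj\<close>, and v = v1
      + J v2.\<close>
    define v1 v2 where "v1 = (1/2::real) *\<^sub>R (v + cj v)" and "v2 = - ((1/2::real) *\<^sub>R ph_J (v - cj v))"
    note cj_lin = linear_add[OF linear_cj] linear_diff[OF linear_cj] linear_scale[OF linear_cj] linear_neg[OF linear_cj]
    have "cj v1 = v1" "cj v2 = v2"
      by (simp_all add: v1_def v2_def cj_lin cj_J linear_diff[OF ph.linear] algebra_simps)
    moreover have "v = v1 + ph_J v2"
    proof -
      have "ph_J v2 = (1/2::real) *\<^sub>R (v - cj v)"
        by (simp add: v2_def linear_neg[OF ph.linear] linear_scale[OF ph.linear] ph.J_J algebra_simps)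
      then show ?thesis
        by (simp add: v1_def scaleR_add_right[symmetric] del: scaleR_add_right)
    qed
    ultimately show ?thesis
      using real0 EJ[of v2] linear_add[OF lin, of v1 "ph_J v2"] by simp
  qed
  show ?thesis
    using all0[of "DK v"] inv by simp
qed

lemma grad_eq_on_P:
  assumes z: "z \<in> P_real \<epsilon>" and f: "hol ph_J f M" "z \<in> M" and g: "hol ph_J g M'" "z \<in> M'"
    and N: "open N" "z \<in> N" and eq: "\<And>w. w \<in> N \<inter> P_real \<epsilon> \<Longrightarrow> f w = g w"
  shows "grad f z = grad g z"
proof -
  have "has_cderiv ph_J ((*) \<i>) (\<lambda>w. f w - g w) (\<lambda>v. ph.dd f v z - ph.dd g v z) z"
    by (intro has_cderiv_diff ph.has_cderiv_dd[OF f] ph.has_cderiv_dd[OF g])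
  then have "ph.dd f v z - ph.dd g v z = 0" for v
    by (rule cderiv_zero_on_P[OF z _ N]) (simp add: eq)
  then have "ph.dd f v z = ph.dd g v z" for v
    by simp
  then show ?thesis
    unfolding grad_def partial_x_dd partial_p_dd by simp
qed

section \<open>Analyticity of restrictions of holomorphic maps\<close>

lemma hol_extendable_Re:
  fixes E :: "'a::euclidean_space \<Rightarrow> 'n::finite phase"
  assumes E: "linear E" and g: "hol ph_J g S" "open S" "E a \<in> S"
  shows "hol_extendable (\<lambda>x. Re (g (E x))) a"
proof -
  \<comment> \<open>The complexification of the affine map h \<mapsto> E (a + h). It is used for the
    identity, where the phase space counts as a real vector space, and for the embedding of real
    points.\<close>
  define M where "M w = E a + E (fst w) + ph_J (E (snd w))" for w
  have E': "bounded_linear E"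
    using E by (simp add: linear_conv_bounded_linear)
  have J': "bounded_linear (ph_J :: 'n phase \<Rightarrow> _)"
    using ph.linear by (simp add: linear_conv_bounded_linear)
  have "(M has_derivative (\<lambda>w. E (fst w) + ph_J (E (snd w)))) (at w)" for w
    unfolding M_def
    by (auto intro!: derivative_eq_intros bounded_linear.has_derivative[OF E'] bounded_linear.has_derivative[OF J'])
  then have M: "has_cderiv cpl_J ph_J M (\<lambda>w. E (fst w) + ph_J (E (snd w))) w" for w
    unfolding has_cderiv_def
    by (simp add: cpl_J_def linear_neg[OF E] linear_add[OF ph.linear] ph.J_J)
  have "continuous_on UNIV M"
    using M unfolding has_cderiv_def by (meson continuous_at_imp_continuous_on has_derivative_continuous)
  then have "open (M -` S)"
    using g(2) by (simp add: open_vimage)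
  moreover have "0 \<in> M -` S"
    using g(3) by (simp add: M_def linear_0[OF E] linear_0[OF ph.linear])
  ultimately obtain d where d: "d > 0" "ball 0 d \<subseteq> M -` S"
    using open_contains_ball by blast
  have "hol cpl_J (\<lambda>w. g (M w)) (ball 0 d)"
    unfolding hol_def
  proof
    fix w :: "'a \<times> 'a" assume "w \<in> ball 0 d"
    then obtain D where "has_cderiv ph_J ((*) \<i>) g D (M w)"
      using g(1) d(2) unfolding hol_def by blast
    from has_cderiv_compose[OF M this] show "\<exists>D. has_cderiv cpl_J ((*) \<i>) (\<lambda>w. g (M w)) D w"
      by blast
  qed
  moreover have "g (E (a + h)) = g (M (h, 0))" for h
    by (simp add: M_def linear_add[OF E] linear_0[OF E] linear_0[OF ph.linear])
  ultimately show ?thesis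
    unfolding hol_extendable_def using d(1) by (intro exI[of _ d] conjI exI[of _ "\<lambda>w. g (M w)"]) simp_all
qed

lemma real_analytic_at_Re:
  assumes "hol ph_J g S" "open S" "z \<in> S"
  shows "real_analytic_at (\<lambda>x. Re (g x)) z"
  using hol_extendable_Re[OF linear_ident assms] by (intro real_analytic_at_hol_extendable) simp

lemma real_analytic_hol_map:
  fixes E :: "'a::euclidean_space \<Rightarrow> 'n::finite phase" and R :: "'n phase \<Rightarrow> 'b::euclidean_space"
  assumes E: "linear E" and R: "linear R" and F: "hol_map F S" "open S" "E a \<in> S"
  shows "real_analytic_at (\<lambda>x. R (F (E x))) a"
proof (rule real_analytic_at_hol_extendable)
  fix i :: 'b assume "i \<in> Basis"
  \<comment> \<open>The complex linear functional whose real part is the real linear functional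
    \<open>R w \<bullet> i\<close>.\<close>
  define L where "L w = complex_of_real (R w \<bullet> i) - \<i> * of_real (R (ph_J w) \<bullet> i)" for w
  have R': "bounded_linear R" "bounded_linear (ph_J :: 'n phase \<Rightarrow> _)"
    using R ph.linear by (simp_all add: linear_conv_bounded_linear)
  have "(L has_derivative L) (at w)" for w
    unfolding L_def
    by (auto intro!: derivative_eq_intros bounded_linear.has_derivative[OF R'(1)] bounded_linear.has_derivative[OF R'(2)])
  moreover have "L (ph_J w) = \<i> * L w" for w
    by (simp add: L_def ph.J_J linear_neg[OF R] algebra_simps)
  ultimately have "hol ph_J L UNIV"
    unfolding hol_def has_cderiv_def by blast
  then have "hol ph_J (\<lambda>w. L (F w)) S"
    by (rule hol_compose_map[OF _ F(1)]) simp
  from hol_extendable_Re[OF E this F(2,3)]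
  show "hol_extendable (\<lambda>x. R (F (E x)) \<bullet> i) a"
    by (simp add: L_def)
qed

definition emb :: "(real ^ 'n) \<times> (real ^ 'n) \<Rightarrow> 'n::finite phase" where
  "emb t = (\<chi> j. of_real (fst t $ j), \<chi> j. of_real (snd t $ j))"

definition rep :: "'n::finite phase \<Rightarrow> (real ^ 'n) \<times> (real ^ 'n)" where
  "rep z = (\<chi> j. Re (fst z $ j), \<chi> j. Re (snd z $ j))"

lemma emb_rep: "rep (emb t) = t" "cj (emb t) = emb t"
  by (simp_all add: rep_def emb_def cj_def cv_def prod_eq_iff vec_eq_iff)

lemma rep_emb:
  assumes "cj z = z"
  shows "emb (rep z) = z"
proof -
  have "cv (fst z) = fst z" "cv (snd z) = snd z"
    using assms cj_simps(1,2)[of z] by simp_all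
  then have "cnj (fst z $ j) = fst z $ j" "cnj (snd z $ j) = snd z $ j" for j
    unfolding cv_def vec_eq_iff by simp_all
  then have "complex_of_real (Re (fst z $ j)) = fst z $ j" "complex_of_real (Re (snd z $ j)) = snd z $ j" for j
    by (metis Reals_cnj_iff of_real_Re)+
  then show ?thesis
    by (simp add: rep_def emb_def prod_eq_iff vec_eq_iff)
qed

lemma linear_emb: "linear emb" and linear_rep: "linear rep"
  by (rule linearI; simp add: emb_def rep_def prod_eq_iff vec_eq_iff scaleR_conv_of_real[where 'a = complex])+

text \<open>A holomorphic chart is restricted to real points by \<open>rep\<close> and
  \<open>emb\<close>. Holomorphic maps composed with real linear maps are analytic on open sets of
  the ambient space, which is what analyticity on a subset asks for.\<close>

lemma P_real_submanifold:
  "real_analytic_submanifold (P_real \<epsilon> :: 'n::finite phase set) TYPE((real ^ 'n) \<times> (real ^ 'n))"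
  unfolding real_analytic_submanifold_def
proof
  fix z :: "'n phase" assume z: "z \<in> P_real \<epsilon>"
  obtain A B K H where chart: "hol_chart \<epsilon> A B K H" and zA: "z \<in> A"
    using hol_chart_exists[OF z] by blast
  have AB: "open A" "open B" "K ` A \<subseteq> B" "H ` B \<subseteq> A"
    and HK: "\<And>z. z \<in> A \<Longrightarrow> H (K z) = z" "\<And>t. t \<in> B \<Longrightarrow> K (H t) = t" and hol: "hol_map K A" "hol_map H B"
    and real: "\<And>z. z \<in> A \<Longrightarrow> z \<in> P_real \<epsilon> \<Longrightarrow> cj (K z) = K z" "\<And>t. t \<in> B \<Longrightarrow> cj t = t \<Longrightarrow> H t \<in> P_real \<epsilon>"
    using chart unfolding hol_chart_def by blast+
  define U where "U = P_real \<epsilon> \<inter> A"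
  define W where "W = {t. emb t \<in> B}"
  define \<kappa> where "\<kappa> w = rep (K w)" for w
  define \<phi> where "\<phi> t = H (emb t)" for t
  have emb_\<kappa>: "emb (\<kappa> w) = K w" if "w \<in> U" for w
    using that by (simp add: \<kappa>_def U_def rep_emb real(1))
  have \<kappa>W: "\<kappa> w \<in> W" "\<phi> (\<kappa> w) = w" if "w \<in> U" for w
    using that AB(3) HK(1) by (auto simp: W_def \<phi>_def emb_\<kappa> U_def)
  have \<phi>U: "\<phi> t \<in> U" "\<kappa> (\<phi> t) = t" if "t \<in> W" for t
    using that AB(4) HK(2) real(2) emb_rep(2)[of t] by (auto simp: W_def \<phi>_def U_def \<kappa>_def emb_rep(1))
  have "bounded_linear (emb :: (real ^ 'n) \<times> (real ^ 'n) \<Rightarrow> _)"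
    using linear_emb by (simp add: linear_conv_bounded_linear)
  then have W: "open W"
    using continuous_open_vimage[OF AB(2), of emb] unfolding W_def
    by (simp add: linear_continuous_at vimage_def)
  have "real_analytic_on \<kappa> U"
    unfolding real_analytic_on_def
  proof
    fix a assume "a \<in> U"
    then have "open A \<and> a \<in> A \<and> (\<forall>y\<in>A. real_analytic_at \<kappa> y) \<and> (\<forall>y\<in>A \<inter> U. \<kappa> y = \<kappa> y)"
      using AB(1) real_analytic_hol_map[OF linear_ident linear_rep hol(1) AB(1)] by (simp add: U_def \<kappa>_def[abs_def])
    then show "\<exists>N F. open N \<and> a \<in> N \<and> (\<forall>y\<in>N. real_analytic_at F y) \<and> (\<forall>y\<in>N \<inter> U. F y = \<kappa> y)"
      by blast
  qed
  moreover have "real_analytic_on \<phi> W"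
    unfolding real_analytic_on_def
  proof
    fix a assume a: "a \<in> W"
    have "real_analytic_at \<phi> t" if "t \<in> W" for t
      using that real_analytic_hol_map[OF linear_emb linear_ident hol(2) AB(2), of t]
      by (simp add: W_def \<phi>_def[abs_def])
    then show "\<exists>N F. open N \<and> a \<in> N \<and> (\<forall>y\<in>N. real_analytic_at F y) \<and> (\<forall>y\<in>N \<inter> W. F y = \<phi> y)"
      using W a by blast
  qed
  moreover have "\<kappa> ` U = W" "\<phi> ` W = U"
    using \<kappa>W \<phi>U by (auto simp: image_iff) metis+
  moreover have "openin (top_of_set (P_real \<epsilon>)) U" "z \<in> U"
    using AB(1) z zA by (auto simp: U_def openin_open_Int)
  ultimately show "\<exists>U (W :: ((real ^ 'n) \<times> (real ^ 'n)) set) \<kappa> \<phi>.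
      z \<in> U \<and> openin (top_of_set (P_real \<epsilon>)) U \<and> open W \<and> \<kappa> ` U = W \<and> \<phi> ` W = U \<and>
      (\<forall>y\<in>U. \<phi> (\<kappa> y) = y) \<and> (\<forall>t\<in>W. \<kappa> (\<phi> t) = t) \<and> real_analytic_on \<kappa> U \<and> real_analytic_on \<phi> W"
    using W \<kappa>W(2) \<phi>U(2) by (intro exI[of _ U] exI[of _ W] exI[of _ \<kappa>] exI[of _ \<phi>]) simp
qed

lemma open_PC: "open (PC \<epsilon>)"
  unfolding PC_def by (rule open_nonzero[OF hol_Lam])

lemma psi_antiholomorphic:
  assumes "w \<in> PC \<epsilon>"
  obtains D where "(psi \<epsilon> has_derivative D) (at w)" "\<And>v. D (ph_J v) = - ph_J (D v)"
proof -
  have "hol_map (Theta \<epsilon>) (PC \<epsilon>)"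
    by (rule hol_map_Theta) (simp add: PC_def)
  then obtain D where D: "(Theta \<epsilon> has_derivative D) (at w)" "\<And>v. D (ph_J v) = ph_J (D v)"
    using assms unfolding hol_map_def has_cderiv_def by blast
  have "bounded_linear (cj :: 'a phase \<Rightarrow> _)"
    using linear_cj by (simp add: linear_conv_bounded_linear)
  from bounded_linear.has_derivative[OF this D(1)]
  have "(psi \<epsilon> has_derivative (\<lambda>v. cj (D v))) (at w)"
    by (simp add: psi_eq[abs_def])
  then show ?thesis
    by (rule that) (simp add: D(2) cj_J)
qed

text \<open>On the fixed point set of \<open>psi\<close> the real coordinates of \<open>w\<close> are the values of the holomorphic
  coordinates \<open>(w + psi w) / 2\<close> of the complexification of the phase space as a real vector space.\<close>

lemma hol_extension_at:
  fixes F :: "'n::finite phase \<Rightarrow> real"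
  assumes z: "z \<in> P_real \<epsilon>" and F: "real_analytic_at F z"
  obtains N f where "open N" "z \<in> N" "N \<subseteq> PC \<epsilon>" "hol ph_J f N" "\<And>w. w \<in> N \<inter> P_real \<epsilon> \<Longrightarrow> f w = of_real (F w)"
proof -
  obtain d G where d: "d > 0" and G: "hol cpl_J G (ball 0 d)" "\<And>h. norm h < d \<Longrightarrow> G (h, 0) = of_real (F (z + h))"
    using real_analytic_hol_extension[OF F] by blast
  \<comment> \<open>Real and imaginary coordinates of w relative to z, with \<open>psi\<close> as
    the conjugation. As \<open>psi\<close> is antiholomorphic, \<open>X\<close> intertwines
    \<open>ph_J\<close> with \<open>cpl_J\<close>; on the fixed point set it is (w - z, 0), where
    \<open>G\<close> restricts to \<open>F\<close>.\<close>
  define X where "X w = ((1/2::real) *\<^sub>R (w + psi \<epsilon> w) - z, - ((1/2::real) *\<^sub>R ph_J (w - psi \<epsilon> w)))" for w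
  have X: "\<exists>D. has_cderiv ph_J cpl_J X D w" if w: "w \<in> PC \<epsilon>" for w
  proof -
    obtain D where D: "(psi \<epsilon> has_derivative D) (at w)" "\<And>v. D (ph_J v) = - ph_J (D v)"
      using psi_antiholomorphic[OF w] by blast
    have J: "bounded_linear (ph_J :: 'n phase \<Rightarrow> _)"
      using ph.linear by (simp add: linear_conv_bounded_linear)
    have "(X has_derivative (\<lambda>v. ((1/2::real) *\<^sub>R (v + D v), - ((1/2::real) *\<^sub>R ph_J (v - D v))))) (at w)"
      unfolding X_def
      by (auto intro!: derivative_eq_intros bounded_linear.has_derivative[OF J] D(1))
    then have "has_cderiv ph_J cpl_J X (\<lambda>v. ((1/2::real) *\<^sub>R (v + D v), - ((1/2::real) *\<^sub>R ph_J (v - D v)))) w"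
      unfolding has_cderiv_def
      by (simp add: cpl_J_def D(2) linear_add[OF ph.linear] linear_diff[OF ph.linear] linear_neg[OF ph.linear] ph.J_J algebra_simps)
    then show ?thesis by blast
  qed
  have psiP: "psi \<epsilon> w = w" "w \<in> PC \<epsilon>" if "w \<in> P_real \<epsilon>" for w
    using that by (simp_all add: P_real_def)
  have XP: "X w = (w - z, 0)" if "w \<in> P_real \<epsilon>" for w
    using psiP[OF that] by (simp add: X_def linear_0[OF ph.linear] scaleR_2[symmetric])
  define N where "N = PC \<epsilon> \<inter> X -` ball 0 d"
  have "continuous_on (PC \<epsilon>) X"
    using X unfolding has_cderiv_def by (meson continuous_at_imp_continuous_on has_derivative_continuous)
  then have "open N"
    unfolding N_def using open_PC open_ball by (rule continuous_open_preimage)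
  moreover have "z \<in> N"
    using d psiP[OF z] by (simp add: N_def XP[OF z])
  moreover have "hol ph_J (\<lambda>w. G (X w)) N"
    unfolding hol_def
  proof
    fix w assume w: "w \<in> N"
    then obtain D E where "has_cderiv ph_J cpl_J X D w" "has_cderiv cpl_J ((*) \<i>) G E (X w)"
      using X G(1) unfolding N_def hol_def by blast
    from has_cderiv_compose[OF this] show "\<exists>D. has_cderiv ph_J ((*) \<i>) (\<lambda>w. G (X w)) D w"
      by blast
  qed
  moreover have "G (X w) = of_real (F w)" if "w \<in> N \<inter> P_real \<epsilon>" for w
  proof -
    have "X w \<in> ball 0 d"
      using that by (simp add: N_def)
    then have "norm (w - z) < d"
      using XP[of w] that by (simp add: norm_prod_def)
    then show ?thesis
      using G(2)[of "w - z"] that XP by simp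
  qed
  ultimately show ?thesis
    using that[of N "\<lambda>w. G (X w)"] by (auto simp: N_def)
qed

section \<open>The involution is anti-Poisson\<close>

text \<open>The entries pair the covector \<alpha> with the infinitesimal rotations at z; this is
  the moment map of the rotation action on the phase space.\<close>

definition WP :: "'n::{finite,linorder} phase \<Rightarrow> 'n phase \<Rightarrow> 'n cmat" where
  "WP z \<alpha> = (\<Sum>s\<in>UNIV. wd (cmp s \<alpha>) (cmp s z))"

definition SP :: "real \<Rightarrow> 'n::{finite,linorder} phase \<Rightarrow> 'n phase \<Rightarrow> 'n phase \<Rightarrow> complex" where
  "SP \<epsilon> z \<alpha> \<beta> = lam1 \<epsilon> z * (dotc (snd \<alpha>) (fst \<beta>) - dotc (fst \<alpha>) (snd \<beta>))
     + kap \<epsilon> * (dotc (snd \<alpha>) (snd z) * dotc (fst \<beta>) (fst z) - dotc (snd \<alpha>) (fst z) * dotc (fst \<beta>) (snd z)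
       - dotc (fst \<alpha>) (fst z) * dotc (snd \<beta>) (snd z) + dotc (fst \<alpha>) (snd z) * dotc (snd \<beta>) (fst z))"

text \<open>Since both tensor factors of r lie in so(n), the r-part sees the covectors only through
  their pairings with rotations. The denominator 4 combines the half in \<open>rr_Rop\<close> with
  the factor in \<open>trace_wd\<close>.\<close>

lemma PB_decompose: "PB \<epsilon> z \<alpha> \<beta> = - trace (WP z \<alpha> ** Rop \<epsilon> (WP z \<beta>)) / 4 + SP \<epsilon> z \<alpha> \<beta>"
proof -
  have add: "trace ((A + B) ** C) = trace (A ** C) + trace (B ** C)" "trace (C ** (A + B)) = trace (C ** A) + trace (C ** B)" for A B C :: "'a cmat"
    by (simp_all add: trace_matrix_mult sum.distrib distrib_right distrib_left)
  have "rr \<epsilon> a b u v = - trace (wd a u ** Rop \<epsilon> (wd b v)) / 4" for a b u v :: "'a cvec"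
    unfolding trace_wd[OF Rop_antisym[OF transpose_wd]] rr_Rop by simp
  then show ?thesis
    unfolding PB_def br1_def WP_def SP_def UNIV_bool
    by (simp add: Rop_linear add om_def cmp_def algebra_simps add_divide_distrib diff_divide_distrib)
qed

text \<open>The pullback of the covector \<open>a\<close> under \<open>Theta\<close>, see \<open>pair_pull\<close>.\<close>

definition pull :: "real \<Rightarrow> 'n::finite phase \<Rightarrow> 'n phase \<Rightarrow> 'n phase" where
  "pull \<epsilon> z a = (let \<tau> = dotc (snd a) (snd (Theta \<epsilon> z)); y = 1 / Lam \<epsilon> z; k = kap \<epsilon> in
     (fst a + (k * y * dotc (snd z) (snd z)) *s snd a - (2 * k * \<tau>) *s snd (Theta \<epsilon> z),
      y *s snd a + (2 * k * y * dotc (snd a) (fst z)) *s snd z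
        - (2 * k * \<tau> * y) *s (fst z + (k * dotc (fst z) (fst z)) *s snd z)))"

text \<open>\<open>Theta\<close> commutes with rotations, so pulling a covector back does not change
  its pairings with infinitesimal rotations.\<close>

lemma WP_pull: "WP z (pull \<epsilon> z a) = WP (Theta \<epsilon> z) a"
proof -
  have wd_lin: "wd (a + b) u = wd a u + wd b u" "wd (a - b) u = wd a u - wd b u" "wd (c *s a) u = (\<chi> i. c *s (wd a u $ i))"
    "wd a (u + v) = wd a u + wd a v" "wd a (c *s u) = (\<chi> i. c *s (wd a u $ i))" for a b u v :: "'a cvec" and c
    by (simp_all add: wd_def vec_eq_iff algebra_simps)
  have wd0: "wd u u = 0" for u :: "'a cvec"
    by (simp add: wd_def vec_eq_iff)
  have swap: "wd (snd z) (fst z) = - wd (fst z) (snd z)"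
    by (rule wd_swap)
  show ?thesis
    unfolding WP_def UNIV_bool pull_def Let_def cmp_def Theta_def T_vec_eq
    by (simp add: wd_lin wd0 swap vec_eq_iff algebra_simps)
qed

text \<open>The pairing of a covector with \<open>Theta\<close> is a term in the position plus a
  quotient \<open>g / Lam\<close>. The quotient rule yields the formula for \<open>pull\<close>,
  with \<tau> as the value of that quotient.\<close>

lemma pair_pull:
  assumes "Lam \<epsilon> z \<noteq> 0" and D: "(Theta \<epsilon> has_derivative D) (at z)"
  shows "pair a (D h) = pair (pull \<epsilon> z a) h"
proof -
  note id = has_derivative_fst[OF has_derivative_ident] has_derivative_snd[OF has_derivative_ident]

  define DL where "DL h = 2 * kap \<epsilon> * (dotc (snd h) (fst z) + dotc (snd z) (fst h))
     + kap \<epsilon> * kap \<epsilon> * (dotc (fst z) (fst z) * (dotc (snd h) (snd z) + dotc (snd z) (snd h))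
       + (dotc (fst h) (fst z) + dotc (fst z) (fst h)) * dotc (snd z) (snd z))" for h
  have L: "(Lam \<epsilon> has_derivative DL) (at z)"
  proof -
    note D = has_derivative_add[OF has_derivative_add[OF has_derivative_const[of 1]
        has_derivative_mult_right[OF dotc_has_derivative[OF id(2,1)], of "2 * kap \<epsilon>"]]
      has_derivative_mult_right[OF has_derivative_mult[OF dotc_has_derivative[OF id(1,1)] dotc_has_derivative[OF id(2,2)]], of "kap \<epsilon> * kap \<epsilon>"]]
    show ?thesis
      unfolding Lam_eq[abs_def] mult.assoc[of "kap \<epsilon> * kap \<epsilon>"]
      by (rule has_derivative_eq_rhs[OF D])
        (simp add: DL_def fun_eq_iff)
  qed
  define g where "g w = dotc (snd a) (snd w) + kap \<epsilon> * (dotc (snd w) (snd w) * dotc (snd a) (fst w))" for w :: "'a phase"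
  define Dg where "Dg h = dotc (snd a) (snd h) + kap \<epsilon> * (dotc (snd z) (snd z) * dotc (snd a) (fst h)
     + (dotc (snd h) (snd z) + dotc (snd z) (snd h)) * dotc (snd a) (fst z))" for h
  have g: "(g has_derivative Dg) (at z)"
  proof -
    note D = has_derivative_add[OF dotc_has_derivative[OF has_derivative_const[of "snd a"] id(2)]
      has_derivative_mult_right[OF has_derivative_mult[OF dotc_has_derivative[OF id(2,2)]
        dotc_has_derivative[OF has_derivative_const[of "snd a"] id(1)]], of "kap \<epsilon>"]]
    show ?thesis
      unfolding g_def[abs_def]
      by (rule has_derivative_eq_rhs[OF D])
        (simp add: Dg_def fun_eq_iff dotc_simps)
  qed
  have pair_Theta: "pair a (Theta \<epsilon> w) = dotc (fst a) (fst w) + g w / Lam \<epsilon> w" for w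
    by (simp add: pair_def Theta_def dotc_simps T_vec_eq g_def add_divide_distrib)
  have "((\<lambda>w. pair a (Theta \<epsilon> w)) has_derivative (\<lambda>h. dotc (fst a) (fst h) + (Dg h * Lam \<epsilon> z - g z * DL h) / (Lam \<epsilon> z * Lam \<epsilon> z))) (at z)"
    unfolding pair_Theta
    by (rule has_derivative_eq_rhs[OF has_derivative_add[OF dotc_has_derivative[OF has_derivative_const[of "fst a"] id(1)]
            has_derivative_divide'[OF g L assms(1)]]])
      (simp add: dotc_simps)
  moreover have "((\<lambda>w. pair a (Theta \<epsilon> w)) has_derivative (\<lambda>h. pair a (D h))) (at z)"
    unfolding pair_def
    by (rule has_derivative_eq_rhs[OF has_derivative_add[OF
          dotc_has_derivative[OF has_derivative_const[of "fst a"] has_derivative_fst[OF D]]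
          dotc_has_derivative[OF has_derivative_const[of "snd a"] has_derivative_snd[OF D]]]])
      (simp add: dotc_simps)
  ultimately have "pair a (D h) = dotc (fst a) (fst h) + (Dg h * Lam \<epsilon> z - g z * DL h) / (Lam \<epsilon> z * Lam \<epsilon> z)"
    by (rule has_derivative_unique[THEN fun_cong, symmetric])
  also have "\<dots> = dotc (fst a) (fst h) + Dg h * (1 / Lam \<epsilon> z) - (g z * (1 / Lam \<epsilon> z)) * (DL h * (1 / Lam \<epsilon> z))"
    using assms(1) by (simp add: field_simps)
  also have "g z * (1 / Lam \<epsilon> z) = dotc (snd a) (snd (Theta \<epsilon> z))"
    by (simp add: Theta_def dotc_simps T_vec_eq g_def add_divide_distrib)
  also have "dotc (fst a) (fst h) + Dg h * (1 / Lam \<epsilon> z) - dotc (snd a) (snd (Theta \<epsilon> z)) * (DL h * (1 / Lam \<epsilon> z))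
      = pair (pull \<epsilon> z a) h"
  proof -
    have T: "dotc (snd (Theta \<epsilon> z)) u = (1 / Lam \<epsilon> z) * (dotc (snd z) u + kap \<epsilon> * dotc (snd z) (snd z) * dotc (fst z) u)" for u
      by (simp add: Theta_def dotc_simps T_vec_eq add_divide_distrib)
    define y \<tau> where "y = 1 / Lam \<epsilon> z" and "\<tau> = dotc (snd a) (snd (Theta \<epsilon> z))"
    show ?thesis
      unfolding pull_def Let_def pair_def fst_conv snd_conv dotc_simps T
      unfolding y_def[symmetric] \<tau>_def[symmetric] Dg_def DL_def
      by (simp add: dotc_commute[of "snd h" "fst z"] dotc_commute[of "snd h" "snd z"] dotc_commute[of "fst h" "fst z"] algebra_simps)
  qed
  finally show ?thesis .
qed

lemma SP_add:
  "SP \<epsilon> z (\<alpha> + \<alpha>') \<beta> = SP \<epsilon> z \<alpha> \<beta> + SP \<epsilon> z \<alpha>' \<beta>"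
  "SP \<epsilon> z \<alpha> (\<beta> + \<beta>') = SP \<epsilon> z \<alpha> \<beta> + SP \<epsilon> z \<alpha> \<beta>'"
  unfolding SP_def fst_add snd_add dotc_simps by (simp_all add: algebra_simps)

lemma SP_swap: "SP \<epsilon> z \<beta> \<alpha> = - SP \<epsilon> z \<alpha> \<beta>"
  unfolding SP_def by (simp add: dotc_commute[of "snd \<beta>" "fst \<alpha>"] dotc_commute[of "fst \<beta>" "snd \<alpha>"] algebra_simps)

lemma pull_split: "pull \<epsilon> z a = (fst a, 0) + pull \<epsilon> z (0, snd a)"
  by (simp add: pull_def Let_def)

text \<open>The contractions of \<open>pull \<epsilon> z (0, a)\<close>, up to the factor \<open>1 / Lam\<close>, are polynomials in
  \<open>\<tau>\<close>, the pairing of \<open>a\<close> with the momentum part of \<open>Theta \<epsilon> z\<close>.\<close>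

lemma pull_momentum:
  fixes z :: "'n::finite phase" and a :: "'n cvec"
  assumes "Lam \<epsilon> z \<noteq> 0"
  defines "k \<equiv> kap \<epsilon>" and "x \<equiv> fst z" and "p \<equiv> snd z"
  defines "y \<equiv> 1 / Lam \<epsilon> z" and "\<tau> \<equiv> dotc a (snd (Theta \<epsilon> z))"
  defines "ax \<equiv> (k * dotc p p) *s a - (2 * k * \<tau>) *s (p + (k * dotc p p) *s x)"
    and "ap \<equiv> a + (2 * k * dotc a x) *s p - (2 * k * \<tau>) *s (x + (k * dotc x x) *s p)"
  shows "fst (pull \<epsilon> z (0, a)) = y *s ax" "snd (pull \<epsilon> z (0, a)) = y *s ap"
    "dotc a p = \<tau> * (1 + 2 * k * dotc p x + k * k * dotc x x * dotc p p) - k * dotc p p * dotc a x"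
    "dotc ap p = \<tau> * (1 - k * k * dotc x x * dotc p p) + k * dotc a x * dotc p p"
    "dotc ax p = - k * dotc p p * (\<tau> * (1 - k * k * dotc x x * dotc p p) + k * dotc a x * dotc p p)"
    "dotc ax x = k * (dotc p p * dotc a x - 2 * \<tau> * dotc p x - 2 * k * \<tau> * dotc p p * dotc x x)"
    "dotc ap x = dotc a x * (1 + 2 * k * dotc p x) - 2 * k * \<tau> * dotc x x * (1 + k * dotc p x)"
proof -
  have q: "snd (Theta \<epsilon> z) = y *s (p + (k * dotc p p) *s x)"
    by (simp add: Theta_def T_vec_eq y_def p_def x_def k_def)
  show "fst (pull \<epsilon> z (0, a)) = y *s ax" "snd (pull \<epsilon> z (0, a)) = y *s ap"
    unfolding pull_def Let_def fst_conv snd_conv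
    unfolding \<tau>_def[symmetric] unfolding y_def[symmetric] k_def[symmetric] x_def[symmetric] p_def[symmetric] unfolding q
    by (simp_all add: ax_def ap_def vec_eq_iff algebra_simps)
  have "\<tau> * Lam \<epsilon> z = dotc a p + k * dotc p p * dotc a x"
    unfolding \<tau>_def q dotc_simps using assms(1) by (simp add: y_def)
  then show 1: "dotc a p = \<tau> * (1 + 2 * k * dotc p x + k * k * dotc x x * dotc p p) - k * dotc p p * dotc a x"
    unfolding Lam_eq by (simp add: x_def p_def k_def)
  show "dotc ap p = \<tau> * (1 - k * k * dotc x x * dotc p p) + k * dotc a x * dotc p p"
    "dotc ax p = - k * dotc p p * (\<tau> * (1 - k * k * dotc x x * dotc p p) + k * dotc a x * dotc p p)"
    unfolding ap_def ax_def dotc_simps 1 dotc_commute[of x p] by algebra+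
  show "dotc ax x = k * (dotc p p * dotc a x - 2 * \<tau> * dotc p x - 2 * k * \<tau> * dotc p p * dotc x x)"
    "dotc ap x = dotc a x * (1 + 2 * k * dotc p x) - 2 * k * \<tau> * dotc x x * (1 + k * dotc p x)"
    unfolding ap_def ax_def dotc_simps by algebra+
qed

text \<open>Positions are untouched by \<open>Theta\<close>, and their invariant bracket with its
  momentum part is the original one with the parameter reversed. After \<open>pull_momentum\<close>
  only scalar products remain.\<close>

lemma SP_pull_px:
  assumes L: "Lam \<epsilon> z \<noteq> 0"
  shows "SP \<epsilon> z (pull \<epsilon> z (0, a)) (b, 0) = SP (- \<epsilon>) (Theta \<epsilon> z) (0, a) (b, 0)"
proof -
  define x p k y \<tau> where "x = fst z" and "p = snd z" and "k = kap \<epsilon>" and "y = 1 / Lam \<epsilon> z" and "\<tau> = dotc a (snd (Theta \<epsilon> z))"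
  define X P E where "X = dotc x x" and "P = dotc p p" and "E = dotc p x"
  define ap where "ap = a + (2 * k * dotc a x) *s p - (2 * k * \<tau>) *s (x + (k * X) *s p)"
  note m = pull_momentum[OF L, of a, folded k_def x_def p_def y_def \<tau>_def, folded X_def P_def E_def, folded ap_def]
  have y: "y * (1 + 2 * k * E + k * k * X * P) = 1"
    using L unfolding y_def Lam_eq E_def X_def P_def x_def p_def k_def by simp
  have q: "dotc u (snd (Theta \<epsilon> z)) = y * (dotc u p + k * P * dotc u x)" for u
    by (simp add: Theta_def T_vec_eq y_def p_def x_def k_def P_def dotc_simps add_divide_distrib)
  have apb: "dotc ap b = dotc a b + 2 * k * dotc a x * dotc b p - 2 * k * \<tau> * (dotc b x + k * X * dotc b p)"
    unfolding ap_def dotc_simps dotc_commute[of p b] dotc_commute[of x b] ..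
  have "SP \<epsilon> z (pull \<epsilon> z (0, a)) (b, 0) = y * ((1 + k * E) * dotc ap b + k * (dotc ap p * dotc b x - dotc ap x * dotc b p))"
    unfolding SP_def m(2) fst_conv snd_conv dotc_simps lam1_def
    by (simp add: x_def[symmetric] p_def[symmetric] k_def[symmetric] dotc_commute[of x p] E_def[symmetric] algebra_simps)
  \<comment> \<open>Grouped so that \<tau> is multiplied by \<open>Lam\<close>; the next step
    cancels it against \<open>y\<close>.\<close>
  also have "\<dots> = y * ((1 + k * E) * dotc a b + k * (- \<tau> * (1 + 2 * k * E + k * k * X * P) * dotc b x + dotc a x * (dotc b p + k * P * dotc b x)))"
    unfolding apb m(4,7) by algebra
  also have "\<dots> = (1 - k * (y * (E + k * P * X))) * dotc a b - k * (\<tau> * dotc b x - dotc a x * (y * (dotc b p + k * P * dotc b x)))"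
    using y by algebra
  also have "\<dots> = SP (- \<epsilon>) (Theta \<epsilon> z) (0, a) (b, 0)"
    unfolding SP_def lam1_def fst_conv snd_conv fst_Theta x_def[symmetric] kap_simps k_def[symmetric] \<tau>_def[symmetric] q[of b] q[of x] dotc_simps
      dotc_commute[of x p] E_def[symmetric] X_def[symmetric] by (simp add: algebra_simps)
  finally show ?thesis .
qed

text \<open>The counterpart of the fact that momenta commute in the invariant part: the momentum
  components of \<open>Theta\<close> commute as well. Expanding one covector of each contraction
  reduces the claim to a polynomial identity.\<close>

lemma SP_pull_pp:
  assumes L: "Lam \<epsilon> z \<noteq> 0"
  shows "SP \<epsilon> z (pull \<epsilon> z (0, a)) (pull \<epsilon> z (0, b)) = 0"
proof -
  define x p k y \<tau> \<sigma> where "x = fst z" and "p = snd z" and "k = kap \<epsilon>" and "y = 1 / Lam \<epsilon> z"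
    and "\<tau> = dotc a (snd (Theta \<epsilon> z))" and "\<sigma> = dotc b (snd (Theta \<epsilon> z))"
  define X P E where "X = dotc x x" and "P = dotc p p" and "E = dotc p x"
  define ax ap where "ax = (k * P) *s a - (2 * k * \<tau>) *s (p + (k * P) *s x)"
    and "ap = a + (2 * k * dotc a x) *s p - (2 * k * \<tau>) *s (x + (k * X) *s p)"
  define bx bp where "bx = (k * P) *s b - (2 * k * \<sigma>) *s (p + (k * P) *s x)"
    and "bp = b + (2 * k * dotc b x) *s p - (2 * k * \<sigma>) *s (x + (k * X) *s p)"
  note m = pull_momentum[OF L, of a, folded k_def x_def p_def y_def \<tau>_def, folded X_def P_def E_def, folded ap_def ax_def]
  note n = pull_momentum[OF L, of b, folded k_def x_def p_def y_def \<sigma>_def, folded X_def P_def E_def, folded bp_def bx_def]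
  have pb: "dotc ap b = dotc a b + 2 * k * dotc a x * dotc b p - 2 * k * \<tau> * (dotc b x + k * X * dotc b p)"
    "dotc bp a = dotc a b + 2 * k * dotc b x * dotc a p - 2 * k * \<sigma> * (dotc a x + k * X * dotc a p)"
    unfolding ap_def bp_def dotc_simps dotc_commute[of p b] dotc_commute[of x b] dotc_commute[of p a] dotc_commute[of x a] dotc_commute[of b a]
    by (rule refl)+
  have c1: "dotc ap bx = k * P * dotc ap b - 2 * k * \<sigma> * (dotc ap p + k * P * dotc ap x)"
    unfolding bx_def dotc_simps ..
  have c2: "dotc ax bp = k * P * dotc bp a - 2 * k * \<tau> * (dotc bp p + k * P * dotc bp x)"
    unfolding dotc_commute[of ax bp] unfolding ax_def dotc_simps ..
  have "SP \<epsilon> z (pull \<epsilon> z (0, a)) (pull \<epsilon> z (0, b)) = y * y * ((1 + k * E) * (dotc ap bx - dotc ax bp)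
      + k * (dotc ap p * dotc bx x - dotc ap x * dotc bx p - dotc ax x * dotc bp p + dotc ax p * dotc bp x))"
    unfolding SP_def m(1,2) n(1,2) dotc_simps lam1_def x_def[symmetric] p_def[symmetric] k_def[symmetric] dotc_commute[of x p] E_def[symmetric]
    by algebra
  also have "\<dots> = 0"
    unfolding c1 c2 pb m(3-7) n(3-7) by algebra
  finally show ?thesis .
qed

text \<open>\<open>WP\<close> is unchanged by the pullback and \<open>Rop\<close> has real
  coefficients, so the r-part goes to its conjugate. The invariant part passes from \<epsilon> to
  -\<epsilon>, which is conjugation because \<open>kap\<close> is imaginary.\<close>

lemma pull_antipoisson:
  assumes z: "z \<in> P_real \<epsilon>"
  shows "PB \<epsilon> z (pull \<epsilon> z a) (pull \<epsilon> z b) = cnj (PB \<epsilon> z (cj a) (cj b))"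
proof -
  have L: "Lam \<epsilon> z \<noteq> 0" and T: "Theta \<epsilon> z = cj z"
    using z by (simp_all add: P_real_iff)
  have "SP \<epsilon> z (pull \<epsilon> z a) (pull \<epsilon> z b) = SP \<epsilon> z (fst a, 0) (fst b, 0) + SP \<epsilon> z (fst a, 0) (pull \<epsilon> z (0, snd b))
      + SP \<epsilon> z (pull \<epsilon> z (0, snd a)) (fst b, 0) + SP \<epsilon> z (pull \<epsilon> z (0, snd a)) (pull \<epsilon> z (0, snd b))"
    unfolding pull_split[of \<epsilon> z a] pull_split[of \<epsilon> z b] SP_add by simp
  also have "\<dots> = - SP (- \<epsilon>) (Theta \<epsilon> z) (0, snd b) (fst a, 0) + SP (- \<epsilon>) (Theta \<epsilon> z) (0, snd a) (fst b, 0)"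
    unfolding SP_swap[of \<epsilon> z "(fst a, 0)" "pull \<epsilon> z (0, snd b)"] SP_pull_px[OF L] SP_pull_pp[OF L]
    by (simp add: SP_def dotc_simps)
  also have "\<dots> = SP (- \<epsilon>) (cj z) a b"
    unfolding T SP_def fst_conv snd_conv dotc_simps dotc_commute[of "snd b" "fst a"] by algebra
  also have "\<dots> = cnj (SP \<epsilon> z (cj a) (cj b))"
  proof -
    have "dotc u (cv v) = cnj (dotc (cv u) v)" for u v :: "'a cvec"
      using dotc_cv[of u "cv v"] dotc_cv[of "cv u" v] by simp
    then show ?thesis
      by (simp add: SP_def lam1_def)
  qed
  finally have SP: "SP \<epsilon> z (pull \<epsilon> z a) (pull \<epsilon> z b) = cnj (SP \<epsilon> z (cj a) (cj b))" .
  define cm where "cm M = (\<chi> i j. cnj (M $ i $ j))" for M :: "'a cmat"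
  have wd_cj: "WP (cj z) a = cm (WP z (cj a))" for a
    by (simp add: WP_def UNIV_bool cm_def wd_def cmp_def cj_def cv_def vec_eq_iff)
  have Rop_cm: "Rop \<epsilon> (cm M) = cm (Rop \<epsilon> M)" for M
    by (simp add: Rop_def cm_def vec_eq_iff th_def)
  have trace_cm: "trace (cm A ** cm B) = cnj (trace (A ** B))" for A B
    by (simp add: trace_matrix_mult cm_def)
  show ?thesis
    unfolding PB_decompose SP WP_pull T wd_cj Rop_cm trace_cm by simp
qed

text \<open>The function f and its reflection w \<mapsto> \<open>cnj (f (psi \<epsilon> w))\<close>
  are complex differentiable at z and agree on the fixed point set, so their derivatives at z agree:
  the gradient of f is the pullback of its own conjugate. By \<open>pull_antipoisson\<close> the
  bracket equals its conjugate.\<close>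

lemma hol_bracket_real:
  fixes z :: "'n::{finite,linorder} phase"
  assumes z: "z \<in> P_real \<epsilon>" and N: "open N" "z \<in> N" and f: "hol ph_J f N" and g: "hol ph_J g N"
    and real: "\<And>w. w \<in> N \<inter> P_real \<epsilon> \<Longrightarrow> f w \<in> \<real>" "\<And>w. w \<in> N \<inter> P_real \<epsilon> \<Longrightarrow> g w \<in> \<real>"
  shows "hol_bracket \<epsilon> f g z \<in> \<real>"
proof -
  have L: "Lam \<epsilon> z \<noteq> 0" and T: "Theta \<epsilon> z = cj z"
    using z by (simp_all add: P_real_iff)
  have "hol_map (Theta \<epsilon>) (PC \<epsilon>)"
    by (rule hol_map_Theta) (simp add: PC_def)
  then obtain D where D: "(Theta \<epsilon> has_derivative D) (at z)" "\<And>v. D (ph_J v) = ph_J (D v)"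
    using L unfolding hol_map_def has_cderiv_def PC_def by blast
  have cj': "bounded_linear (cj :: 'n phase \<Rightarrow> _)"
    using linear_cj by (simp add: linear_conv_bounded_linear)
  have grad: "grad f z = pull \<epsilon> z (cj (grad f z))"
    if f: "hol ph_J f N" and real: "\<And>w. w \<in> N \<inter> P_real \<epsilon> \<Longrightarrow> f w \<in> \<real>" for f
  proof -
    have df: "has_cderiv ph_J ((*) \<i>) f (pair (grad f z)) z"
      using ph.has_cderiv_dd[OF f N(2)] unfolding dd_pair[OF f N(2)] by (simp only: eta_contract_eq)
    have psi: "(psi \<epsilon> has_derivative (\<lambda>v. cj (D v))) (at z)"
      using bounded_linear.has_derivative[OF cj' D(1)] by (simp add: psi_eq[abs_def])
    have "(f has_derivative pair (grad f z)) (at (psi \<epsilon> z))"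
      using df by (simp add: has_cderiv_def psi_eq T)
    from bounded_linear.has_derivative[OF bounded_linear_cnj has_derivative_compose[OF psi this]]
    have d: "((\<lambda>w. cnj (f (psi \<epsilon> w))) has_derivative (\<lambda>v. cnj (pair (grad f z) (cj (D v))))) (at z)" .
    have c: "cnj (pair (grad f z) (cj u)) = pair (cj (grad f z)) u" for u
    proof -
      have "dotc u (cv v) = cnj (dotc (cv u) v)" for u v :: "'n cvec"
        using dotc_cv[of u "cv v"] dotc_cv[of "cv u" v] by simp
      then show ?thesis by (simp add: pair_def)
    qed
    have "((\<lambda>w. cnj (f (psi \<epsilon> w))) has_derivative pair (pull \<epsilon> z (cj (grad f z)))) (at z)"
      using d unfolding c pair_pull[OF L D(1)] by (simp only: eta_contract_eq)
    moreover have J: "pair \<alpha> (ph_J v) = \<i> * pair \<alpha> v" for \<alpha> v :: "'n phase"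
      by (simp add: pair_def ph_J_def dotc_simps distrib_left)
    ultimately have "has_cderiv ph_J ((*) \<i>) (\<lambda>w. cnj (f (psi \<epsilon> w))) (pair (pull \<epsilon> z (cj (grad f z)))) z"
      by (simp add: has_cderiv_def)
    from has_cderiv_diff[OF df this]
    have diff: "has_cderiv ph_J ((*) \<i>) (\<lambda>w. f w - cnj (f (psi \<epsilon> w)))
      (\<lambda>v. pair (grad f z) v - pair (pull \<epsilon> z (cj (grad f z))) v) z" .
    have "pair (grad f z) v - pair (pull \<epsilon> z (cj (grad f z))) v = 0" for v
    proof (rule cderiv_zero_on_P[OF z diff N])
      fix w assume w: "w \<in> N \<inter> P_real \<epsilon>"
      then have "psi \<epsilon> w = w" by (simp add: P_real_def)
      then show "f w - cnj (f (psi \<epsilon> w)) = 0"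
        using real[OF w] by (simp add: Reals_cnj_iff)
    qed
    then have eq: "pair (grad f z) v = pair (pull \<epsilon> z (cj (grad f z))) v" for v
      by simp
    have comp: "pair \<alpha> (axis j 1, 0) = fst \<alpha> $ j" "pair \<alpha> (0, axis j 1) = snd \<alpha> $ j" for \<alpha> :: "'n phase" and j
      by (simp_all add: pair_def dotc_def axis_def if_distrib[of "\<lambda>x. _ * x"] cong: if_cong)
    show ?thesis
      using eq[of "(axis _ 1, 0)"] eq[of "(0, axis _ 1)"] unfolding comp
      by (simp add: prod_eq_iff vec_eq_iff)
  qed
  have "hol_bracket \<epsilon> f g z = PB \<epsilon> z (pull \<epsilon> z (cj (grad f z))) (pull \<epsilon> z (cj (grad g z)))"
    unfolding hol_bracket_eq_PB using grad[OF f real(1)] grad[OF g real(2)] by simp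
  also have "\<dots> = cnj (hol_bracket \<epsilon> f g z)"
    unfolding pull_antipoisson[OF z] hol_bracket_eq_PB by simp
  finally show ?thesis
    by (simp add: Reals_cnj_iff)
qed

section \<open>The bracket on the fixed point set\<close>

lemma local_extension_iff:
  "local_hol_extension \<epsilon> U f\<^sub>0 N f \<longleftrightarrow> open N \<and> N \<subseteq> PC \<epsilon> \<and> hol ph_J f N \<and> (\<forall>y\<in>N \<inter> U. f y = of_real (f\<^sub>0 y))"
  unfolding local_hol_extension_def holomorphic_phase_iff ..

lemma local_extension_mono:
  assumes "local_hol_extension \<epsilon> U f\<^sub>0 N f" "open M" "M \<subseteq> N"
  shows "local_hol_extension \<epsilon> U f\<^sub>0 M f"
  using assms hol_subset[of ph_J f N M] unfolding local_extension_iff by (auto simp: subset_eq)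

lemma local_extension_exists:
  assumes U: "openin (top_of_set (P_real \<epsilon>)) U" and f: "real_analytic_on f\<^sub>0 U" and z: "z \<in> U"
  shows "\<exists>N f. z \<in> N \<and> local_hol_extension \<epsilon> U f\<^sub>0 N f"
proof -
  have UP: "U \<subseteq> P_real \<epsilon>" using openin_imp_subset[OF U] .
  obtain N\<^sub>0 F where F: "open N\<^sub>0" "z \<in> N\<^sub>0" "\<And>y. y \<in> N\<^sub>0 \<Longrightarrow> real_analytic_at F y" "\<And>y. y \<in> N\<^sub>0 \<inter> U \<Longrightarrow> F y = f\<^sub>0 y"
    using f z unfolding real_analytic_on_def by metis
  obtain N g where g: "open N" "z \<in> N" "N \<subseteq> PC \<epsilon>" "hol ph_J g N" "\<And>w. w \<in> N \<inter> P_real \<epsilon> \<Longrightarrow> g w = of_real (F w)"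
    using hol_extension_at[OF subsetD[OF UP z] F(3)[OF F(2)]] by metis
  have "local_hol_extension \<epsilon> U f\<^sub>0 (N \<inter> N\<^sub>0) g"
    unfolding local_extension_iff using F(1,4) g(1,3,5) UP hol_subset[OF g(4), of "N \<inter> N\<^sub>0"] by auto
  then show ?thesis using F(2) g(2) by blast
qed

lemma grad_local_extension:
  assumes U: "openin (top_of_set (P_real \<epsilon>)) U"
    and f: "local_hol_extension \<epsilon> U f\<^sub>0 N f" and g: "local_hol_extension \<epsilon> U f\<^sub>0 M g" and z: "z \<in> N" "z \<in> M" "z \<in> U"
  shows "grad f z = grad g z"
proof -
  obtain T where T: "open T" "U = P_real \<epsilon> \<inter> T"
    using U by (auto simp: openin_open)
  have "z \<in> P_real \<epsilon>" "hol ph_J f N" "hol ph_J g M" and N: "open (N \<inter> M \<inter> T)" "z \<in> N \<inter> M \<inter> T"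
    using z f g T by (auto simp: local_extension_iff)
  moreover have "f w = g w" if "w \<in> N \<inter> M \<inter> T \<inter> P_real \<epsilon>" for w
    using that f g T(2) by (auto simp: local_extension_iff)
  ultimately show ?thesis
    using grad_eq_on_P[OF _ _ z(1) _ z(2) N] by blast
qed

text \<open>Chosen separately at every point. The bracket uses only the gradient at z, which by
  \<open>grad_local_extension\<close> is independent of the choice.\<close>

definition some_extension :: "real \<Rightarrow> 'n::finite phase set \<Rightarrow> ('n phase \<Rightarrow> real) \<Rightarrow> 'n phase \<Rightarrow> 'n phase \<Rightarrow> complex" where
  "some_extension \<epsilon> U f\<^sub>0 z = (SOME f. \<exists>N. z \<in> N \<and> local_hol_extension \<epsilon> U f\<^sub>0 N f)"

definition real_bracket ::
  "real \<Rightarrow> 'n::{finite,linorder} phase set \<Rightarrow> ('n phase \<Rightarrow> real) \<Rightarrow> ('n phase \<Rightarrow> real) \<Rightarrow> 'n phase \<Rightarrow> real" where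
  "real_bracket \<epsilon> U f\<^sub>0 g\<^sub>0 z = Re (hol_bracket \<epsilon> (some_extension \<epsilon> U f\<^sub>0 z) (some_extension \<epsilon> U g\<^sub>0 z) z)"

lemma hol_bracket_local_extension:
  assumes U: "openin (top_of_set (P_real \<epsilon>)) U"
    and f: "local_hol_extension \<epsilon> U f\<^sub>0 N f" and g: "local_hol_extension \<epsilon> U g\<^sub>0 N g" and z: "z \<in> N" "z \<in> U"
  shows "hol_bracket \<epsilon> f g z = of_real (real_bracket \<epsilon> U f\<^sub>0 g\<^sub>0 z)"
proof -
  have grad: "grad (some_extension \<epsilon> U h\<^sub>0 z) z = grad h z" if h: "local_hol_extension \<epsilon> U h\<^sub>0 N h" for h\<^sub>0 h
  proof -
    have "\<exists>M. z \<in> M \<and> local_hol_extension \<epsilon> U h\<^sub>0 M (some_extension \<epsilon> U h\<^sub>0 z)"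
      unfolding some_extension_def by (rule someI[of _ h]) (use h z in blast)
    then obtain M where "z \<in> M" "local_hol_extension \<epsilon> U h\<^sub>0 M (some_extension \<epsilon> U h\<^sub>0 z)"
      by blast
    then show ?thesis
      using grad_local_extension[OF U _ h] z by blast
  qed
  obtain T where T: "open T" "U = P_real \<epsilon> \<inter> T"
    using U by (auto simp: openin_open)
  have "z \<in> P_real \<epsilon>" "open (N \<inter> T)" "z \<in> N \<inter> T" "hol ph_J f (N \<inter> T)" "hol ph_J g (N \<inter> T)"
    using z f g T hol_subset[of ph_J _ N "N \<inter> T"] by (auto simp: local_extension_iff)
  moreover have "f w \<in> \<real>" "g w \<in> \<real>" if "w \<in> N \<inter> T \<inter> P_real \<epsilon>" for w
    using that f g T(2) by (auto simp: local_extension_iff)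
  ultimately have "hol_bracket \<epsilon> f g z \<in> \<real>"
    by (rule hol_bracket_real)
  moreover have "hol_bracket \<epsilon> (some_extension \<epsilon> U f\<^sub>0 z) (some_extension \<epsilon> U g\<^sub>0 z) z = hol_bracket \<epsilon> f g z"
    unfolding hol_bracket_eq_PB grad[OF f] grad[OF g] ..
  ultimately show ?thesis
    by (simp add: real_bracket_def of_real_Re)
qed

text \<open>The bracket of extensions extends the bracket on the same neighbourhood, so brackets can
  be nested; this carries both its analyticity and the Jacobi identity.\<close>

lemma local_extension_bracket:
  assumes U: "openin (top_of_set (P_real \<epsilon>)) U"
    and f: "local_hol_extension \<epsilon> U f\<^sub>0 N f" and g: "local_hol_extension \<epsilon> U g\<^sub>0 N g"
  shows "local_hol_extension \<epsilon> U (real_bracket \<epsilon> U f\<^sub>0 g\<^sub>0) N (hol_bracket \<epsilon> f g)"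
  using f g hol_hol_bracket[of f N g] hol_bracket_local_extension[OF U f g] unfolding local_extension_iff by auto

lemma hol_bracket_dd:
  assumes "hol ph_J g N" "z \<in> N"
  shows "hol_bracket \<epsilon> f g z = ph.dd g (Ham \<epsilon> z (grad f z)) z"
  unfolding hol_bracket_eq_PB PB_eq_pair dd_pair[OF assms] ..

lemma hol_bracket_antisym: "hol_bracket \<epsilon> g f z = - hol_bracket \<epsilon> f g z"
  unfolding hol_bracket_eq_PB by (rule PB_swap)

lemma common_local_extensions:
  assumes U: "openin (top_of_set (P_real \<epsilon>)) U" and z: "z \<in> U"
    and f: "real_analytic_on f\<^sub>0 U" and g: "real_analytic_on g\<^sub>0 U" and h: "real_analytic_on h\<^sub>0 U"
  obtains N f g h where "z \<in> N" "local_hol_extension \<epsilon> U f\<^sub>0 N f" "local_hol_extension \<epsilon> U g\<^sub>0 N g" "local_hol_extension \<epsilon> U h\<^sub>0 N h"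
proof -
  obtain N\<^sub>1 f where 1: "z \<in> N\<^sub>1" "local_hol_extension \<epsilon> U f\<^sub>0 N\<^sub>1 f"
    using local_extension_exists[OF U f z] by blast
  obtain N\<^sub>2 g where 2: "z \<in> N\<^sub>2" "local_hol_extension \<epsilon> U g\<^sub>0 N\<^sub>2 g"
    using local_extension_exists[OF U g z] by blast
  obtain N\<^sub>3 h where 3: "z \<in> N\<^sub>3" "local_hol_extension \<epsilon> U h\<^sub>0 N\<^sub>3 h"
    using local_extension_exists[OF U h z] by blast
  have O: "open (N\<^sub>1 \<inter> N\<^sub>2 \<inter> N\<^sub>3)"
    using 1 2 3 by (auto simp: local_extension_iff)
  show ?thesis
  proof (rule that)
    show "z \<in> N\<^sub>1 \<inter> N\<^sub>2 \<inter> N\<^sub>3"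
      using 1(1) 2(1) 3(1) by blast
    show "local_hol_extension \<epsilon> U f\<^sub>0 (N\<^sub>1 \<inter> N\<^sub>2 \<inter> N\<^sub>3) f"
      by (rule local_extension_mono[OF 1(2) O]) blast
    show "local_hol_extension \<epsilon> U g\<^sub>0 (N\<^sub>1 \<inter> N\<^sub>2 \<inter> N\<^sub>3) g"
      by (rule local_extension_mono[OF 2(2) O]) blast
    show "local_hol_extension \<epsilon> U h\<^sub>0 (N\<^sub>1 \<inter> N\<^sub>2 \<inter> N\<^sub>3) h"
      by (rule local_extension_mono[OF 3(2) O]) blast
  qed
qed

text \<open>Every axiom for the bracket except analyticity is checked at one point, on a
  neighbourhood with common holomorphic extensions, where it follows from the properties of
  \<open>hol_bracket\<close>.\<close>

lemma real_analytic_poisson_P_real: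
  "real_analytic_poisson_manifold (P_real \<epsilon> :: 'n::{finite,linorder} phase set)
     TYPE((real ^ 'n::{finite,linorder}) \<times> (real ^ 'n::{finite,linorder})) (real_bracket \<epsilon>)"
proof
  show "real_analytic_submanifold (P_real \<epsilon> :: 'n phase set) TYPE((real ^ 'n::{finite,linorder}) \<times> (real ^ 'n::{finite,linorder}))"
    by (rule P_real_submanifold)
next
  fix U :: "'n phase set" and f g :: "'n phase \<Rightarrow> real"
  assume U: "openin (top_of_set (P_real \<epsilon>)) U" and f: "real_analytic_on f U" and g: "real_analytic_on g U"
  show "real_analytic_on (real_bracket \<epsilon> U f g) U"
    unfolding real_analytic_on_def
  proof
    fix a assume a: "a \<in> U"
    obtain N F G H where N: "a \<in> N" and F: "local_hol_extension \<epsilon> U f N F" and G: "local_hol_extension \<epsilon> U g N G"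
      using common_local_extensions[OF U a f g g] by metis
    have "local_hol_extension \<epsilon> U (real_bracket \<epsilon> U f g) N (hol_bracket \<epsilon> F G)"
      by (rule local_extension_bracket[OF U F G])
    then have B: "open N" "hol ph_J (hol_bracket \<epsilon> F G) N" "\<And>y. y \<in> N \<inter> U \<Longrightarrow> hol_bracket \<epsilon> F G y = of_real (real_bracket \<epsilon> U f g y)"
      unfolding local_extension_iff by blast+
    show "\<exists>N F. open N \<and> a \<in> N \<and> (\<forall>y\<in>N. real_analytic_at F y) \<and> (\<forall>y\<in>N \<inter> U. F y = real_bracket \<epsilon> U f g y)"
      using N B real_analytic_at_Re[OF B(2,1)] by (intro exI[of _ N] exI[of _ "\<lambda>x. Re (hol_bracket \<epsilon> F G x)"]) simp
  qed
next
  fix U V :: "'n phase set" and f g f' g' :: "'n phase \<Rightarrow> real" and z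
  assume U: "openin (top_of_set (P_real \<epsilon>)) U" and V: "openin (top_of_set (P_real \<epsilon>)) V" "V \<subseteq> U"
    and f: "real_analytic_on f U" and g: "real_analytic_on g U"
    and eq: "\<forall>y\<in>V. f' y = f y" "\<forall>y\<in>V. g' y = g y" and z: "z \<in> V"
  obtain N F G H where N: "z \<in> N" and F: "local_hol_extension \<epsilon> U f N F" and G: "local_hol_extension \<epsilon> U g N G"
    using common_local_extensions[OF U subsetD[OF V(2) z] f g g] by metis
  have "local_hol_extension \<epsilon> V f' N F" "local_hol_extension \<epsilon> V g' N G"
    using F G eq V(2) unfolding local_extension_iff by auto
  then have "complex_of_real (real_bracket \<epsilon> V f' g' z) = of_real (real_bracket \<epsilon> U f g z)"
    using hol_bracket_local_extension[OF V(1) _ _ N z] hol_bracket_local_extension[OF U F G N subsetD[OF V(2) z]] by simp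
  then show "real_bracket \<epsilon> V f' g' z = real_bracket \<epsilon> U f g z"
    by simp
next
  fix U :: "'n phase set" and f g h :: "'n phase \<Rightarrow> real" and z and a b :: real
  assume U: "openin (top_of_set (P_real \<epsilon>)) U" and z: "z \<in> U"
    and f: "real_analytic_on f U" and g: "real_analytic_on g U" and h: "real_analytic_on h U"
  obtain N F G H where N: "z \<in> N" and F: "local_hol_extension \<epsilon> U f N F" and G: "local_hol_extension \<epsilon> U g N G"
    and H: "local_hol_extension \<epsilon> U h N H"
    using common_local_extensions[OF U z f g h] by metis
  have hol: "hol ph_J F N" "hol ph_J G N" "hol ph_J H N" "open N"
    and val: "F z = of_real (f z)" "G z = of_real (g z)" "H z = of_real (h z)"
    using F G H N z by (auto simp: local_extension_iff)
  note br = hol_bracket_local_extension[OF U _ _ N z, symmetric]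
  note d = ph.has_cderiv_dd[OF hol(1) N] ph.has_cderiv_dd[OF hol(2) N] ph.has_cderiv_dd[OF hol(3) N]
  have lin: "local_hol_extension \<epsilon> U (\<lambda>y. a * f y + b * g y) N (\<lambda>y. of_real a * F y + of_real b * G y)"
    using F G by (auto simp: local_extension_iff intro!: hol_intros)
  have dlin: "ph.dd (\<lambda>y. of_real a * F y + of_real b * G y) v z = of_real a * ph.dd F v z + of_real b * ph.dd G v z" for v
    using ph.dd_eq[OF has_cderiv_add[OF has_cderiv_mult[OF has_cderiv_const d(1)] has_cderiv_mult[OF has_cderiv_const d(2)]]] by simp
  \<comment> \<open>\<open>hol_bracket_dd\<close> expresses the bracket as a derivative of its
    second argument, so linearity in the first one is obtained by antisymmetry.\<close>
  have "complex_of_real (real_bracket \<epsilon> U (\<lambda>y. a * f y + b * g y) h z) = - hol_bracket \<epsilon> H (\<lambda>y. of_real a * F y + of_real b * G y) z"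
    unfolding br[OF lin H] by (rule hol_bracket_antisym)
  also have "\<dots> = of_real a * - hol_bracket \<epsilon> H F z + of_real b * - hol_bracket \<epsilon> H G z"
    using lin unfolding local_extension_iff
    by (simp add: hol_bracket_dd[OF _ N] hol dlin)
  also have "\<dots> = of_real (a * real_bracket \<epsilon> U f h z + b * real_bracket \<epsilon> U g h z)"
    unfolding hol_bracket_antisym[symmetric] by (simp add: br[OF F H] br[OF G H])
  finally show "real_bracket \<epsilon> U (\<lambda>y. a * f y + b * g y) h z = a * real_bracket \<epsilon> U f h z + b * real_bracket \<epsilon> U g h z"
    using of_real_eq_iff by blast
next
  fix U :: "'n phase set" and f g :: "'n phase \<Rightarrow> real" and z
  assume U: "openin (top_of_set (P_real \<epsilon>)) U" and z: "z \<in> U" and f: "real_analytic_on f U" and g: "real_analytic_on g U"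
  obtain N F G H where N: "z \<in> N" and F: "local_hol_extension \<epsilon> U f N F" and G: "local_hol_extension \<epsilon> U g N G"
    using common_local_extensions[OF U z f g g] by metis
  note br = hol_bracket_local_extension[OF U _ _ N z, symmetric]
  have "complex_of_real (real_bracket \<epsilon> U g f z) = of_real (- real_bracket \<epsilon> U f g z)"
    unfolding br[OF G F] of_real_minus br[OF F G] by (rule hol_bracket_antisym)
  then show "real_bracket \<epsilon> U g f z = - real_bracket \<epsilon> U f g z"
    using of_real_eq_iff by blast
next
  fix U :: "'n phase set" and f g h :: "'n phase \<Rightarrow> real" and z
  assume U: "openin (top_of_set (P_real \<epsilon>)) U" and z: "z \<in> U"
    and f: "real_analytic_on f U" and g: "real_analytic_on g U" and h: "real_analytic_on h U"
  obtain N F G H where N: "z \<in> N" and F: "local_hol_extension \<epsilon> U f N F" and G: "local_hol_extension \<epsilon> U g N G"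
    and H: "local_hol_extension \<epsilon> U h N H"
    using common_local_extensions[OF U z f g h] by metis
  have hol: "hol ph_J F N" "hol ph_J G N" "hol ph_J H N" "open N"
    and val: "F z = of_real (f z)" "G z = of_real (g z)" "H z = of_real (h z)"
    using F G H N z by (auto simp: local_extension_iff)
  note br = hol_bracket_local_extension[OF U _ _ N z, symmetric]
  note d = ph.has_cderiv_dd[OF hol(2) N] ph.has_cderiv_dd[OF hol(3) N]
  have prod: "local_hol_extension \<epsilon> U (\<lambda>y. g y * h y) N (\<lambda>y. G y * H y)"
    using G H by (auto simp: local_extension_iff intro!: hol_mult)
  have "complex_of_real (real_bracket \<epsilon> U f (\<lambda>y. g y * h y) z) = hol_bracket \<epsilon> F (\<lambda>y. G y * H y) z"
    by (rule br[OF F prod])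
  also have "\<dots> = hol_bracket \<epsilon> F G z * H z + G z * hol_bracket \<epsilon> F H z"
    using prod ph.dd_eq[OF has_cderiv_mult[OF d]] unfolding local_extension_iff
    by (simp add: hol_bracket_dd[OF _ N] hol)
  also have "\<dots> = of_real (real_bracket \<epsilon> U f g z * h z + g z * real_bracket \<epsilon> U f h z)"
    by (simp add: br[OF F G] br[OF F H] val)
  finally show "real_bracket \<epsilon> U f (\<lambda>y. g y * h y) z = real_bracket \<epsilon> U f g z * h z + g z * real_bracket \<epsilon> U f h z"
    using of_real_eq_iff by blast
next
  fix U :: "'n phase set" and f g h :: "'n phase \<Rightarrow> real" and z
  assume U: "openin (top_of_set (P_real \<epsilon>)) U" and z: "z \<in> U"
    and f: "real_analytic_on f U" and g: "real_analytic_on g U" and h: "real_analytic_on h U"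
  obtain N F G H where N: "z \<in> N" and F: "local_hol_extension \<epsilon> U f N F" and G: "local_hol_extension \<epsilon> U g N G"
    and H: "local_hol_extension \<epsilon> U h N H"
    using common_local_extensions[OF U z f g h] by metis
  have hol: "hol ph_J F N" "hol ph_J G N" "hol ph_J H N" "open N"
    using F G H by (auto simp: local_extension_iff)
  note br = hol_bracket_local_extension[OF U _ _ N z, symmetric]
  note ext = local_extension_bracket[OF U]
  have "complex_of_real (real_bracket \<epsilon> U f (real_bracket \<epsilon> U g h) z + real_bracket \<epsilon> U g (real_bracket \<epsilon> U h f) z
      + real_bracket \<epsilon> U h (real_bracket \<epsilon> U f g) z) = 0"
    unfolding of_real_add br[OF F ext[OF G H]] br[OF G ext[OF H F]] br[OF H ext[OF F G]]
    by (rule hol_bracket_jacobi[OF hol N])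
  then show "real_bracket \<epsilon> U f (real_bracket \<epsilon> U g h) z + real_bracket \<epsilon> U g (real_bracket \<epsilon> U h f) z
      + real_bracket \<epsilon> U h (real_bracket \<epsilon> U f g) z = 0"
    using of_real_eq_0_iff by blast
qed

text \<open>The existence of local extensions keeps the last clause from being vacuous. On a common
  smaller neighbourhood the two clauses together determine the bracket of analytic functions at
  every point.\<close>

theorem mainTheorem8:
  fixes \<epsilon> :: real
    and P :: "'n::{finite,linorder} phase set"
  assumes "P = P_real \<epsilon>"
  shows "\<exists>br. real_analytic_poisson_manifold P
      TYPE((real ^ 'n::{finite,linorder}) \<times> (real ^ 'n::{finite,linorder})) br \<and>
    (\<forall>U f\<^sub>0. openin (top_of_set P) U \<and> real_analytic_on f\<^sub>0 U \<longrightarrow>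
       (\<forall>z\<in>U. \<exists>N f. z \<in> N \<and> local_hol_extension \<epsilon> U f\<^sub>0 N f)) \<and>
    (\<forall>U f\<^sub>0 g\<^sub>0 N f g. openin (top_of_set P) U \<and>
       real_analytic_on f\<^sub>0 U \<and> real_analytic_on g\<^sub>0 U \<and>
       local_hol_extension \<epsilon> U f\<^sub>0 N f \<and> local_hol_extension \<epsilon> U g\<^sub>0 N g \<longrightarrow>
       (\<forall>z\<in>N \<inter> U. hol_bracket \<epsilon> f g z \<in> \<real> \<and>
          hol_bracket \<epsilon> f g z = of_real (br U f\<^sub>0 g\<^sub>0 z)))"
  unfolding assms
proof (intro exI[of _ "real_bracket \<epsilon>"] conjI)
  show "real_analytic_poisson_manifold (P_real \<epsilon> :: 'n phase set)
      TYPE((real ^ 'n::{finite,linorder}) \<times> (real ^ 'n::{finite,linorder})) (real_bracket \<epsilon>)"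
    by (rule real_analytic_poisson_P_real)
  show "\<forall>U f\<^sub>0. openin (top_of_set (P_real \<epsilon> :: 'n phase set)) U \<and> real_analytic_on f\<^sub>0 U \<longrightarrow>
      (\<forall>z\<in>U. \<exists>N f. z \<in> N \<and> local_hol_extension \<epsilon> U f\<^sub>0 N f)"
    using local_extension_exists by blast
  have "hol_bracket \<epsilon> f g z \<in> \<real> \<and> hol_bracket \<epsilon> f g z = of_real (real_bracket \<epsilon> U f\<^sub>0 g\<^sub>0 z)"
    if "openin (top_of_set (P_real \<epsilon>)) U" "local_hol_extension \<epsilon> U f\<^sub>0 N f" "local_hol_extension \<epsilon> U g\<^sub>0 N g" "z \<in> N \<inter> U"
    for U :: "'n phase set" and f\<^sub>0 g\<^sub>0 N f g z
    using hol_bracket_local_extension[OF that(1-3)] that(4) by simp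
  then show "\<forall>U f\<^sub>0 g\<^sub>0 N f g. openin (top_of_set (P_real \<epsilon> :: 'n phase set)) U \<and>
       real_analytic_on f\<^sub>0 U \<and> real_analytic_on g\<^sub>0 U \<and>
       local_hol_extension \<epsilon> U f\<^sub>0 N f \<and> local_hol_extension \<epsilon> U g\<^sub>0 N g \<longrightarrow>
       (\<forall>z\<in>N \<inter> U. hol_bracket \<epsilon> f g z \<in> \<real> \<and> hol_bracket \<epsilon> f g z = of_real (real_bracket \<epsilon> U f\<^sub>0 g\<^sub>0 z))"
    by blast
qed

end
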